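(* Let $m$ and $t\ge 12$ be positive integers satisfying $\binom{t-1}{3} \le m \le \binom{t-1}{3} + \binom{t-2}{2}-6$. Let $H$ be a $3$-graph with $m$ edges. If all but two edges of $[t-1]^{(3)}$ are in $H$, then $H$ is not dense.
   Context: For a finite set $V$, $V^{(3)}$ denotes the family of all $3$-element subsets of $V$; $[n]=\{1,\dots,n\}$. A $3$-graph $G$ consists of a finite vertex set $V(G)$ and an edge set $E(G)\subseteq V(G)^{(3)}$; vertex sets are taken of the form $[n]$. $H$ is a subgraph of $G$ if $V(H)\subseteq V(G)$ and $E(H)\subseteq E(G)$. $[n]^{(3)}$ also denotes the complete $3$-graph on $[n]$. For a $3$-graph $G$ with vertex set $[n]$ and $\vec x=(x_1,\dots,x_n)\in\mathbb R^n$, let $\lambda(G,\vec x)=\sum_{e\in E(G)}\prod_{i\in e}x_i$. The Lagrangian of $G$ is $\lambda(G)=\max\{\lambda(G,\vec x): \sum_{i=1}^n x_i=1,\ x_i\ge 0 \text{ for all } i\}$ (and analogously for an arbitrary finite vertex set). A $3$-graph $G$ is dense if every proper subgraph $G'$ of $G$ satisfies $\lambda(G')<\lambda(G)$ (equivalently, no optimum weighting of $G$ has a zero coordinate). *)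

theory Defs
  imports "HOL-Analysis.Analysis" "HOL-Library.Ramsey"
begin

datatype 'a three_graph = Three_Graph (verts: "'a set") (edges: "'a set set")

definition is_three_graph :: "'a three_graph \<Rightarrow> bool" where
  "is_three_graph G \<longleftrightarrow> finite (verts G) \<and> edges G \<subseteq> nsets (verts G) 3"

definition subgraph :: "'a three_graph \<Rightarrow> 'a three_graph \<Rightarrow> bool" where
  "subgraph H G \<longleftrightarrow> is_three_graph H \<and> is_three_graph G \<and>
     verts H \<subseteq> verts G \<and> edges H \<subseteq> edges G"

definition lagrange_poly :: "'a three_graph \<Rightarrow> ('a \<Rightarrow> real) \<Rightarrow> real" where
  "lagrange_poly G x = (\<Sum>e\<in>edges G. \<Prod>i\<in>e. x i)"

text \<open>A weighting of \<open>V\<close> is a total function; its values outside \<open>V\<close> are unconstrained and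
  do not matter, as edges of a 3-graph are subsets of the vertex set.\<close>

definition weightings :: "'a set \<Rightarrow> ('a \<Rightarrow> real) set" where
  "weightings V = {x. (\<forall>i\<in>V. 0 \<le> x i) \<and> (\<Sum>i\<in>V. x i) = 1}"

text \<open>The supremum is a maximum whenever the vertex set is nonempty; see
  \<open>lagrangian_attained\<close> and \<open>lagrange_poly_le_lagrangian\<close> below.\<close>

definition lagrangian :: "'a three_graph \<Rightarrow> real" where
  "lagrangian G = (SUP x\<in>weightings (verts G). lagrange_poly G x)"

text \<open>The graph without vertices admits no weighting, so it has no Lagrangian; it is therefore
  excluded from the subgraphs that are compared with \<open>G\<close>.\<close>

definition dense :: "'a three_graph \<Rightarrow> bool" where
  "dense G \<longleftrightarrow> (\<forall>G'. subgraph G' G \<and> G' \<noteq> G \<and> verts G' \<noteq> {} \<longrightarrow>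
     lagrangian G' < lagrangian G)"

lemma lagrange_poly_max:
  assumes G: "is_three_graph G" and ne: "verts G \<noteq> {}"
  shows "\<exists>x\<in>weightings (verts G). \<forall>y\<in>weightings (verts G).
    lagrange_poly G y \<le> lagrange_poly G x"
proof -
  define V where "V = verts G"
  define B where "B = PiE UNIV (\<lambda>i. if i \<in> V then {0..1::real} else {0})"
  define S where "S = B \<inter> {x. (\<Sum>i\<in>V. x i) = 1}"
  have S_iff: "x \<in> S \<longleftrightarrow> (\<forall>i. if i \<in> V then 0 \<le> x i \<and> x i \<le> 1 else x i = 0) \<and> (\<Sum>i\<in>V. x i) = 1"
    for x
    unfolding S_def B_def by (simp add: PiE_iff if_distrib[of "\<lambda>A. _ \<in> A"] cong: if_cong)
  have fin: "finite V" and E: "edges G \<subseteq> nsets V 3"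
    using G by (auto simp: is_three_graph_def V_def)
  have e: "e \<subseteq> V" if "e \<in> edges G" for e
    using that E by (auto simp: nsets_def)
  have coord: "continuous_on A (\<lambda>x::'a \<Rightarrow> real. x i)" for A i
    by (rule continuous_on_subset[OF continuous_on_product_coordinates]) simp
  have "compactin (product_topology (\<lambda>_::'a. euclidean :: real topology) UNIV) B"
    unfolding B_def compactin_PiE by simp
  then have "compact B"
    by (simp add: euclidean_product_topology)
  moreover have "closed {x::'a \<Rightarrow> real. (\<Sum>i\<in>V. x i) = 1}"
    by (intro closed_Collect_eq continuous_on_sum coord continuous_on_const)
  ultimately have cS: "compact S"
    unfolding S_def by (rule compact_Int_closed)
  obtain v where v: "v \<in> V" using ne V_def by blast
  have "(\<lambda>i. if i = v then 1 else 0) \<in> S"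
    unfolding S_iff using v fin by simp
  then have neS: "S \<noteq> {}" by blast
  have "continuous_on S (lagrange_poly G)"
    unfolding lagrange_poly_def[abs_def]
    by (intro continuous_on_sum continuous_on_prod coord)
  from continuous_attains_sup[OF cS neS this]
  obtain x where x: "x \<in> S" and mx: "\<And>y. y \<in> S \<Longrightarrow> lagrange_poly G y \<le> lagrange_poly G x"
    by blast
  have xw: "x \<in> weightings V"
    using x unfolding S_iff weightings_def by simp
  have "lagrange_poly G y \<le> lagrange_poly G x" if y: "y \<in> weightings V" for y
  proof -
    define z where "z = (\<lambda>i. if i \<in> V then y i else 0)"
    have y0: "\<And>i. i \<in> V \<Longrightarrow> 0 \<le> y i" and y1: "(\<Sum>i\<in>V. y i) = 1"
      using y by (simp_all add: weightings_def)
    have le1: "y i \<le> 1" if "i \<in> V" for i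
      using member_le_sum[of i V y] that fin y0 y1 by simp
    have "z \<in> S" unfolding S_iff z_def using y0 y1 le1 by simp
    moreover have "(\<Prod>i\<in>a. z i) = (\<Prod>i\<in>a. y i)" if "a \<in> edges G" for a
      using e[OF that] by (intro prod.cong) (auto simp: z_def)
    then have "lagrange_poly G z = lagrange_poly G y"
      unfolding lagrange_poly_def by (rule sum.cong[OF refl])
    ultimately show ?thesis using mx[of z] by simp
  qed
  with xw show ?thesis unfolding V_def by blast
qed

lemma lagrangian_attained:
  assumes "is_three_graph G" and "verts G \<noteq> {}"
  shows "\<exists>x\<in>weightings (verts G). lagrange_poly G x = lagrangian G"
proof -
  obtain x where x: "x \<in> weightings (verts G)"
    "\<And>y. y \<in> weightings (verts G) \<Longrightarrow> lagrange_poly G y \<le> lagrange_poly G x"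
    using lagrange_poly_max[OF assms] by blast
  have "lagrangian G = lagrange_poly G x"
    unfolding lagrangian_def using x by (intro cSup_eq_maximum) auto
  with x(1) show ?thesis by metis
qed

lemma lagrange_poly_le_lagrangian:
  assumes "is_three_graph G" and "x \<in> weightings (verts G)"
  shows "lagrange_poly G x \<le> lagrangian G"
proof -
  have "verts G \<noteq> {}" using assms(2) by (auto simp: weightings_def)
  from lagrange_poly_max[OF assms(1) this]
  have "bdd_above (lagrange_poly G ` weightings (verts G))"
    unfolding bdd_above_def by blast
  then show ?thesis
    unfolding lagrangian_def by (rule cSUP_upper[OF assms(2)])
qed

end

theory Submission
  imports Defs
begin

text \<open>Write \<open>A = [t - 1]\<close>, \<open>N = card A\<close> and \<open>\<lambda>\<close> for the Lagrangian of \<open>H\<close>. Suppose that \<open>H\<close> is dense, and let \<open>x\<close> be an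
optimal weighting. All weights are positive, so by Lagrange multipliers every vertex has weighted
degree \<open>3 * \<lambda>\<close>. The edges of \<open>H\<close> inside \<open>A\<close> form a proper subgraph, whose Lagrangian \<open>\<mu>\<close> is therefore less
than \<open>\<lambda>\<close>; the uniform weighting of \<open>A\<close> shows that \<open>\<mu>\<close> is almost that of the complete 3-graph. On the
other hand at most \<open>(N - 1 choose 2) - 4\<close> edges leave \<open>A\<close>. These facts contradict each other, for three
different reasons.

If at least two vertices lie outside \<open>A\<close>, the links of two of them share these few edges, so by Cauchy-Schwarz the
remaining weights must be concentrated (their squares have a large sum); but then the third
elementary symmetric function is too small for the optimum. This is
\<open>no_two_outer_vertices\<close>.

If only \<open>t\<close> lies outside \<open>A\<close>, let \<open>M\<close> be the set of pairs of \<open>A\<close> that are missing from the link of \<open>t\<close>; it has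
at least \<open>N + 3\<close> elements. Let \<open>i\<close> be a lightest vertex of \<open>A\<close>, of weight \<open>\<alpha>\<close>, let \<open>d\<close> be the number of its
neighbours in the link of \<open>t\<close>, and let \<open>P\<close> be the degree of \<open>i\<close> in the two missing triples. Comparing the
degrees of \<open>i\<close> and \<open>t\<close>, and bounding the other weights by comparing their degrees with that of \<open>i\<close>,
shows that the weight of the at least \<open>4 + d\<close> pairs of \<open>M\<close> that avoid \<open>i\<close> is at most about
\<open>d * \<alpha>\<^sup>2 + 2 * P\<close> (lemma \<open>pivot\<close>). Each of these pairs weighs at least \<open>\<alpha>\<^sup>2\<close>, so there is a surplus of four pairs
with which \<open>P\<close> has to be beaten. If no missing triple contains \<open>i\<close> this is immediate.

If the two missing triples meet, one may pass to a graph of maximal Lagrangian among all graphs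
with at least \<open>N + 3\<close> missing pairs and a pair of missing triples of the same type. For an optimal
weighting of such a graph the missing triples may be moved to the lightest vertices without any loss,
in such a way that both contain \<open>i\<close>. Then \<open>P\<close> is made of lightest pairs and the surplus suffices
(\<open>lagrangian_le_clique_if_missing_meet\<close>). If the missing triples are disjoint, then \<open>P\<close> is
a single product, and it is enough to know that only \<open>i\<close> can be lighter than half the heaviest vertex of
\<open>A\<close>; this follows from the degree equations and from \<open>\<lambda> > \<mu>\<close> (\<open>no_optimum_if_missing_disjoint\<close>).\<close>

section \<open>Elementary symmetric functions and degrees of a weighted hypergraph\<close>

definition esym :: "nat \<Rightarrow> 'a set \<Rightarrow> ('a \<Rightarrow> real) \<Rightarrow> real" where
  "esym k A x = (\<Sum>e\<in>nsets A k. \<Prod>i\<in>e. x i)"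

definition wsum :: "'a set set \<Rightarrow> ('a \<Rightarrow> real) \<Rightarrow> real" where
  "wsum F x = (\<Sum>e\<in>F. \<Prod>i\<in>e. x i)"

text \<open>The partial derivative of \<open>wsum F\<close> in the direction of \<open>v\<close>; \<open>wcodeg\<close> below is the mixed second
derivative.\<close>

definition wdeg :: "'a set set \<Rightarrow> ('a \<Rightarrow> real) \<Rightarrow> 'a \<Rightarrow> real" where
  "wdeg F x v = (\<Sum>e\<in>{e\<in>F. v \<in> e}. \<Prod>i\<in>e - {v}. x i)"

definition wcodeg :: "'a set set \<Rightarrow> ('a \<Rightarrow> real) \<Rightarrow> 'a \<Rightarrow> 'a \<Rightarrow> real" where
  "wcodeg F x u v = (\<Sum>e\<in>{e\<in>F. u \<in> e \<and> v \<in> e}. \<Prod>i\<in>e - {u, v}. x i)"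

lemma nsets_insert_Suc:
  assumes "finite A" "v \<notin> A"
  shows "nsets (insert v A) (Suc k) = nsets A (Suc k) \<union> insert v ` nsets A k"
proof (intro set_eqI iffI)
  fix e assume e: "e \<in> nsets (insert v A) (Suc k)"
  show "e \<in> nsets A (Suc k) \<union> insert v ` nsets A k"
  proof (cases "v \<in> e")
    case True
    have "e - {v} \<in> nsets A k" using e True by (auto simp: nsets_def)
    moreover have "e = insert v (e - {v})" using True by auto
    ultimately show ?thesis by blast
  next
    case False then show ?thesis using e by (auto simp: nsets_def)
  qed
next
  fix e assume "e \<in> nsets A (Suc k) \<union> insert v ` nsets A k"
  then show "e \<in> nsets (insert v A) (Suc k)"
    using assms(2) by (auto simp: nsets_def card_insert_if)
qed

lemma esym_insert:
  assumes "finite A" "v \<notin> A"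
  shows "esym (Suc k) (insert v A) x = esym (Suc k) A x + x v * esym k A x"
proof -
  have disj: "nsets A (Suc k) \<inter> insert v ` nsets A k = {}"
    using assms(2) by (auto simp: nsets_def)
  have inj: "inj_on (insert v) (nsets A k)"
    using assms(2) by (intro inj_onI) (auto simp: nsets_def)
  have "(\<Sum>e\<in>insert v ` nsets A k. \<Prod>i\<in>e. x i) = (\<Sum>e\<in>nsets A k. x v * (\<Prod>i\<in>e. x i))"
    unfolding sum.reindex[OF inj] o_def
    using assms(2) by (intro sum.cong refl prod.insert) (auto simp: nsets_def)
  then show ?thesis
    unfolding esym_def nsets_insert_Suc[OF assms]
    by (subst sum.union_disjoint) (simp_all add: finite_imp_finite_nsets assms(1) disj sum_distrib_left)
qed

lemma esym_0: "esym 0 A x = 1"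
proof -
  have "nsets A 0 = {{}}" by (auto simp: nsets_def)
  then show ?thesis by (simp add: esym_def)
qed

lemma esym_empty: "esym (Suc k) {} x = 0"
  by (simp add: esym_def nsets_def)

lemma esym_1:
  assumes "finite A" shows "esym 1 A x = sum x A"
  using assms
proof (induction A)
  case empty show ?case using esym_empty[of 0] by simp
next
  case (insert v A)
  then show ?case using esym_insert[of A v 0 x] by (simp add: esym_0)
qed

text \<open>Newton's identities express the symmetric functions of degree 2 and 3 by power sums. They make all
estimates below independent of the combinatorics of the complete graph.\<close>

lemma esym_2:
  assumes "finite A" shows "2 * esym 2 A x = (sum x A)\<^sup>2 - (\<Sum>i\<in>A. (x i)\<^sup>2)"
  using assms
proof (induction A)
  case empty show ?case using esym_empty[of 1] by (simp add: numeral_2_eq_2)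
next
  case (insert v A)
  have "esym 2 (insert v A) x = esym 2 A x + x v * sum x A"
    using esym_insert[of A v 1 x] esym_1[of A x] insert.hyps by (simp add: numeral_2_eq_2)
  then show ?case using insert by (simp add: power2_eq_square algebra_simps)
qed

lemma esym_3:
  assumes "finite A"
  shows "6 * esym 3 A x = sum x A ^ 3 - 3 * sum x A * (\<Sum>i\<in>A. (x i)\<^sup>2) + 2 * (\<Sum>i\<in>A. x i ^ 3)"
  using assms
proof (induction A)
  case empty show ?case using esym_empty[of 2] by (simp add: numeral_3_eq_3)
next
  case (insert v A)
  have "esym 3 (insert v A) x = esym 3 A x + x v * esym 2 A x"
    using esym_insert[of A v 2 x] insert.hyps by (simp add: numeral_3_eq_3)
  then have "6 * esym 3 (insert v A) x
      = 6 * esym 3 A x + 3 * x v * ((sum x A)\<^sup>2 - (\<Sum>i\<in>A. (x i)\<^sup>2))"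
    using esym_2[OF insert.hyps(1), of x] by simp
  then show ?case using insert
    by (simp add: power2_eq_square power3_eq_cube algebra_simps)
qed

lemma esym_remove:
  assumes "finite A" "v \<in> A"
  shows "esym (Suc k) A x = esym (Suc k) (A - {v}) x + x v * esym k (A - {v}) x"
  using esym_insert[of "A - {v}" v k x] assms by (simp add: insert_absorb)

lemma wsum_split:
  assumes "finite F" "\<And>e. e \<in> F \<Longrightarrow> finite e"
  shows "wsum F x = wsum {e\<in>F. v \<notin> e} x + x v * wdeg F x v"
proof -
  have "wsum F x = wsum {e\<in>F. v \<notin> e} x + wsum {e\<in>F. v \<in> e} x"
    unfolding wsum_def using assms(1)
    by (subst sum.union_disjoint[symmetric]) (auto intro!: sum.cong)
  moreover have "wsum {e\<in>F. v \<in> e} x = x v * wdeg F x v"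
    unfolding wsum_def wdeg_def sum_distrib_left using assms
    by (intro sum.cong refl) (auto simp: prod.remove[of _ v])
  ultimately show ?thesis by simp
qed

lemma wdeg_nsets:
  assumes "finite V" "v \<in> V"
  shows "wdeg (nsets V (Suc k)) x v = esym k (V - {v}) x"
proof -
  have "bij_betw (\<lambda>e. e - {v}) {e\<in>nsets V (Suc k). v \<in> e} (nsets (V - {v}) k)"
  proof (rule bij_betw_byWitness[where f' = "insert v"])
    show "insert v ` nsets (V - {v}) k \<subseteq> {e \<in> nsets V (Suc k). v \<in> e}"
      using assms by (auto simp: nsets_def card_insert_if)
  qed (use assms in \<open>auto simp: nsets_def\<close>)
  from sum.reindex_bij_betw[OF this, of "\<lambda>e. \<Prod>i\<in>e. x i"]
  show ?thesis by (simp add: wdeg_def esym_def)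
qed

lemma wdeg_Diff:
  assumes "finite F" "F' \<subseteq> F"
  shows "wdeg (F - F') x v = wdeg F x v - wdeg F' x v"
proof -
  have "{e \<in> F - F'. v \<in> e} = {e\<in>F. v \<in> e} - {e\<in>F'. v \<in> e}" by auto
  then show ?thesis unfolding wdeg_def
    using assms by (simp add: sum_diff Collect_mono_iff subset_iff)
qed

lemma wdeg_nonneg:
  assumes "\<And>e i. e \<in> F \<Longrightarrow> i \<in> e \<Longrightarrow> 0 \<le> x i"
  shows "0 \<le> wdeg F x v"
  unfolding wdeg_def using assms by (intro sum_nonneg prod_nonneg) auto

text \<open>Along the direction that moves weight from \<open>u\<close> to \<open>v\<close> the weight of \<open>F\<close> is a quadratic polynomial,
because it is linear in each single weight.\<close>

lemma wsum_shift:
  assumes "finite F" "\<And>e. e \<in> F \<Longrightarrow> finite e" "u \<noteq> v"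
  shows "wsum F (x(u := x u - s, v := x v + s))
    = wsum F x + s * (wdeg F x v - wdeg F x u) - s\<^sup>2 * wcodeg F x u v"
proof -
  let ?y = "x(u := x u - s, v := x v + s)"
  have *: "(\<Prod>i\<in>e. ?y i) = (\<Prod>i\<in>e. x i) + s * ((if v \<in> e then \<Prod>i\<in>e - {v}. x i else 0)
      - (if u \<in> e then \<Prod>i\<in>e - {u}. x i else 0))
      - s\<^sup>2 * (if u \<in> e \<and> v \<in> e then \<Prod>i\<in>e - {u, v}. x i else 0)" if "e \<in> F" for e
  proof -
    have fe: "finite e" using assms(2) that .
    have r: "(\<Prod>i\<in>e - {u,v}. ?y i) = (\<Prod>i\<in>e - {u,v}. x i)"
      by (intro prod.cong) auto
    have r1: "(\<Prod>i\<in>e. ?y i) = (\<Prod>i\<in>e - {u,v}. ?y i) * (\<Prod>i\<in>e \<inter> {u,v}. ?y i)"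
      "(\<Prod>i\<in>e. x i) = (\<Prod>i\<in>e - {u,v}. x i) * (\<Prod>i\<in>e \<inter> {u,v}. x i)"
      using prod.Int_Diff[OF fe, of ?y "{u,v}"] prod.Int_Diff[OF fe, of x "{u,v}"]
      by (simp_all add: mult.commute)
    consider "u \<in> e" "v \<in> e" | "u \<in> e" "v \<notin> e" | "u \<notin> e" "v \<in> e" | "u \<notin> e" "v \<notin> e" by blast
    then show ?thesis
    proof cases
      case 1
      have i: "e \<inter> {u,v} = {u,v}" using 1 by auto
      have ev: "e - {v} = insert u (e - {u,v})" and eu: "e - {u} = insert v (e - {u,v})"
        using 1 assms(3) by auto
      have "(\<Prod>i\<in>e - {v}. x i) = x u * (\<Prod>i\<in>e - {u,v}. x i)"
        unfolding ev by (rule prod.insert) (use fe in auto)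
      moreover have "(\<Prod>i\<in>e - {u}. x i) = x v * (\<Prod>i\<in>e - {u,v}. x i)"
        unfolding eu by (rule prod.insert) (use fe in auto)
      ultimately show ?thesis using 1 assms(3) unfolding r1 r i
        by (simp add: algebra_simps power2_eq_square)
    next
      case 2
      have i: "e \<inter> {u,v} = {u}" "e - {u} = e - {u,v}" using 2 by auto
      show ?thesis using 2 assms(3) unfolding r1 r i by (simp add: algebra_simps)
    next
      case 3
      have i: "e \<inter> {u,v} = {v}" "e - {v} = e - {u,v}" using 3 by auto
      show ?thesis using 3 assms(3) unfolding r1 r i by (simp add: algebra_simps)
    next
      case 4
      have i: "e \<inter> {u,v} = {}" using 4 by auto
      show ?thesis using 4 assms(3) unfolding r1 r i by simp
    qed
  qed
  have "wsum F ?y = (\<Sum>e\<in>F. (\<Prod>i\<in>e. x i) + s * ((if v \<in> e then \<Prod>i\<in>e - {v}. x i else 0)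
      - (if u \<in> e then \<Prod>i\<in>e - {u}. x i else 0))
      - s\<^sup>2 * (if u \<in> e \<and> v \<in> e then \<Prod>i\<in>e - {u, v}. x i else 0))"
    unfolding wsum_def by (intro sum.cong refl *)
  also have "\<dots> = wsum F x + s * (wdeg F x v - wdeg F x u) - s\<^sup>2 * wcodeg F x u v"
    unfolding wsum_def wdeg_def wcodeg_def sum.distrib sum_subtractf sum_distrib_left[symmetric]
    using assms(1) by (simp add: sum.inter_filter)
  finally show ?thesis .
qed

text \<open>Euler's identity for homogeneous polynomials.\<close>

lemma wsum_euler:
  assumes "finite V" "F \<subseteq> nsets V k"
  shows "(\<Sum>v\<in>V. x v * wdeg F x v) = real k * wsum F x"
proof -
  have fF: "finite F" using assms finite_subset finite_imp_finite_nsets by blast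
  have "(\<Sum>v\<in>V. x v * wdeg F x v) = (\<Sum>v\<in>V. \<Sum>e\<in>{e\<in>F. v \<in> e}. \<Prod>i\<in>e. x i)"
    unfolding wdeg_def sum_distrib_left
  proof (intro sum.cong refl)
    fix v e assume "e \<in> {e\<in>F. v \<in> e}"
    then have "finite e" "v \<in> e" using assms by (auto simp: nsets_def)
    then show "x v * prod x (e - {v}) = prod x e" by (simp add: prod.remove[of e v])
  qed
  also have "\<dots> = (\<Sum>e\<in>F. \<Sum>v\<in>{v\<in>V. v \<in> e}. \<Prod>i\<in>e. x i)"
    using assms(1) fF by (rule sum.swap_restrict)
  also have "\<dots> = (\<Sum>e\<in>F. real k * (\<Prod>i\<in>e. x i))"
  proof (intro sum.cong refl)
    fix e assume "e \<in> F"
    then have "{v\<in>V. v \<in> e} = e" "card e = k" using assms(2) by (auto simp: nsets_def)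
    then show "(\<Sum>v\<in>{v\<in>V. v \<in> e}. \<Prod>i\<in>e. x i) = real k * (\<Prod>i\<in>e. x i)" by simp
  qed
  finally show ?thesis by (simp add: wsum_def sum_distrib_left)
qed

lemma lagrange_poly_wsum: "lagrange_poly G x = wsum (edges G) x"
  by (simp add: lagrange_poly_def wsum_def)

lemma edges_finite:
  assumes "is_three_graph G"
  shows "finite (edges G)" "\<And>e. e \<in> edges G \<Longrightarrow> finite e"
  using assms finite_subset[OF _ finite_imp_finite_nsets] by (auto simp: is_three_graph_def nsets_def)

lemma weightings_shift:
  assumes "finite V" "x \<in> weightings V" "u \<in> V" "v \<in> V" "u \<noteq> v" "0 \<le> s" "s \<le> x u"
  shows "x(u := x u - s, v := x v + s) \<in> weightings V"
proof -
  have "(\<Sum>i\<in>V. (x(u := x u - s, v := x v + s)) i)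
      = (\<Sum>i\<in>V. x i + (if i = v then s else 0) - (if i = u then s else 0))"
    using assms(5) by (intro sum.cong) auto
  also have "\<dots> = 1"
    using assms by (simp add: sum.distrib sum_subtractf weightings_def)
  finally show ?thesis using assms by (auto simp: weightings_def)
qed

text \<open>First-order optimality: otherwise moving a little weight from \<open>u\<close> to \<open>v\<close> would increase the value. The
weight of \<open>v\<close> may be zero, in which case only the inequality holds.\<close>

lemma optimum_wdeg_le:
  assumes G: "is_three_graph G" and x: "x \<in> weightings (verts G)" "lagrange_poly G x = lagrangian G"
    and uv: "u \<in> verts G" "v \<in> verts G" "0 < x u"
  shows "wdeg (edges G) x v \<le> wdeg (edges G) x u"
proof (cases "u = v")
  case False
  show ?thesis
  proof (rule ccontr)
    define b c where "b = wdeg (edges G) x v - wdeg (edges G) x u" and "c = wcodeg (edges G) x u v"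
    assume "\<not> ?thesis"
    then have b: "b > 0" by (simp add: b_def)
    define s where "s = min (x u) (b / (2 * (\<bar>c\<bar> + 1)))"
    have s: "0 < s" "s \<le> x u" using b uv(3) by (auto simp: s_def)
    have "s \<le> b / (2 * (\<bar>c\<bar> + 1))" unfolding s_def by simp
    then have "s * (\<bar>c\<bar> + 1) \<le> b / 2" by (simp add: field_simps)
    moreover have "s * c \<le> s * (\<bar>c\<bar> + 1)" using s by (intro mult_left_mono) auto
    ultimately have "s * c < b" using b by simp
    then have "s * (b - s * c) > 0" using s by simp
    then have "lagrange_poly G x < lagrange_poly G (x(u := x u - s, v := x v + s))"
      unfolding lagrange_poly_wsum
      using wsum_shift[OF edges_finite[OF G] False, of x s]
      by (simp add: b_def c_def algebra_simps power2_eq_square)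
    also have "\<dots> \<le> lagrangian G"
      using G by (intro lagrange_poly_le_lagrangian weightings_shift x uv False)
        (use s in \<open>auto simp: is_three_graph_def\<close>)
    finally show False using x(2) by simp
  qed
qed simp

section \<open>Numerical inequalities for two vertices outside the clique\<close>

text \<open>With \<open>h = 1 / N\<close>, the last factor is six times the value of the complete 3-graph on \<open>N\<close> vertices
without two edges at the uniform weighting. The first factor is a lower bound for the reciprocal of
\<open>1 - 3/2 * h - 41/10 * h\<^sup>2\<close>, which in turn is an upper bound for \<open>h\<close> times the square root of \<open>N\<^sup>2 - 3 * N - 6\<close>,
that is, of twice the number of edges that may leave the clique.\<close>

lemma density_times_inverse:
  fixes h :: real
  assumes "0 < h" "h \<le> 1/11"
  shows "1 - 3/2 * h \<le> (1 + 3/2 * h + 6 * h\<^sup>2) * (1 - 3 * h + 2 * h\<^sup>2 - 12 * h ^ 3)"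
proof -
  have "27 * h + 6 * h\<^sup>2 + 72 * h ^ 3 \<le> 27 * (1/11) + 6 * (1/11)\<^sup>2 + 72 * (1/11) ^ 3"
    using assms by (intro add_mono mult_left_mono power_mono) auto
  also have "\<dots> \<le> 7/2" by (simp add: power2_eq_square power3_eq_cube)
  finally have "0 \<le> h\<^sup>2 * (7/2 - 27 * h - 6 * h\<^sup>2 - 72 * h ^ 3)"
    by (intro mult_nonneg_nonneg) auto
  also have "\<dots> = (1 + 3/2 * h + 6 * h\<^sup>2) * (1 - 3 * h + 2 * h\<^sup>2 - 12 * h ^ 3) - (1 - 3/2 * h)"
    by (simp add: field_simps power2_eq_square power3_eq_cube)
  finally show ?thesis by simp
qed

lemma divide_out_link_factor:
  fixes h :: real
  assumes "0 < h" "h \<le> 1/11" "0 \<le> B" "B \<le> (1 - 3/2 * h - 41/10 * h\<^sup>2) * S"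
  shows "B * (1 + 3/2 * h + 6 * h\<^sup>2) \<le> S"
proof -
  have "h\<^sup>2 \<le> (1/11)\<^sup>2" using assms by (intro power_mono) auto
  then have K: "0 < 1 - 3/2 * h - 41/10 * h\<^sup>2" using assms by (simp add: power2_eq_square)
  have S: "0 \<le> S"
    using assms(3,4) K by (meson order_trans zero_le_mult_iff not_le)
  have "B * (1 + 3/2 * h + 6 * h\<^sup>2)
      \<le> (1 - 3/2 * h - 41/10 * h\<^sup>2) * S * (1 + 3/2 * h + 6 * h\<^sup>2)"
    using assms by (intro mult_right_mono) auto
  also have "\<dots> = S * (1 - h\<^sup>2 * (7/20 + 303/20 * h + 123/5 * h\<^sup>2))"
    by (simp add: algebra_simps power2_eq_square)
  also have "\<dots> \<le> S * 1"
    using S assms by (intro mult_left_mono) auto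
  finally show ?thesis by simp
qed

text \<open>The left-hand side is what Newton's identity leaves for the sum of squares of the remaining weights, if \<open>s\<close> is
the weight of the two outer vertices. The terms \<open>(1 - s) ^ 3\<close> and \<open>1 - 3 * s\<close> cancel up to second order.\<close>

lemma cubic_remainder_le:
  fixes h s :: real
  assumes h: "0 < h" "h \<le> 1/11" and s: "0 \<le> s" "s \<le> 11/5 * h"
  shows "(1 - s) ^ 3 - (1 - 3 * h + 2 * h\<^sup>2 - 12 * h ^ 3) * (1 - 3 * s) \<le> 3 * s\<^sup>2 + 3 * h * (1 - 3 * s)"
proof -
  have "0 \<le> h\<^sup>2 * (2 - 12 * h) * (1 - 3 * s) + s ^ 3"
    using assms by (intro add_nonneg_nonneg mult_nonneg_nonneg) auto
  then show ?thesis by (simp add: algebra_simps power2_eq_square power3_eq_cube)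
qed

text \<open>The final inequality is linear in the codegree \<open>g\<close> of the two outer vertices, so it suffices to treat
\<open>g = 0\<close> (here) and \<open>g = 1 - s\<close> (the next two lemmas), where \<open>s\<close> is the sum of their weights.\<close>

lemma outer_pair_margin_codegree_0:
  fixes h s :: real
  assumes h: "0 < h" "h \<le> 1/11" and s: "0 \<le> s" "s \<le> 11/5 * h"
  shows "3 * s\<^sup>2 + 3 * h * (1 - 3 * s) < (3 - 3 * s - 12/5 * h) * (1414/1000 * h * (1 - 3/2 * h))"
proof -
  have s2: "s\<^sup>2 \<le> 11/5 * h * s" unfolding power2_eq_square using s by (intro mult_right_mono) auto
  have e: "(3 - 3 * s - 12/5 * h) * (1414/1000 * (1 - 3/2 * h)) - (3 - 12/5 * s)
     = 1242/1000 - 1842/1000 * s - 97566/10000 * h + 6363/1000 * h * s + 50904/10000 * h\<^sup>2"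
    by (simp add: field_simps power2_eq_square)
  have "0 \<le> (11/5 * h - s) * (1842/1000 - 6363/1000 * h)"
    using h s by (intro mult_nonneg_nonneg) auto
  then have 1: "1842/1000 * s - 6363/1000 * h * s \<le> 11/5 * h * (1842/1000 - 6363/1000 * h)"
    by (simp add: field_simps)
  have "0 \<le> (1/11 - h) * (12 - 19 * h)" using h by (intro mult_nonneg_nonneg) auto
  moreover have "0 < h * h" using h by simp
  ultimately have "1242/1000 - 97566/10000 * h + 50904/10000 * h\<^sup>2 - 11/5 * h * (1842/1000 - 6363/1000 * h) > 0"
    using h by (simp add: algebra_simps power2_eq_square)
  then have "3 - 12/5 * s < (3 - 3 * s - 12/5 * h) * (1414/1000 * (1 - 3/2 * h))"
    using e 1 by linarith
  then have "h * (3 - 12/5 * s) < h * ((3 - 3 * s - 12/5 * h) * (1414/1000 * (1 - 3/2 * h)))"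
    using h by (intro mult_strict_left_mono)
  then show ?thesis using s2 by (simp add: algebra_simps)
qed

lemma outer_pair_margin_light:
  fixes h s :: real
  assumes h: "0 < h" "h \<le> 1/11" and s: "0 \<le> s" "s \<le> 11/10 * h"
  shows "3 * s\<^sup>2 + 3 * h * (1 - 3 * s)
    < (3 - 3 * s - 12/5 * h) * (1414/1000 * h * (1 - 3/2 * h - (s - s\<^sup>2) * (1 + 41/20 * h)))"
proof -
  have s2: "s\<^sup>2 \<le> 11/10 * h * s" unfolding power2_eq_square using s by (intro mult_right_mono) auto
  have D: "0 \<le> 3 - 3 * s - 12/5 * h" using h s by simp
  have "(3 - 3 * s - 12/5 * h) * (1 - 3/2 * h - s * (1 + 41/20 * h))
     = 3 - 69/10 * h - 6 * s + (3/4 * h * s + 3 * s\<^sup>2 + 123/20 * h * s\<^sup>2 + 18/5 * h\<^sup>2 + 123/25 * h\<^sup>2 * s)"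
    by (simp add: algebra_simps power2_eq_square)
  moreover have "0 \<le> 3/4 * h * s + 3 * s\<^sup>2 + 123/20 * h * s\<^sup>2 + 18/5 * h\<^sup>2 + 123/25 * h\<^sup>2 * s"
    using h s by (intro add_nonneg_nonneg mult_nonneg_nonneg) auto
  moreover have "(3 - 3 * s - 12/5 * h) * (1 - 3/2 * h - s * (1 + 41/20 * h))
    \<le> (3 - 3 * s - 12/5 * h) * (1 - 3/2 * h - (s - s\<^sup>2) * (1 + 41/20 * h))"
    using h D by (intro mult_left_mono diff_left_mono mult_right_mono) auto
  ultimately have "3 - 57/10 * s < (3 - 3 * s - 12/5 * h) * (1414/1000 * (1 - 3/2 * h - (s - s\<^sup>2) * (1 + 41/20 * h)))"
    using h s by linarith
  then have "h * (3 - 57/10 * s) < h * ((3 - 3 * s - 12/5 * h) * (1414/1000 * (1 - 3/2 * h - (s - s\<^sup>2) * (1 + 41/20 * h))))"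
    using h by (intro mult_strict_left_mono)
  moreover have "3 * s\<^sup>2 + 3 * h * (1 - 3 * s) \<le> h * (3 - 57/10 * s)"
    using s2 by (simp add: algebra_simps)
  ultimately show ?thesis by (simp only: mult.assoc mult.left_commute)
qed

text \<open>For \<open>s\<close> beyond \<open>11/10 * h\<close> both outer vertices carry weight, and the product of their weights enters; the
quadratic is bounded below by its tangent at \<open>9/5 * h\<close> and above by the chord of the interval.\<close>

lemma outer_pair_margin_heavy:
  fixes h s :: real
  assumes h: "0 < h" "h \<le> 1/11" and s: "11/10 * h \<le> s" "s \<le> 11/5 * h"
  shows "3 * s\<^sup>2 + 3 * h * (1 - 3 * s) - 6 * (11/10 * h * s - 121/100 * h\<^sup>2) * (1 - s)
    < (3 - 3 * s - 12/5 * h) * (1414/1000 * h * (1 - 3/2 * h - (s - s\<^sup>2) * (1 + 41/20 * h)))"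
proof -
  have D: "0 \<le> 3 - 3 * s - 12/5 * h" using h s by simp
  have "0 \<le> (s - 11/10 * h) * (11/5 * h - s)" using s by (intro mult_nonneg_nonneg) auto
  then have s2: "s\<^sup>2 \<le> 33/10 * h * s - 242/100 * h\<^sup>2"
    by (simp add: algebra_simps power2_eq_square)
  have "0 \<le> (s - 9/5 * h)\<^sup>2" by simp
  then have s3: "18/5 * h * s - 81/25 * h\<^sup>2 \<le> s\<^sup>2" by (simp add: algebra_simps power2_eq_square)
  define X where "X = 1 - 3/2 * h - (s - s\<^sup>2) * (1 + 41/20 * h)"
  have "(s - s\<^sup>2) * (1 + 41/20 * h) \<le> (s - 18/5 * h * s + 81/25 * h\<^sup>2) * (1 + 41/20 * h)"
    using s3 h by (intro mult_right_mono) auto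
  also have "\<dots> = s - 31/20 * h * s + 81/25 * h\<^sup>2 * (1 + 41/20 * h) - 369/50 * h\<^sup>2 * s"
    by (simp add: algebra_simps power2_eq_square)
  also have "\<dots> \<le> s - 31/20 * h * s + 81/25 * h\<^sup>2 * (1187/1000) - 0"
    using h s by (intro diff_mono add_mono order_refl mult_left_mono mult_nonneg_nonneg) auto
  also have "\<dots> \<le> s - 31/20 * h * s + 77/20 * h\<^sup>2"
    using h by simp
  finally have X: "1 - 3/2 * h - s + 31/20 * h * s - 77/20 * h\<^sup>2 \<le> X" by (simp add: X_def)
  have "1414/1000 * ((3 - 3 * s - 12/5 * h) * (1 - 3/2 * h - s + 31/20 * h * s - 77/20 * h\<^sup>2)) - (3 - 438/100 * s - 1452/1000 * h)
    = 1242/1000 - 83046/10000 * h - 4104/1000 * s + (163317/10000 * h * s + 4242/1000 * s\<^sup>2 - 112413/10000 * h\<^sup>2)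
      + 1414/1000 * h * (924/100 * h\<^sup>2 + 783/100 * h * s - 465/100 * s\<^sup>2)" (is "_ = ?r")
    by (simp add: algebra_simps power2_eq_square power3_eq_cube)
  moreover have "?r > 0"
  proof -
    have "0 \<le> h * (924/100 * h\<^sup>2 + 783/100 * h * s - 465/100 * s\<^sup>2)"
    proof (intro mult_nonneg_nonneg)
      have "0 \<le> (11/5 * h - s) * h" using h s by (intro mult_nonneg_nonneg) auto
      then have "h * s \<le> 11/5 * h\<^sup>2" by (simp add: algebra_simps power2_eq_square)
      moreover have "s\<^sup>2 \<le> 33/10 * (h * s) - 242/100 * h\<^sup>2" using s2 by simp
      moreover have "0 \<le> h\<^sup>2" by simp
      ultimately have "0 \<le> 924/100 * h\<^sup>2 + 783/100 * (h * s) - 465/100 * s\<^sup>2" by linarith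
      then show "0 \<le> 924/100 * h\<^sup>2 + 783/100 * h * s - 465/100 * s\<^sup>2" by simp
    qed (use h in simp)
    moreover have "0 \<le> (11/5 * h - s) * (4104/1000 - 163317/10000 * h - 4242/1000 * (s + 11/5 * h))"
      using h s by (intro mult_nonneg_nonneg) auto
    then have "- 4104/1000 * (11/5 * h) + 163317/10000 * h * (11/5 * h) + 4242/1000 * (11/5 * h)\<^sup>2
        \<le> - 4104/1000 * s + 163317/10000 * h * s + 4242/1000 * s\<^sup>2"
      by (simp add: field_simps power2_eq_square)
    moreover have "0 \<le> (1/11 - h) * (12 - 45 * h)" using h by (intro mult_nonneg_nonneg) auto
    then have "0 < 1242/1000 - 83046/10000 * h - 4104/1000 * (11/5 * h)
        + 163317/10000 * h * (11/5 * h) + 4242/1000 * (11/5 * h)\<^sup>2 - 112413/10000 * h\<^sup>2"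
      using h by (simp add: algebra_simps power2_eq_square)
    ultimately show ?thesis by linarith
  qed
  moreover have "(3 - 3 * s - 12/5 * h) * (1 - 3/2 * h - s + 31/20 * h * s - 77/20 * h\<^sup>2)
      \<le> (3 - 3 * s - 12/5 * h) * X"
    using D X by (intro mult_left_mono)
  ultimately have "3 - 438/100 * s - 1452/1000 * h < (3 - 3 * s - 12/5 * h) * (1414/1000 * X)"
    by linarith
  then have "h * (3 - 438/100 * s - 1452/1000 * h) < h * ((3 - 3 * s - 12/5 * h) * (1414/1000 * X))"
    using h by (intro mult_strict_left_mono)
  moreover have "3 * s\<^sup>2 + 3 * h * (1 - 3 * s) - 6 * (11/10 * h * s - 121/100 * h\<^sup>2) * (1 - s)
     \<le> h * (3 - 438/100 * s - 1452/1000 * h)"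
  proof -
    have "6 * (11/10 * h * s - 121/100 * h\<^sup>2) * (1 - s) \<ge> 6 * (11/10 * h * s - 121/100 * h\<^sup>2) * (4/5)"
    proof (intro mult_left_mono)
      have "0 \<le> h * (s - 11/10 * h)" using h s by (intro mult_nonneg_nonneg) auto
      then show "0 \<le> 6 * (11/10 * h * s - 121/100 * h\<^sup>2)" by (simp add: algebra_simps power2_eq_square)
    qed (use h s in auto)
    moreover have "6 * (11/10 * h * s - 121/100 * h\<^sup>2) * (4/5) = 528/100 * (h * s) - 5808/1000 * h\<^sup>2"
      "h * (3 - 438/100 * s - 1452/1000 * h) = 3 * h - 438/100 * (h * s) - 1452/1000 * h\<^sup>2"
      "3 * h * (1 - 3 * s) = 3 * h - 9 * (h * s)"
      by (simp_all add: field_simps power2_eq_square)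
    moreover have "s\<^sup>2 \<le> 33/10 * (h * s) - 242/100 * h\<^sup>2" using s2 by simp
    ultimately show ?thesis by linarith
  qed
  ultimately show ?thesis unfolding X_def by (simp only: mult.assoc mult.left_commute)
qed

text \<open>Here \<open>a\<close> and \<open>b\<close> are the weights of two vertices outside the clique, \<open>g\<close> their codegree, \<open>S\<close> the sum of
the squares of the other weights, \<open>M\<close> a bound for these weights and \<open>l\<close> six times the Lagrangian. The
hypothesis on \<open>S\<close> from below comes from Cauchy-Schwarz on the two links, the last one from Newton's
identity.\<close>

lemma outer_pair_inequalities_inconsistent:
  fixes h a b g S M l :: real
  assumes h: "0 < h" "h \<le> 1/11"
    and l: "1 - 3 * h + 2 * h\<^sup>2 - 12 * h ^ 3 \<le> l"
    and ab: "0 \<le> a" "a \<le> 11/10 * h" "0 \<le> b" "b \<le> 11/10 * h"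
    and g: "0 \<le> g" "g \<le> 1 - a - b"
    and S: "1414/1000 * h * (l - (a + b) * g) \<le> (1 - 3/2 * h - 41/10 * h\<^sup>2) * S"
    and M: "M \<le> 6/5 * h"
    and e3: "l * (1 - 3 * (a + b)) + 6 * a * b * g \<le> (1 - (a + b)) ^ 3 - (3 * (1 - (a + b)) - 2 * M) * S"
  shows False
proof -
  define s where "s = a + b"
  define l0 where "l0 = 1 - 3 * h + 2 * h\<^sup>2 - 12 * h ^ 3"
  define c where "c = 1 + 3/2 * h + 6 * h\<^sup>2"
  define D where "D = 3 - 3 * s - 12/5 * h"
  define A where "A = 3 * s\<^sup>2 + 3 * h * (1 - 3 * s)"
  have s: "0 \<le> s" "s \<le> 11/5 * h" "s \<le> 1/5" and D: "D \<ge> 0" using ab h by (auto simp: s_def D_def)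
  have h2: "h\<^sup>2 \<le> h * (1/11)" unfolding power2_eq_square using h by (intro mult_left_mono) auto
  have c: "0 \<le> c" "c \<le> 1 + 41/20 * h" using h h2 by (auto simp: c_def)
  have cl: "1 - 3/2 * h \<le> c * l0" unfolding c_def l0_def by (rule density_times_inverse[OF h])
  have sg: "s * g \<le> s * (1 - s)" using g s by (intro mult_left_mono) (auto simp: s_def)
  have ss: "s * (1 - s) \<le> 1/5"
    using s mult_mono[of s "1/5" "1 - s" 1] by simp
  have "h ^ 3 \<le> (1/11) ^ 3" using h by (intro power_mono) auto
  then have "h ^ 3 \<le> 1/1331" by (simp add: power3_eq_cube)
  moreover have "0 \<le> h\<^sup>2" by simp
  ultimately have l7: "7/10 \<le> l0" using h unfolding l0_def by linarith
  have Bpos: "0 \<le> 1414/1000 * h * (l - s * g)"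
    using h sg ss l7 l by (intro mult_nonneg_nonneg) (auto simp: l0_def)
  have "1414/1000 * h * (l - s * g) * c \<le> S"
    using divide_out_link_factor[OF h Bpos] S unfolding c_def s_def by simp
  moreover have "D \<le> 3 * (1 - s) - 2 * M" using M by (simp add: D_def)
  ultimately have "D * (1414/1000 * h * (l - s * g) * c) \<le> (3 * (1 - s) - 2 * M) * S"
    using D Bpos c by (intro mult_mono) auto
  then have "D * (1414/1000 * h * (l - s * g) * c) + l * (1 - 3 * s) + 6 * a * b * g \<le> (1 - s) ^ 3"
    using e3 unfolding s_def by linarith
  moreover have "D * (1414/1000 * h * (l0 - s * g) * c) \<le> D * (1414/1000 * h * (l - s * g) * c)"
    using D c h l by (intro mult_left_mono mult_right_mono) (auto simp: l0_def)
  moreover have "l0 * (1 - 3 * s) \<le> l * (1 - 3 * s)"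
    using l s by (intro mult_right_mono) (auto simp: l0_def)
  ultimately have *: "D * (1414/1000 * h * (l0 - s * g) * c) + 6 * a * b * g \<le> A"
    using cubic_remainder_le[OF h s(1,2)] unfolding l0_def A_def by linarith
  show False
  proof (cases "D * (1414/1000 * h * s * c) \<le> 6 * a * b")
    case True
    then have "D * (1414/1000 * h * s * c) * g \<le> 6 * a * b * g" using g by (intro mult_right_mono)
    moreover have "D * (1414/1000 * h * (l0 - s * g) * c)
        = D * (1414/1000 * h * (c * l0)) - D * (1414/1000 * h * s * c) * g"
      by (simp add: field_simps)
    ultimately have "D * (1414/1000 * h * (c * l0)) \<le> A" using * by linarith
    moreover have "D * (1414/1000 * h * (1 - 3/2 * h)) \<le> D * (1414/1000 * h * (c * l0))"
      using D h cl by (intro mult_left_mono) auto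
    ultimately show False using outer_pair_margin_codegree_0[OF h s(1,2)] unfolding A_def D_def by linarith
  next
    case False
    have "0 \<le> (D * (1414/1000 * h * s * c) - 6 * a * b) * ((1 - s) - g)"
      using False g by (intro mult_nonneg_nonneg) (auto simp: s_def)
    moreover have "D * (1414/1000 * h * (l0 - s * g) * c) + 6 * a * b * g
        = D * (1414/1000 * h * (c * l0 - (s - s\<^sup>2) * c)) + 6 * (a * b) * (1 - s)
          + (D * (1414/1000 * h * s * c) - 6 * a * b) * ((1 - s) - g)"
      by (simp add: field_simps power2_eq_square)
    ultimately have "D * (1414/1000 * h * (c * l0 - (s - s\<^sup>2) * c)) + 6 * (a * b) * (1 - s) \<le> A"
      using * by linarith
    moreover have "(s - s\<^sup>2) * c \<le> (s - s\<^sup>2) * (1 + 41/20 * h)"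
      using s c by (intro mult_left_mono) (auto simp: power2_eq_square mult_left_le_one_le)
    then have "1 - 3/2 * h - (s - s\<^sup>2) * (1 + 41/20 * h) \<le> c * l0 - (s - s\<^sup>2) * c"
      using cl by linarith
    then have "D * (1414/1000 * h * (1 - 3/2 * h - (s - s\<^sup>2) * (1 + 41/20 * h)))
        \<le> D * (1414/1000 * h * (c * l0 - (s - s\<^sup>2) * c))"
      using D h by (intro mult_left_mono) auto
    ultimately have **: "D * (1414/1000 * h * (1 - 3/2 * h - (s - s\<^sup>2) * (1 + 41/20 * h)))
        + 6 * (a * b) * (1 - s) \<le> A" by linarith
    show False
    proof (cases "s \<le> 11/10 * h")
      case True
      have "0 \<le> 6 * (a * b) * (1 - s)" using ab s by (intro mult_nonneg_nonneg) auto
      then show False using ** outer_pair_margin_light[OF h s(1) True] unfolding A_def D_def by linarith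
    next
      case False
      have "0 \<le> (11/10 * h - a) * (11/10 * h - b)" using ab by (intro mult_nonneg_nonneg) auto
      then have "11/10 * h * s - 121/100 * h\<^sup>2 \<le> a * b"
        by (simp add: s_def algebra_simps power2_eq_square)
      then have "6 * (11/10 * h * s - 121/100 * h\<^sup>2) * (1 - s) \<le> 6 * (a * b) * (1 - s)"
        using s by (intro mult_right_mono) auto
      moreover have "11/10 * h \<le> s" using False by simp
      ultimately show False using ** outer_pair_margin_heavy[OF h _ s(2)] unfolding A_def D_def by linarith
    qed
  qed
qed

section \<open>Optimal weightings of dense graphs, and two vertices outside the clique\<close>

lemma subgraph_lagrangian_less:
  assumes "dense H" "is_three_graph H" "U \<subseteq> verts H" "F \<subseteq> edges H" "F \<subseteq> nsets U 3" "U \<noteq> {}"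
    "U \<noteq> verts H"
  shows "lagrangian (Three_Graph U F) < lagrangian H"
proof -
  have "subgraph (Three_Graph U F) H" "Three_Graph U F \<noteq> H"
    using assms finite_subset[OF assms(3)] by (auto simp: subgraph_def is_three_graph_def)
  then show ?thesis using assms(1,6) unfolding dense_def by simp
qed

text \<open>A zero weight would allow the deletion of its vertex without decreasing the Lagrangian. So all weights
are positive, all degrees agree, and Euler's identity gives their common value.\<close>

lemma dense_optimum:
  assumes H: "dense H" "is_three_graph H" and ne: "verts H \<noteq> {}"
  obtains x where "x \<in> weightings (verts H)" "lagrange_poly H x = lagrangian H"
    "\<And>v. v \<in> verts H \<Longrightarrow> 0 < x v"
    "\<And>v. v \<in> verts H \<Longrightarrow> wdeg (edges H) x v = 3 * lagrangian H"
proof -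
  have fin: "finite (verts H)" and E: "edges H \<subseteq> nsets (verts H) 3"
    using H by (auto simp: is_three_graph_def)
  obtain x where x: "x \<in> weightings (verts H)" "lagrange_poly H x = lagrangian H"
    using lagrangian_attained[OF H(2) ne] by blast
  have nn: "0 \<le> x v" if "v \<in> verts H" for v using x that by (auto simp: weightings_def)
  have pos: "0 < x v" if v: "v \<in> verts H" for v
  proof (rule ccontr)
    assume "\<not> 0 < x v"
    then have x0: "x v = 0" using nn[OF v] by simp
    define G where "G = Three_Graph (verts H - {v}) {e \<in> edges H. v \<notin> e}"
    have "(\<Sum>i\<in>verts H - {v}. x i) = 1"
      using x fin v x0 by (simp add: weightings_def sum_diff1)
    then have w: "x \<in> weightings (verts G)" using x by (auto simp: G_def weightings_def)
    have ne': "verts H - {v} \<noteq> {}"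
    proof
      assume "verts H - {v} = {}"
      moreover have "sum x (verts H - {v}) = 1" using w by (simp add: weightings_def G_def)
      ultimately show False by (metis sum.empty zero_neq_one)
    qed
    have sub: "{e \<in> edges H. v \<notin> e} \<subseteq> nsets (verts H - {v}) 3"
      using E by (auto simp: nsets_def)
    have "lagrange_poly G x = lagrange_poly H x"
      using wsum_split[OF edges_finite[OF H(2)], of x v] x0
      by (simp add: lagrange_poly_wsum G_def)
    moreover have "is_three_graph G" using sub fin by (simp add: is_three_graph_def G_def)
    ultimately have "lagrangian H \<le> lagrangian G"
      using lagrange_poly_le_lagrangian[OF _ w] x by simp
    moreover have "lagrangian G < lagrangian H"
      unfolding G_def using v by (intro subgraph_lagrangian_less H sub ne') auto
    ultimately show False by simp
  qed
  have eq: "wdeg (edges H) x u = wdeg (edges H) x v" if "u \<in> verts H" "v \<in> verts H" for u v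
    using optimum_wdeg_le[OF H(2) x] that pos by (meson antisym)
  have "wdeg (edges H) x v = 3 * lagrangian H" if v: "v \<in> verts H" for v
  proof -
    have "wsum (edges H) x = lagrangian H" using x(2) unfolding lagrange_poly_wsum .
    then have "3 * lagrangian H = (\<Sum>u\<in>verts H. x u * wdeg (edges H) x u)"
      using wsum_euler[OF fin E, of x] by simp
    moreover have "(\<Sum>u\<in>verts H. x u * wdeg (edges H) x u) = (\<Sum>u\<in>verts H. x u * wdeg (edges H) x v)"
      by (rule sum.cong[OF refl]) (simp only: eq[OF _ v])
    moreover have "(\<Sum>u\<in>verts H. x u * wdeg (edges H) x v) = wdeg (edges H) x v"
      using x(1) unfolding weightings_def sum_distrib_right[symmetric] by simp
    ultimately show ?thesis by simp
  qed
  then show ?thesis using that x pos by blast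
qed

lemma lagrangian_ge_uniform:
  assumes G: "is_three_graph G" and ne: "verts G \<noteq> {}"
  shows "real (card (edges G)) / real (card (verts G)) ^ 3 \<le> lagrangian G"
proof -
  have fin: "finite (verts G)" and E: "edges G \<subseteq> nsets (verts G) 3"
    using G by (auto simp: is_three_graph_def)
  define x where "x = (\<lambda>_::'a. 1 / real (card (verts G)))"
  have "x \<in> weightings (verts G)" using fin ne by (simp add: x_def weightings_def)
  moreover have "lagrange_poly G x = (\<Sum>e\<in>edges G. (1 / real (card (verts G))) ^ 3)"
    unfolding lagrange_poly_def using E by (intro sum.cong) (auto simp: x_def nsets_def)
  moreover have "(\<Sum>e\<in>edges G. (1 / real (card (verts G))) ^ 3)
      = real (card (edges G)) / real (card (verts G)) ^ 3"
    by (simp add: power_one_over)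
  ultimately show ?thesis
    using lagrange_poly_le_lagrangian[OF G, of x] by simp
qed

lemma wdeg_le_esym:
  assumes "finite V" "F \<subseteq> nsets V 3" "\<And>i. i \<in> V \<Longrightarrow> 0 \<le> x i" "v \<in> V"
  shows "wdeg F x v \<le> esym 2 (V - {v}) x"
proof -
  have "wdeg F x v \<le> wdeg (nsets V 3) x v"
    unfolding wdeg_def
  proof (rule sum_mono2)
    show "finite {e \<in> nsets V 3. v \<in> e}" using assms(1) by (simp add: finite_imp_finite_nsets)
  qed (use assms in \<open>auto intro!: prod_nonneg simp: nsets_def\<close>)
  also have "\<dots> = esym 2 (V - {v}) x"
    using wdeg_nsets[OF assms(1,4), of 2 x] by (simp add: numeral_3_eq_3)
  finally show ?thesis .
qed

text \<open>The link of \<open>v\<close> has at most the weight of the complete graph on the other vertices.\<close>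

lemma vertex_bound:
  assumes "finite V" "F \<subseteq> nsets V 3" "x \<in> weightings V" "v \<in> V"
  shows "2 * wdeg F x v \<le> (1 - x v)\<^sup>2 - (\<Sum>i\<in>V - {v}. (x i)\<^sup>2)"
proof -
  have "sum x (V - {v}) = 1 - x v" using assms by (simp add: weightings_def sum_diff1)
  then show ?thesis
    using wdeg_le_esym[OF assms(1,2) _ assms(4), of x] esym_2[of "V - {v}" x] assms(1,3)
    by (simp add: weightings_def)
qed

lemma link_sum_eq_wsum:
  "(\<Sum>e\<in>{e\<in>F. v \<in> e \<and> Q e}. \<Prod>i\<in>e - {v}. x i) = wsum ((\<lambda>e. e - {v}) ` {e\<in>F. v \<in> e \<and> Q e}) x"
proof -
  have "inj_on (\<lambda>e. e - {v}) {e\<in>F. v \<in> e \<and> Q e}"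
    by (intro inj_onI) (metis (mono_tags, lifting) insert_Diff mem_Collect_eq)
  then show ?thesis unfolding wsum_def by (simp add: sum.reindex)
qed

text \<open>Few pairs can have a large total weight only if the weights are concentrated.\<close>

lemma wsum_pairs_Cauchy_Schwarz:
  assumes "finite R" "B \<subseteq> nsets R 2"
  shows "2 * (wsum B x)\<^sup>2 \<le> real (card B) * (\<Sum>i\<in>R. (x i)\<^sup>2)\<^sup>2"
proof -
  have fB: "finite B" using assms finite_subset finite_imp_finite_nsets by blast
  have "(wsum B x)\<^sup>2 \<le> (\<Sum>e\<in>B. (\<Prod>i\<in>e. x i)\<^sup>2) * real (card B)"
    unfolding wsum_def by (rule sum_squared_le_sum_of_squares)
  moreover have "(\<Sum>e\<in>B. (\<Prod>i\<in>e. x i)\<^sup>2) \<le> esym 2 R (\<lambda>i. (x i)\<^sup>2)"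
    unfolding esym_def prod_power_distrib[symmetric]
    using assms finite_imp_finite_nsets by (intro sum_mono2) (auto intro!: prod_nonneg)
  then have "(\<Sum>e\<in>B. (\<Prod>i\<in>e. x i)\<^sup>2) * real (card B) \<le> esym 2 R (\<lambda>i. (x i)\<^sup>2) * real (card B)"
    by (intro mult_right_mono) auto
  ultimately have "2 * (wsum B x)\<^sup>2 \<le> real (card B) * (2 * esym 2 R (\<lambda>i. (x i)\<^sup>2))"
    by (simp add: mult.commute)
  also have "\<dots> \<le> real (card B) * (\<Sum>i\<in>R. (x i)\<^sup>2)\<^sup>2"
    using esym_2[OF assms(1), of "\<lambda>i. (x i)\<^sup>2"]
    by (intro mult_left_mono) (simp_all add: sum_nonneg)
  finally show ?thesis .
qed

lemma card_link:
  assumes "finite F"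
  shows "card ((\<lambda>e. e - {v}) ` {e\<in>F. v \<in> e \<and> Q e}) \<le> card {e\<in>F. v \<in> e \<and> Q e}"
  using assms by (intro card_image_le) simp

text \<open>Edges at \<open>u\<close> that contain \<open>v\<close> are separated, so that in the sum of two degrees no edge is counted twice by
the remaining terms.\<close>

lemma wdeg_split_codeg:
  assumes "finite F" "\<And>e. e \<in> F \<Longrightarrow> finite e" "u \<noteq> v"
  shows "wdeg F x u = (\<Sum>e\<in>{e\<in>F. u \<in> e \<and> v \<notin> e}. \<Prod>i\<in>e - {u}. x i) + x v * wcodeg F x u v"
proof -
  have "wdeg F x u = (\<Sum>e\<in>{e\<in>F. u \<in> e \<and> v \<notin> e}. \<Prod>i\<in>e - {u}. x i)
      + (\<Sum>e\<in>{e\<in>F. u \<in> e \<and> v \<in> e}. \<Prod>i\<in>e - {u}. x i)"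
    unfolding wdeg_def using assms(1)
    by (subst sum.union_disjoint[symmetric]) (auto intro!: sum.cong)
  also have "(\<Sum>e\<in>{e\<in>F. u \<in> e \<and> v \<in> e}. \<Prod>i\<in>e - {u}. x i) = x v * wcodeg F x u v"
    unfolding wcodeg_def sum_distrib_left
  proof (intro sum.cong refl)
    fix e assume e: "e \<in> {e\<in>F. u \<in> e \<and> v \<in> e}"
    then have "e - {u} - {v} = e - {u, v}" by auto
    then show "prod x (e - {u}) = x v * prod x (e - {u, v})"
      using e assms prod.remove[of "e - {u}" v x] by auto
  qed
  finally show ?thesis .
qed

lemma wcodeg_commute: "wcodeg F x u v = wcodeg F x v u"
  unfolding wcodeg_def by (intro sum.cong) (auto intro!: prod.cong)

lemma wcodeg_le:
  assumes "finite V" "F \<subseteq> nsets V 3" "\<And>i. i \<in> V \<Longrightarrow> 0 \<le> x i" "u \<noteq> v"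
  shows "0 \<le> wcodeg F x u v" "wcodeg F x u v \<le> sum x (V - {u, v})"
proof -
  have fF: "finite F" using assms(1,2) finite_subset finite_imp_finite_nsets by blast
  show "0 \<le> wcodeg F x u v"
    unfolding wcodeg_def using assms(2,3) by (intro sum_nonneg prod_nonneg) (auto simp: nsets_def)
  have rep: "e \<in> (\<lambda>i. {u, v, i}) ` (V - {u, v})" if "e \<in> {e\<in>F. u \<in> e \<and> v \<in> e}" for e
  proof -
    have e: "e \<subseteq> V" "finite e" "card e = 3" "u \<in> e" "v \<in> e" using that assms(2) by (auto simp: nsets_def)
    then have "card (e - {u, v}) = 1" using assms(4) by (simp add: card_Diff_subset)
    then obtain i where "e - {u, v} = {i}" by (auto simp: card_1_singleton_iff)
    then have "e = {u, v, i}" "i \<in> V - {u, v}" using e by auto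
    then show ?thesis by blast
  qed
  have "wcodeg F x u v \<le> (\<Sum>e\<in>(\<lambda>i. {u, v, i}) ` (V - {u, v}). \<Prod>i\<in>e - {u, v}. x i)"
    unfolding wcodeg_def using assms(1,3) rep
    by (intro sum_mono2) (auto intro!: prod_nonneg)
  also have "\<dots> = (\<Sum>j\<in>V - {u, v}. \<Prod>i\<in>{u, v, j} - {u, v}. x i)"
  proof (subst sum.reindex)
    show "inj_on (\<lambda>i. {u, v, i}) (V - {u, v})" by (intro inj_onI) auto
  qed simp
  also have "\<dots> = sum x (V - {u, v})"
  proof (intro sum.cong refl)
    fix j assume "j \<in> V - {u, v}"
    then have "{u, v, j} - {u, v} = {j}" by auto
    then show "(\<Prod>i\<in>{u, v, j} - {u, v}. x i) = x j" by simp
  qed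
  finally show "wcodeg F x u v \<le> sum x (V - {u, v})" .
qed

text \<open>The links of \<open>w\<close> and \<open>w'\<close> both have weight \<open>l / 2\<close>, but together they have only about \<open>N\<^sup>2 / 2\<close> edges, as
many as a single vertex would need. Cauchy-Schwarz turns this into a lower bound for the sum \<open>S\<close> of
squares of the other weights. The value of the optimum on these other vertices is known exactly from the
degrees of \<open>w\<close> and \<open>w'\<close>, and it gives an upper bound for \<open>S\<close> through Newton's identity.\<close>

lemma no_two_outer_vertices:
  fixes N :: nat
  assumes V: "finite V" and F: "F \<subseteq> nsets V 3" and x: "x \<in> weightings V"
    and deg: "\<And>v. v \<in> V \<Longrightarrow> 2 * wdeg F x v = l" and l6: "l = 6 * wsum F x"
    and w: "w \<in> V" "w' \<in> V" "w \<noteq> w'" and N: "11 \<le> N" and h: "h = 1 / real N"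
    and E: "2 * real (card {e\<in>F. w \<in> e \<or> w' \<in> e}) \<le> real N ^ 2 - 3 * real N - 6"
    and l: "1 - 3 * h + 2 * h\<^sup>2 - 12 * h ^ 3 \<le> l"
  shows False
proof -
  have hh: "0 < h" "h \<le> 1/11" using N by (auto simp: h divide_simps)
  have hN: "real N * h = 1" using N by (simp add: h)
  have fF: "finite F" "\<And>e. e \<in> F \<Longrightarrow> finite e"
    using V F finite_subset finite_imp_finite_nsets by (blast, auto simp: nsets_def)
  have nn: "0 \<le> x i" if "i \<in> V" for i using x that by (auto simp: weightings_def)
  have sx: "sum x V = 1" using x by (auto simp: weightings_def)
  (* N * K is an upper bound for the square root of twice the number of edges at w or w' *)
  define K where "K = 1 - 3/2 * h - 41/10 * h\<^sup>2"
  have "h\<^sup>2 \<le> (1/11)\<^sup>2" using hh by (intro power_mono) auto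
  then have K0: "0 \<le> K" using hh by (simp add: K_def power2_eq_square)
  have "0 \<le> h\<^sup>2 * (1/20 + 123/10 * h + 1681/100 * h\<^sup>2)" using hh by (intro mult_nonneg_nonneg) auto
  then have "1 - 3 * h - 6 * h\<^sup>2 \<le> K\<^sup>2" by (simp add: K_def field_simps power2_eq_square)
  then have "real N ^ 2 * (1 - 3 * h - 6 * h\<^sup>2) \<le> real N ^ 2 * K\<^sup>2" by (intro mult_left_mono) auto
  moreover have "real N ^ 2 * (1 - 3 * h - 6 * h\<^sup>2) = real N ^ 2 - 3 * real N * (real N * h) - 6 * (real N * h)\<^sup>2"
    by (simp add: algebra_simps power2_eq_square)
  ultimately have NK: "real N ^ 2 - 3 * real N - 6 \<le> (real N * K)\<^sup>2"
    by (simp add: hN power_mult_distrib)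
  have h3: "h ^ 3 \<le> 1/1331" using power_mono[OF hh(2), of 3] hh by (simp add: power3_eq_cube)
  have lpos: "7/10 \<le> l" using l h3 zero_le_power2[of h] hh by linarith
  have single: "h * (1 - 3/2 * h) \<le> (\<Sum>i\<in>V - {u}. (x i)\<^sup>2) \<and> x u \<le> 11/10 * h"
    if u: "u \<in> {w, w'}" for u
  proof -
    define S where "S = (\<Sum>i\<in>V - {u}. (x i)\<^sup>2)"
    have uV: "u \<in> V" using u w by auto
    have S0: "0 \<le> S" by (auto simp: S_def intro: sum_nonneg)
    define B where "B = (\<lambda>e. e - {u}) ` {e\<in>F. u \<in> e \<and> True}"
    have B: "B \<subseteq> nsets (V - {u}) 2" using F by (auto simp: B_def nsets_def)
    have "card B \<le> card {e\<in>F. u \<in> e}" using card_link[OF fF(1), where v = u and Q = "\<lambda>_. True"] by (simp add: B_def)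
    also have "\<dots> \<le> card {e\<in>F. w \<in> e \<or> w' \<in> e}" using fF u by (intro card_mono) auto
    finally have cB: "2 * real (card B) \<le> (real N * K)\<^sup>2" using E NK by linarith
    have wB: "wsum B x = l / 2"
      using link_sum_eq_wsum[where x = x and v = u and Q = "\<lambda>_. True" and F = F] deg[OF uV] by (simp add: B_def wdeg_def)
    have "2 * (l / 2)\<^sup>2 \<le> real (card B) * S\<^sup>2"
      using wsum_pairs_Cauchy_Schwarz[OF _ B, of x] V unfolding wB S_def by simp
    then have "l\<^sup>2 \<le> 2 * real (card B) * S\<^sup>2" by (simp add: power_divide)
    also have "\<dots> \<le> (real N * K)\<^sup>2 * S\<^sup>2" using cB by (intro mult_right_mono) auto
    finally have "l\<^sup>2 \<le> (real N * K * S)\<^sup>2" by (simp add: power_mult_distrib)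
    then have "l \<le> real N * K * S" using S0 K0 by (intro power2_le_imp_le[of l]) auto
    then have "h * l \<le> h * (real N * K * S)" using hh by (intro mult_left_mono) auto
    also have "\<dots> = (real N * h) * (K * S)" by simp
    finally have "h * l \<le> K * S" using hN by simp
    then have "h * l * (1 + 3/2 * h + 6 * h\<^sup>2) \<le> S"
      unfolding K_def using hh lpos by (intro divide_out_link_factor) auto
    moreover have "h * (1 - 3/2 * h) \<le> h * ((1 + 3/2 * h + 6 * h\<^sup>2) * l)"
    proof -
      have "(1 + 3/2 * h + 6 * h\<^sup>2) * (1 - 3 * h + 2 * h\<^sup>2 - 12 * h ^ 3) \<le> (1 + 3/2 * h + 6 * h\<^sup>2) * l"
        using l hh by (intro mult_left_mono) auto
      then show ?thesis using density_times_inverse[OF hh] hh by (intro mult_left_mono) auto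
    qed
    ultimately have S: "h * (1 - 3/2 * h) \<le> S" by (simp add: algebra_simps)
    have "x u \<le> 11/10 * h"
    proof (rule ccontr)
      assume "\<not> ?thesis"
      moreover have "x u \<le> 1" using member_le_sum[of u V x] V uV nn sx by auto
      ultimately have "(1 - x u)\<^sup>2 \<le> (1 - 11/10 * h)\<^sup>2" by (intro power_mono) auto
      moreover have "l + S \<le> (1 - x u)\<^sup>2"
        using vertex_bound[OF V F x uV] deg[OF uV] by (simp add: S_def)
      ultimately have "1 - 3 * h + 2 * h\<^sup>2 - 12 * h ^ 3 + h * (1 - 3/2 * h) \<le> (1 - 11/10 * h)\<^sup>2"
        using l S by linarith
      then have "h * (1/5 - 71/100 * h - 12 * h\<^sup>2) \<le> 0"
        by (simp add: field_simps power2_eq_square power3_eq_cube)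
      moreover have "0 < h * (1/5 - 71/100 * h - 12 * h\<^sup>2)"
        using hh \<open>h\<^sup>2 \<le> (1/11)\<^sup>2\<close> by (intro mult_pos_pos) (auto simp: power2_eq_square)
      ultimately show False by simp
    qed
    with S show ?thesis by (simp add: S_def)
  qed
  have M: "x v \<le> 6/5 * h" if v: "v \<in> V" for v
  proof (rule ccontr)
    assume c: "\<not> ?thesis"
    have v1: "x v \<le> 1" using member_le_sum[of v V x] V v nn sx by auto
    have "(\<Sum>i\<in>V - {v}. (x i)\<^sup>2) = (\<Sum>i\<in>V. (x i)\<^sup>2) - (x v)\<^sup>2"
      using V v by (simp add: sum_diff1)
    moreover have "(\<Sum>i\<in>V - {w}. (x i)\<^sup>2) \<le> (\<Sum>i\<in>V. (x i)\<^sup>2)"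
      using V by (intro sum_mono2) auto
    ultimately have "h * (1 - 3/2 * h) - (x v)\<^sup>2 \<le> (\<Sum>i\<in>V - {v}. (x i)\<^sup>2)"
      using single[of w] by simp
    then have *: "l + h * (1 - 3/2 * h) - (x v)\<^sup>2 \<le> (1 - x v)\<^sup>2"
      using vertex_bound[OF V F x v] deg[OF v] by linarith
    have "x v < 1/5"
    proof (rule ccontr)
      assume "\<not> x v < 1/5"
      then have "(1 - x v)\<^sup>2 \<le> (4/5)\<^sup>2" using v1 by (intro power_mono) auto
      moreover have "l \<le> (1 - x v)\<^sup>2"
        using vertex_bound[OF V F x v] deg[OF v] sum_nonneg[of "V - {v}" "\<lambda>i. (x i)\<^sup>2"] by simp
      ultimately show False using lpos by (simp add: power2_eq_square)
    qed
    then have "0 \<le> (x v - 6/5 * h) * (1 - x v - 6/5 * h)"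
      using c hh by (intro mult_nonneg_nonneg) auto
    then have "6/5 * h - 36/25 * h\<^sup>2 \<le> x v - (x v)\<^sup>2"
      by (simp add: field_simps power2_eq_square)
    then have "h * (2/5 - 119/50 * h - 12 * h\<^sup>2) \<le> 0"
      using * l by (simp add: field_simps power2_eq_square power3_eq_cube)
    moreover have "0 < h * (2/5 - 119/50 * h - 12 * h\<^sup>2)"
      using hh \<open>h\<^sup>2 \<le> (1/11)\<^sup>2\<close> by (intro mult_pos_pos) (auto simp: power2_eq_square)
    ultimately show False by simp
  qed
  define R where "R = V - {w, w'}"
  define S where "S = (\<Sum>i\<in>R. (x i)\<^sup>2)"
  define g where "g = wcodeg F x w w'"
  have fR: "finite R" using V by (simp add: R_def)
  have sR: "sum x R = 1 - x w - x w'"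
    unfolding R_def using V w sx by (simp add: sum_diff)
  have g: "0 \<le> g" "g \<le> 1 - x w - x w'"
    using wcodeg_le[OF V F _ w(3), of x] nn sR by (auto simp: g_def R_def)
  have S0: "0 \<le> S" by (auto simp: S_def intro: sum_nonneg)
  have S1: "1414/1000 * h * (l - (x w + x w') * g) \<le> K * S"
  proof -
    define B1 where "B1 = (\<lambda>e. e - {w}) ` {e\<in>F. w \<in> e \<and> w' \<notin> e}"
    define B2 where "B2 = (\<lambda>e. e - {w'}) ` {e\<in>F. w' \<in> e \<and> w \<notin> e}"
    have sub: "B1 \<subseteq> nsets R 2" "B2 \<subseteq> nsets R 2" using F by (auto simp: B1_def B2_def R_def nsets_def)
    have "card B1 + card B2 \<le> card {e\<in>F. w \<in> e \<and> w' \<notin> e} + card {e\<in>F. w' \<in> e \<and> w \<notin> e}"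
      unfolding B1_def B2_def using card_link[OF fF(1)] by (intro add_mono) auto
    also have "\<dots> = card ({e\<in>F. w \<in> e \<and> w' \<notin> e} \<union> {e\<in>F. w' \<in> e \<and> w \<notin> e})"
      using fF by (subst card_Un_disjoint) auto
    also have "\<dots> \<le> card {e\<in>F. w \<in> e \<or> w' \<in> e}" using fF by (intro card_mono) auto
    finally have "real (card B1) + real (card B2) \<le> real (card {e\<in>F. w \<in> e \<or> w' \<in> e})"
      by (metis of_nat_add of_nat_mono)
    then have "2 * (real (card B1) + real (card B2)) \<le> 2 * real (card {e\<in>F. w \<in> e \<or> w' \<in> e})" by simp
    also note E
    also note NK
    finally have cB: "2 * (real (card B1) + real (card B2)) \<le> (real N * K)\<^sup>2" .
    define T1 T2 where "T1 = wsum B1 x" and "T2 = wsum B2 x"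
    have "wdeg F x w = T1 + x w' * g"
      unfolding T1_def B1_def g_def link_sum_eq_wsum[symmetric] by (rule wdeg_split_codeg[OF fF w(3)])
    moreover have "wdeg F x w' = T2 + x w * g"
      unfolding T2_def B2_def g_def link_sum_eq_wsum[symmetric] wcodeg_commute[of F x w w']
      by (rule wdeg_split_codeg[OF fF w(3)[symmetric]])
    ultimately have "l = T1 + T2 + (x w + x w') * g"
      using deg[OF w(1)] deg[OF w(2)] by (simp add: algebra_simps)
    moreover have "1414/1000 * (T1 + T2) \<le> real N * K * S"
    proof -
      have "(T1 + T2)\<^sup>2 \<le> 2 * T1\<^sup>2 + 2 * T2\<^sup>2"
        using zero_le_power2[of "T1 - T2"] by (simp add: power2_eq_square algebra_simps)
      moreover have "2 * T1\<^sup>2 \<le> real (card B1) * S\<^sup>2" "2 * T2\<^sup>2 \<le> real (card B2) * S\<^sup>2"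
        unfolding T1_def T2_def S_def
        by (rule wsum_pairs_Cauchy_Schwarz[OF fR sub(1)], rule wsum_pairs_Cauchy_Schwarz[OF fR sub(2)])
      ultimately have T: "2 * (T1 + T2)\<^sup>2 \<le> (2 * (real (card B1) + real (card B2))) * S\<^sup>2"
        by (simp only: distrib_right distrib_left mult.assoc)
      have "(2 * (real (card B1) + real (card B2))) * S\<^sup>2 \<le> (real N * K)\<^sup>2 * S\<^sup>2"
        by (rule mult_right_mono[OF cB]) simp
      then have "2 * (T1 + T2)\<^sup>2 \<le> (real N * K * S)\<^sup>2"
        unfolding power_mult_distrib[of "real N * K" S] by (rule order_trans[OF T])
      moreover have "(1414/1000 * (T1 + T2))\<^sup>2 \<le> 2 * (T1 + T2)\<^sup>2"
        unfolding power_mult_distrib by (rule mult_right_mono) (simp_all add: power2_eq_square)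
      ultimately have "(1414/1000 * (T1 + T2))\<^sup>2 \<le> (real N * K * S)\<^sup>2" by linarith
      then show ?thesis by (rule power2_le_imp_le) (use S0 K0 in simp)
    qed
    ultimately have "1414/1000 * (l - (x w + x w') * g) \<le> real N * K * S" by simp
    then have "h * (1414/1000 * (l - (x w + x w') * g)) \<le> h * (real N * K * S)"
      by (rule mult_left_mono) (use hh in simp)
    also have "\<dots> = (real N * h) * (K * S)" by simp
    finally have "h * (1414/1000 * (l - (x w + x w') * g)) \<le> K * S" using hN by (simp only: mult_1_left)
    moreover have "1414/1000 * h * (l - (x w + x w') * g) = h * (1414/1000 * (l - (x w + x w') * g))"
      by simp
    ultimately show ?thesis by (simp only:)
  qed
  have E3: "l * (1 - 3 * (x w + x w')) + 6 * x w * x w' * g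
      \<le> (1 - (x w + x w')) ^ 3 - (3 * (1 - (x w + x w')) - 2 * (6/5 * h)) * S"
  proof -
    have s1: "wsum F x = wsum {e\<in>F. w \<notin> e} x + x w * (l / 2)"
      using wsum_split[OF fF, of x w] deg[OF w(1)] by simp
    have s2: "wsum {e\<in>F. w \<notin> e} x = wsum {e\<in>{e\<in>F. w \<notin> e}. w' \<notin> e} x + x w' * wdeg {e\<in>F. w \<notin> e} x w'"
      by (rule wsum_split) (use fF in auto)
    have s3: "wdeg {e\<in>F. w \<notin> e} x w' = l / 2 - x w * g"
    proof -
      have "{e \<in> {e \<in> F. w \<notin> e}. w' \<in> e} = {e \<in> F. w' \<in> e \<and> w \<notin> e}" by auto
      then have "wdeg {e\<in>F. w \<notin> e} x w' = (\<Sum>e\<in>{e\<in>F. w' \<in> e \<and> w \<notin> e}. \<Prod>i\<in>e - {w'}. x i)"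
        by (simp add: wdeg_def)
      then show ?thesis
        using wdeg_split_codeg[OF fF w(3)[symmetric], of x] deg[OF w(2)]
        unfolding g_def wcodeg_commute[of F x w w'] by linarith
    qed
    have "wsum {e\<in>{e\<in>F. w \<notin> e}. w' \<notin> e} x \<le> esym 3 R x"
      unfolding wsum_def esym_def R_def using V F nn
      by (intro sum_mono2) (auto intro!: prod_nonneg finite_imp_finite_nsets simp: nsets_def)
    then have e1: "6 * (wsum F x - x w * (l / 2) - x w' * (l / 2 - x w * g)) \<le> 6 * esym 3 R x"
      using s1 s2 s3 by simp
    have e2: "6 * esym 3 R x = (1 - x w - x w') ^ 3 - 3 * (1 - x w - x w') * S + 2 * (\<Sum>i\<in>R. x i ^ 3)"
      using esym_3[OF fR, of x] by (simp add: sR S_def)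
    have e3: "(\<Sum>i\<in>R. x i ^ 3) \<le> 6/5 * h * S"
      unfolding S_def sum_distrib_left
    proof (intro sum_mono)
      fix i assume "i \<in> R"
      then have "x i \<le> 6/5 * h" using M by (auto simp: R_def)
      then have "x i * (x i)\<^sup>2 \<le> 6/5 * h * (x i)\<^sup>2" by (rule mult_right_mono) simp
      then show "x i ^ 3 \<le> 6/5 * h * (x i)\<^sup>2"
        by (simp add: power2_eq_square power3_eq_cube)
    qed
    have e4: "6 * (wsum F x - x w * (l / 2) - x w' * (l / 2 - x w * g))
        = l * (1 - 3 * (x w + x w')) + 6 * x w * x w' * g"
      using l6 by (simp add: algebra_simps)
    have e5: "1 - (x w + x w') = 1 - x w - x w'" by simp
    have e6: "(3 * (1 - x w - x w') - 2 * (6/5 * h)) * S = 3 * (1 - x w - x w') * S - 2 * (6/5 * h * S)"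
      by (simp only: left_diff_distrib mult.assoc)
    show ?thesis unfolding e5 e6 using e1 e2 e3 e4 by linarith
  qed
  show False
    by (rule outer_pair_inequalities_inconsistent[OF hh l nn[OF w(1)] _ nn[OF w(2)] _ g S1[unfolded K_def] order_refl E3])
      (use single in auto)
qed

section \<open>One vertex outside the clique\<close>

text \<open>The clique on \<open>A\<close> without the triples of \<open>T\<close>, together with an apex \<open>t\<close> whose link lacks exactly the pairs of
\<open>M\<close>. Describing the graph by what is missing keeps all degree equations short.\<close>

definition config :: "'a \<Rightarrow> 'a set \<Rightarrow> 'a set set \<Rightarrow> 'a set set \<Rightarrow> 'a three_graph" where
  "config t A T M = Three_Graph (insert t A) (nsets (insert t A) 3 - (T \<union> insert t ` M))"

lemma verts_config [simp]: "verts (config t A T M) = insert t A"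
  by (simp add: config_def)

lemma config_graph:
  assumes "finite A" shows "is_three_graph (config t A T M)"
  using assms by (auto simp: config_def is_three_graph_def)

lemma wdeg_Un:
  assumes "finite F" "finite F'" "F \<inter> F' = {}"
  shows "wdeg (F \<union> F') x v = wdeg F x v + wdeg F' x v"
proof -
  have "{e \<in> F \<union> F'. v \<in> e} = {e\<in>F. v \<in> e} \<union> {e\<in>F'. v \<in> e}" by auto
  then show ?thesis unfolding wdeg_def
    using assms by (simp add: sum.union_disjoint disjoint_iff)
qed

lemma wdeg_insert_image:
  assumes "\<And>p. p \<in> M \<Longrightarrow> t \<notin> p" "\<And>p. p \<in> M \<Longrightarrow> finite p"
  shows "wdeg (insert t ` M) x t = wsum M x"
    and "j \<noteq> t \<Longrightarrow> wdeg (insert t ` M) x j = x t * wdeg M x j"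
    and "wsum (insert t ` M) x = x t * wsum M x"
proof -
  have inj: "inj_on (insert t) M" using assms(1) by (intro inj_onI) (metis insert_ident)
  have inj': "inj_on (insert t) {p\<in>M. j \<in> p}" using inj by (rule inj_on_subset) auto
  have "{e \<in> insert t ` M. t \<in> e} = insert t ` M" by auto
  then have "wdeg (insert t ` M) x t = (\<Sum>p\<in>M. \<Prod>i\<in>insert t p - {t}. x i)"
    using sum.reindex[OF inj, of "\<lambda>e. prod x (e - {t})"] by (simp only: wdeg_def o_def)
  also have "\<dots> = wsum M x"
    unfolding wsum_def using assms(1) by (intro sum.cong refl) (metis Diff_insert_absorb)
  finally show "wdeg (insert t ` M) x t = wsum M x" .
  show "wdeg (insert t ` M) x j = x t * wdeg M x j" if j: "j \<noteq> t"
  proof -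
    have "{e \<in> insert t ` M. j \<in> e} = insert t ` {p\<in>M. j \<in> p}" using j by auto
    then have "wdeg (insert t ` M) x j = (\<Sum>p\<in>{p\<in>M. j \<in> p}. \<Prod>i\<in>insert t p - {j}. x i)"
      using sum.reindex[OF inj', of "\<lambda>e. prod x (e - {j})"] by (simp only: wdeg_def o_def)
    also have "\<dots> = (\<Sum>p\<in>{p\<in>M. j \<in> p}. x t * (\<Prod>i\<in>p - {j}. x i))"
    proof (intro sum.cong refl)
      fix p assume p: "p \<in> {p\<in>M. j \<in> p}"
      then have "insert t p - {j} = insert t (p - {j})" using j by auto
      then show "(\<Prod>i\<in>insert t p - {j}. x i) = x t * (\<Prod>i\<in>p - {j}. x i)"
        using p assms by simp
    qed
    finally show ?thesis by (simp add: wdeg_def sum_distrib_left)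
  qed
  have "wsum (insert t ` M) x = (\<Sum>p\<in>M. \<Prod>i\<in>insert t p. x i)"
    using sum.reindex[OF inj, of "prod x"] by (simp only: wsum_def o_def)
  also have "\<dots> = (\<Sum>p\<in>M. x t * (\<Prod>i\<in>p. x i))"
    using assms by (intro sum.cong refl) simp
  finally show "wsum (insert t ` M) x = x t * wsum M x" by (simp add: wsum_def sum_distrib_left)
qed

lemma wsum_eq_esym: "wsum (nsets A k) x = esym k A x"
  by (simp add: wsum_def esym_def)

lemma wsum_Diff:
  assumes "finite F" "F' \<subseteq> F"
  shows "wsum (F - F') x = wsum F x - wsum F' x"
  unfolding wsum_def using assms by (simp add: sum_diff)

lemma wsum_Un:
  assumes "finite F" "finite F'" "F \<inter> F' = {}"
  shows "wsum (F \<union> F') x = wsum F x + wsum F' x"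
  unfolding wsum_def using assms by (simp add: sum.union_disjoint)

lemma wsum_nonneg:
  assumes "F \<subseteq> nsets A k" "\<And>i. i \<in> A \<Longrightarrow> 0 \<le> x i"
  shows "0 \<le> wsum F x"
proof -
  have "e \<subseteq> A" if "e \<in> F" for e using assms(1) that by (auto simp: nsets_def)
  then show ?thesis unfolding wsum_def using assms(2) by (intro sum_nonneg prod_nonneg) blast
qed

lemma wdeg_nonneg':
  assumes "F \<subseteq> nsets A k" "\<And>i. i \<in> A \<Longrightarrow> 0 \<le> x i"
  shows "0 \<le> wdeg F x v"
proof -
  have "e \<subseteq> A" if "e \<in> F" for e using assms(1) that by (auto simp: nsets_def)
  then show ?thesis using assms(2) by (intro wdeg_nonneg) blast
qed

lemma config_missing:
  assumes "finite A" "t \<notin> A" "T \<subseteq> nsets A 3" "M \<subseteq> nsets A 2"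
  shows "finite T" "finite M" "T \<inter> insert t ` M = {}" "T \<union> insert t ` M \<subseteq> nsets (insert t A) 3"
    "\<And>p. p \<in> M \<Longrightarrow> t \<notin> p" "\<And>p. p \<in> M \<Longrightarrow> finite p"
proof -
  show "finite T" "finite M"
    using assms finite_subset finite_imp_finite_nsets by (blast, blast)
  show "T \<inter> insert t ` M = {}" using assms(2,3) by (auto simp: nsets_def)
  have "insert t p \<in> nsets (insert t A) 3" if "p \<in> M" for p
    using that assms(2,4) by (auto simp: nsets_def card_insert_if subset_iff)
  moreover have "T \<subseteq> nsets (insert t A) 3" using assms(3) by (auto simp: nsets_def)
  ultimately show "T \<union> insert t ` M \<subseteq> nsets (insert t A) 3" by blast
  show "\<And>p. p \<in> M \<Longrightarrow> t \<notin> p" "\<And>p. p \<in> M \<Longrightarrow> finite p"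
    using assms(2,4) by (auto simp: nsets_def)
qed

lemma wsum_config:
  assumes "finite A" "t \<notin> A" "T \<subseteq> nsets A 3" "M \<subseteq> nsets A 2"
  shows "wsum (edges (config t A T M)) x
    = esym 3 A x + x t * esym 2 A x - wsum T x - x t * wsum M x"
proof -
  note m = config_missing[OF assms]
  have "wsum (edges (config t A T M)) x = esym 3 (insert t A) x - wsum (T \<union> insert t ` M) x"
    unfolding config_def wsum_eq_esym[symmetric] three_graph.sel
    using assms(1) m(4) by (intro wsum_Diff) (auto intro!: finite_imp_finite_nsets)
  also have "wsum (T \<union> insert t ` M) x = wsum T x + x t * wsum M x"
    using wsum_Un[of T "insert t ` M" x] m wdeg_insert_image(3)[OF m(5,6), where x = x] by simp
  finally show ?thesis
    using esym_insert[OF assms(1,2), of 2 x] by (simp add: numeral_3_eq_3)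
qed

lemma wdeg_config:
  assumes "finite A" "t \<notin> A" "T \<subseteq> nsets A 3" "M \<subseteq> nsets A 2" and x: "x \<in> weightings (insert t A)"
  shows "2 * wdeg (edges (config t A T M)) x t
      = 1 - (\<Sum>i\<in>insert t A. (x i)\<^sup>2) - 2 * (x t * (1 - x t) + wsum M x)"
    and "j \<in> A \<Longrightarrow> 2 * wdeg (edges (config t A T M)) x j
      = 1 - (\<Sum>i\<in>insert t A. (x i)\<^sup>2) - 2 * (x j * (1 - x j) + x t * wdeg M x j + wdeg T x j)"
proof -
  note m = config_missing[OF assms(1-4)]
  have fin: "finite (insert t A)" "finite (nsets (insert t A) 3)"
    using assms(1) by (auto intro!: finite_imp_finite_nsets)
  have sx: "sum x (insert t A) = 1" using x by (simp only: weightings_def mem_Collect_eq)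
  have K: "2 * wdeg (nsets (insert t A) 3) x v = 1 - (\<Sum>i\<in>insert t A. (x i)\<^sup>2) - 2 * (x v * (1 - x v))"
    if v: "v \<in> insert t A" for v
  proof -
    have e1: "sum x (insert t A - {v}) = 1 - x v" using sum_diff1[OF fin(1), of x v] v sx by simp
    have e2: "(\<Sum>i\<in>insert t A - {v}. (x i)\<^sup>2) = (\<Sum>i\<in>insert t A. (x i)\<^sup>2) - (x v)\<^sup>2"
      using sum_diff1[OF fin(1), of "\<lambda>i. (x i)\<^sup>2" v] v by simp
    have "2 * esym 2 (insert t A - {v}) x
        = (1 - x v)\<^sup>2 - ((\<Sum>i\<in>insert t A. (x i)\<^sup>2) - (x v)\<^sup>2)"
      using esym_2[of "insert t A - {v}" x] fin(1) unfolding e1 e2 by blast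
    moreover have "wdeg (nsets (insert t A) 3) x v = esym 2 (insert t A - {v}) x"
      using wdeg_nsets[OF fin(1) v, of 2 x] by (simp add: numeral_3_eq_3)
    ultimately show ?thesis by (simp add: power2_eq_square algebra_simps)
  qed
  have D: "wdeg (edges (config t A T M)) x v
     = wdeg (nsets (insert t A) 3) x v - (wdeg T x v + wdeg (insert t ` M) x v)" for v
    unfolding config_def three_graph.sel wdeg_Diff[OF fin(2) m(4)]
    using wdeg_Un[of T "insert t ` M" x v] m by simp
  have "{e\<in>T. t \<in> e} = {}" using assms(2,3) by (auto simp: nsets_def)
  then have "wdeg T x t = 0" unfolding wdeg_def by (simp only: sum.empty)
  then show "2 * wdeg (edges (config t A T M)) x t
      = 1 - (\<Sum>i\<in>insert t A. (x i)\<^sup>2) - 2 * (x t * (1 - x t) + wsum M x)"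
    using D[of t] K[of t] wdeg_insert_image(1)[OF m(5,6), where x = x] by simp
  show "2 * wdeg (edges (config t A T M)) x j
      = 1 - (\<Sum>i\<in>insert t A. (x i)\<^sup>2) - 2 * (x j * (1 - x j) + x t * wdeg M x j + wdeg T x j)"
    if j: "j \<in> A"
  proof -
    have "j \<noteq> t" using j assms(2) by auto
    then show ?thesis
      using D[of j] K[of j] j wdeg_insert_image(2)[OF m(5,6), where j = j and x = x] by simp
  qed
qed

text \<open>By \<open>wdeg_config\<close> the degree of a vertex differs from a common constant by the weight of its missing
links and a term that depends on its own weight only; optimality compares these expressions.\<close>

lemma config_kkt:
  assumes "finite A" "t \<notin> A" "T \<subseteq> nsets A 3" "M \<subseteq> nsets A 2"
    and x: "x \<in> weightings (insert t A)" "lagrange_poly (config t A T M) x = lagrangian (config t A T M)"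
    and j: "j \<in> A"
  shows "0 < x t \<Longrightarrow> x t * (1 - x t) + wsum M x \<le> x j * (1 - x j) + x t * wdeg M x j + wdeg T x j"
    and "0 < x j \<Longrightarrow> x j * (1 - x j) + x t * wdeg M x j + wdeg T x j \<le> x t * (1 - x t) + wsum M x"
    and "l \<in> A \<Longrightarrow> 0 < x j \<Longrightarrow> x j * (1 - x j) + x t * wdeg M x j + wdeg T x j
      \<le> x l * (1 - x l) + x t * wdeg M x l + wdeg T x l"
proof -
  have o: "wdeg (edges (config t A T M)) x v \<le> wdeg (edges (config t A T M)) x u"
    if "u \<in> insert t A" "v \<in> insert t A" "0 < x u" for u v
    using optimum_wdeg_le[OF config_graph[OF assms(1)], of x t T M u v] x that by simp
  note w = wdeg_config[OF assms(1-4) x(1)]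
  show "0 < x t \<Longrightarrow> x t * (1 - x t) + wsum M x \<le> x j * (1 - x j) + x t * wdeg M x j + wdeg T x j"
    using o[of t j] w(1) w(2)[OF j] j by simp
  show "0 < x j \<Longrightarrow> x j * (1 - x j) + x t * wdeg M x j + wdeg T x j \<le> x t * (1 - x t) + wsum M x"
    using o[of j t] w(1) w(2)[OF j] j by simp
  show "l \<in> A \<Longrightarrow> 0 < x j \<Longrightarrow> x j * (1 - x j) + x t * wdeg M x j + wdeg T x j
      \<le> x l * (1 - x l) + x t * wdeg M x l + wdeg T x l"
    using o[of j l] w(2)[OF j] w(2)[of l] j by simp
qed

lemma wdeg_cong:
  assumes "\<And>e i. e \<in> F \<Longrightarrow> i \<in> e \<Longrightarrow> i \<noteq> v \<Longrightarrow> x i = y i"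
  shows "wdeg F x v = wdeg F y v"
  unfolding wdeg_def using assms by (intro sum.cong prod.cong) auto

lemma wsum_upd:
  assumes "finite F" "\<And>e. e \<in> F \<Longrightarrow> finite e"
  shows "wsum F (x(v := x v + s)) = wsum F x + s * wdeg F x v"
proof -
  have "wsum {e\<in>F. v \<notin> e} (x(v := x v + s)) = wsum {e\<in>F. v \<notin> e} x"
    unfolding wsum_def by (intro sum.cong prod.cong) auto
  moreover have "wdeg F (x(v := x v + s)) v = wdeg F x v" by (intro wdeg_cong) auto
  ultimately show ?thesis
    using wsum_split[OF assms, where x = x and v = v]
      wsum_split[OF assms, where x = "x(v := x v + s)" and v = v]
    by (simp add: algebra_simps)
qed

text \<open>Giving the weight of the apex to a vertex \<open>a\<close> of the clique changes the value by \<open>x t\<close> times the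
difference of what is missing at \<open>t\<close> and at \<open>a\<close>, up to the weight of the edges through both.\<close>

lemma absorb_apex:
  assumes "finite A" "t \<notin> A" "T \<subseteq> nsets A 3" "M \<subseteq> nsets A 2"
    and x: "x \<in> weightings (insert t A)" and a: "a \<in> A"
  shows "x(a := x a + x t) \<in> weightings A"
    and "wsum (nsets A 3 - T) (x(a := x a + x t))
      = wsum (edges (config t A T M)) x + x t * (wsum M x - wdeg T x a - x a * (1 - x t - x a))"
proof -
  note m = config_missing[OF assms(1-4)]
  have sx: "sum x A = 1 - x t" using x assms(1,2) by (simp add: weightings_def)
  have "sum (x(a := x a + x t)) A = (x a + x t) + sum x (A - {a})"
  proof -
    have "sum (x(a := x a + x t)) (A - {a}) = sum x (A - {a})" by (intro sum.cong) auto
    then show ?thesis using sum.remove[OF assms(1) a, of "x(a := x a + x t)"] by simp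
  qed
  also have "\<dots> = 1" using sum_diff1[OF assms(1), of x a] a sx by simp
  finally show "x(a := x a + x t) \<in> weightings A" using x a by (simp add: weightings_def)
  have fin: "finite (nsets A 3)" using assms(1) by (rule finite_imp_finite_nsets)
  have "wsum (nsets A 3) (x(a := x a + x t)) = esym 3 A x + x t * esym 2 (A - {a}) x"
  proof -
    have "wsum (nsets A 3) (x(a := x a + x t)) = wsum (nsets A 3) x + x t * wdeg (nsets A 3) x a"
      by (rule wsum_upd[OF fin]) (auto simp: nsets_def)
    then show ?thesis using wdeg_nsets[OF assms(1) a, of 2 x] by (simp add: wsum_eq_esym eval_nat_numeral)
  qed
  moreover have "wsum T (x(a := x a + x t)) = wsum T x + x t * wdeg T x a"
    by (rule wsum_upd[OF m(1)]) (use assms(3) in \<open>auto simp: nsets_def\<close>)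
  moreover have e: "esym 2 A x = esym 2 (A - {a}) x + x a * (1 - x t - x a)"
    using esym_remove[OF assms(1) a, of 1 x] esym_1[of "A - {a}" x] assms(1) a
      sum_diff1[OF assms(1), of x a] sx by (simp add: numeral_2_eq_2)
  ultimately show "wsum (nsets A 3 - T) (x(a := x a + x t))
      = wsum (edges (config t A T M)) x + x t * (wsum M x - wdeg T x a - x a * (1 - x t - x a))"
    unfolding wsum_Diff[OF fin assms(3)] wsum_config[OF assms(1-4)] e
    by (simp add: algebra_simps)
qed

text \<open>The sets on the right are the neighbours of \<open>i\<close> in the graph \<open>M\<close>.\<close>

lemma pairs_at:
  assumes "finite A" "M \<subseteq> nsets A 2" "i \<in> A"
  shows "wdeg M x i = sum x {j \<in> A - {i}. {i, j} \<in> M}"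
    and "card {p\<in>M. i \<in> p} = card {j \<in> A - {i}. {i, j} \<in> M}"
proof -
  let ?J = "{j \<in> A - {i}. {i, j} \<in> M}"
  have inj: "inj_on (\<lambda>j. {i, j}) ?J" by (intro inj_onI) (auto simp: doubleton_eq_iff)
  have im: "(\<lambda>j. {i, j}) ` ?J = {p\<in>M. i \<in> p}"
  proof (intro set_eqI iffI)
    fix p assume p: "p \<in> {p\<in>M. i \<in> p}"
    then have "finite p" "card (p - {i}) = 1" "p \<subseteq> A" using assms(2) by (auto simp: nsets_def)
    then obtain j where j: "p - {i} = {j}" by (auto simp: card_1_singleton_iff)
    then have "p = {i, j}" "j \<in> A - {i}" using p \<open>p \<subseteq> A\<close> by auto
    then show "p \<in> (\<lambda>j. {i, j}) ` ?J" using p by auto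
  qed auto
  show "card {p\<in>M. i \<in> p} = card ?J" unfolding im[symmetric] using inj by (rule card_image)
  have "wdeg M x i = (\<Sum>j\<in>?J. \<Prod>k\<in>{i, j} - {i}. x k)"
    unfolding wdeg_def im[symmetric] sum.reindex[OF inj] by simp
  also have "\<dots> = sum x ?J"
  proof (intro sum.cong refl)
    fix j assume "j \<in> ?J"
    then have "{i, j} - {i} = {j}" by auto
    then show "(\<Prod>k\<in>{i, j} - {i}. x k) = x j" by simp
  qed
  finally show "wdeg M x i = sum x ?J" .
qed

lemma pairs_at_complement:
  assumes "finite A" "M \<subseteq> nsets A 2" "i \<in> A"
  shows "sum x A = x i + wdeg M x i + sum x {j \<in> A - {i}. {i, j} \<notin> M}"
    and "card A = Suc (card {p\<in>M. i \<in> p} + card {j \<in> A - {i}. {i, j} \<notin> M})"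
    and "card M = card {p\<in>M. i \<in> p} + card {p\<in>M. i \<notin> p}"
proof -
  have u: "A - {i} = {j \<in> A - {i}. {i, j} \<in> M} \<union> {j \<in> A - {i}. {i, j} \<notin> M}" by auto
  have "sum x (A - {i}) = sum x {j \<in> A - {i}. {i, j} \<in> M} + sum x {j \<in> A - {i}. {i, j} \<notin> M}"
    using assms(1) by (subst u, intro sum.union_disjoint) auto
  then show "sum x A = x i + wdeg M x i + sum x {j \<in> A - {i}. {i, j} \<notin> M}"
    using sum.remove[OF assms(1,3), of x] pairs_at(1)[OF assms, of x] by simp
  have "card (A - {i}) = card {j \<in> A - {i}. {i, j} \<in> M} + card {j \<in> A - {i}. {i, j} \<notin> M}"
    using assms(1) by (subst u, intro card_Un_disjoint) auto
  then show "card A = Suc (card {p\<in>M. i \<in> p} + card {j \<in> A - {i}. {i, j} \<notin> M})"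
    using card_Suc_Diff1[OF assms(1,3)] pairs_at(2)[OF assms] by simp
  have "finite M" using assms(1,2) finite_subset finite_imp_finite_nsets by blast
  then show "card M = card {p\<in>M. i \<in> p} + card {p\<in>M. i \<notin> p}"
    by (subst card_Un_disjoint[symmetric]) (auto intro!: arg_cong[where f = card])
qed

lemma pivot_step:
  fixes \<alpha> z P y S n :: real
  assumes "0 < z" "z < \<alpha>" "0 \<le> P" "\<alpha> \<le> y" "0 < n" "n * \<alpha> \<le> S"
    and "(y - \<alpha>) * S \<le> z * S + P"
  shows "(\<alpha> - z) * y \<le> \<alpha>\<^sup>2 - z\<^sup>2 + P / n"
proof -
  have "(\<alpha> - z) * (y - \<alpha> - z) \<le> P / n"
  proof (cases "y - \<alpha> - z \<le> 0")
    case True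
    then have "(\<alpha> - z) * (y - \<alpha> - z) \<le> 0" using assms(2) by (intro mult_nonneg_nonpos) auto
    then show ?thesis using assms(3,5) by (meson divide_nonneg_pos order_trans)
  next
    case False
    have "n * (\<alpha> - z) * (y - \<alpha> - z) \<le> S * (y - \<alpha> - z)"
    proof (intro mult_right_mono)
      have "n * (\<alpha> - z) \<le> n * \<alpha>" using assms(1,5) by (intro mult_left_mono) auto
      then show "n * (\<alpha> - z) \<le> S" using assms(6) by linarith
    qed (use False in simp)
    also have "\<dots> \<le> P" using assms(7) by (simp add: algebra_simps)
    finally show ?thesis using assms(5) by (simp add: field_simps)
  qed
  moreover have "(\<alpha> - z) * y = \<alpha>\<^sup>2 - z\<^sup>2 + (\<alpha> - z) * (y - \<alpha> - z)"
    by (simp add: algebra_simps power2_eq_square)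
  ultimately show ?thesis by simp
qed

text \<open>The comparison of the degrees of \<open>i\<close> and of the apex, rewritten: \<open>z\<close> is the weight of the apex, \<open>P\<close> what
the missing triples take from the degree of \<open>i\<close>.\<close>

lemma pivot_sum:
  assumes A: "finite A" and i: "i \<in> A" and M: "M \<subseteq> nsets A 2" and s: "sum y A = 1 - z"
    and K1: "z * (1 - z) + wsum M y \<le> y i * (1 - y i) + z * wdeg M y i + P"
  shows "wsum {p\<in>M. i \<notin> p} y \<le> (y i - z) * sum y {j \<in> A - {i}. {i, j} \<notin> M} + P"
proof -
  have "wsum M y = wsum {p\<in>M. i \<notin> p} y + y i * wdeg M y i"
    using A M finite_subset[OF M] finite_imp_finite_nsets[OF A]
    by (intro wsum_split) (auto simp: nsets_def)
  moreover have "sum y {j \<in> A - {i}. {i, j} \<notin> M} = 1 - z - y i - wdeg M y i"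
    using pairs_at_complement(1)[OF A M i, of y] s by simp
  then have "(y i - z) * sum y {j \<in> A - {i}. {i, j} \<notin> M} = (y i - z) * (1 - z - y i - wdeg M y i)"
    by simp
  ultimately show ?thesis using K1 by (simp add: algebra_simps)
qed

text \<open>A lightest vertex \<open>i\<close> is compared with the apex. Its \<open>d\<close> neighbours in the link of the apex have weight at
most \<open>y i + z + P / S\<close>, where \<open>S\<close> is the total weight of the vertices of the clique other than \<open>i\<close> and the
neighbour, hence at least \<open>(N - 2) * y i\<close>. Multiplying by \<open>y i - z\<close> leaves \<open>(y i)\<^sup>2 - z\<^sup>2\<close> and a multiple
of \<open>P\<close> per neighbour.\<close>

lemma pivot:
  fixes y :: "'a \<Rightarrow> real"
  assumes A: "finite A" "card A = N" "3 \<le> N" and i: "i \<in> A" and M: "M \<subseteq> nsets A 2"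
    and nn: "0 \<le> y i" and z: "0 < z" and s: "sum y A = 1 - z"
    and min: "\<And>j. j \<in> A \<Longrightarrow> y i \<le> y j" and P: "0 \<le> P"
    and K1: "z * (1 - z) + wsum M y \<le> y i * (1 - y i) + z * wdeg M y i + P"
    and K2: "\<And>j. j \<in> A \<Longrightarrow> 0 < y j \<Longrightarrow> y j * (1 - y j) + z * wdeg M y j \<le> y i * (1 - y i) + z * wdeg M y i + P"
    and d: "d = card {j \<in> A - {i}. {i, j} \<notin> M}"
  shows "wsum {p\<in>M. i \<notin> p} y \<le> P
    \<or> wsum {p\<in>M. i \<notin> p} y < real d * (y i)\<^sup>2 + P * (1 + real d / (real N - 2))"
proof -
  let ?J = "{j \<in> A - {i}. {i, j} \<notin> M}"
  have finJ: "finite ?J" using A by simp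
  have L: "wsum {p\<in>M. i \<notin> p} y \<le> (y i - z) * sum y ?J + P"
    by (rule pivot_sum[OF A(1) i M s K1])
  have yn: "0 \<le> y j" if "j \<in> A" for j using min[OF that] nn by simp
  have J0: "0 \<le> sum y ?J" using yn by (intro sum_nonneg) auto
  show ?thesis
  proof (cases "y i \<le> z \<or> d = 0")
    case True
    then have "(y i - z) * sum y ?J \<le> 0"
    proof
      assume "y i \<le> z" then show ?thesis using J0 by (intro mult_nonpos_nonneg) auto
    next
      assume "d = 0"
      then have "?J = {}" using d finJ by (metis card_0_eq)
      then show ?thesis by (simp only: sum.empty mult_zero_right order_refl)
    qed
    then show ?thesis using L by linarith
  next
    case False
    then have zi: "z < y i" and d1: "1 \<le> real d" by auto
    have wi: "wdeg M y i = 1 - z - y i - sum y ?J"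
      using pairs_at_complement(1)[OF A(1) M i, of y] s by simp
    have step: "(y i - z) * y j \<le> (y i)\<^sup>2 - z\<^sup>2 + P / (real N - 2)" if j: "j \<in> ?J" for j
    proof (rule pivot_step[OF z zi P])
      have jA: "j \<in> A" "j \<noteq> i" using j by auto
      show "y i \<le> y j" using min jA by simp
      show "0 < real N - 2" using A(3) by simp
      define S where "S = 1 - z - y i - y j"
      have "S = sum y (A - {i, j})" using s A(1) i jA by (simp add: S_def sum_diff)
      moreover have "real (card (A - {i, j})) * y i \<le> sum y (A - {i, j})"
        using min by (intro sum_bounded_below) auto
      moreover have "card (A - {i, j}) = N - 2" using A i jA by (simp add: card_Diff_subset)
      ultimately show "(real N - 2) * y i \<le> S" using A(3) by (simp add: of_nat_diff)
      have "y j \<le> sum y ?J" using j finJ yn by (intro member_le_sum) auto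
      then have "z * wdeg M y i \<le> z * S" using z wi by (intro mult_left_mono) (auto simp: S_def)
      moreover have "0 \<le> z * wdeg M y j"
        using z wdeg_nonneg'[OF M, of y j] yn by (intro mult_nonneg_nonneg) auto
      moreover have "0 < y j" using zi z min[OF jA(1)] by simp
      moreover have "0 \<le> z * (y j - y i)" using z min[OF jA(1)] by (intro mult_nonneg_nonneg) auto
      ultimately show "(y j - y i) * S \<le> z * S + P"
        using K2[OF jA(1)] by (simp add: S_def algebra_simps)
    qed
    have "(y i - z) * sum y ?J = (\<Sum>j\<in>?J. (y i - z) * y j)" by (rule sum_distrib_left)
    also have "\<dots> \<le> real d * ((y i)\<^sup>2 - z\<^sup>2 + P / (real N - 2))"
      unfolding d using step by (intro sum_bounded_above) auto
    finally have "wsum {p\<in>M. i \<notin> p} y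
        \<le> real d * (y i)\<^sup>2 + P * (1 + real d / (real N - 2)) - real d * z\<^sup>2"
      using L by (simp add: algebra_simps)
    moreover have "0 < real d * z\<^sup>2" using d1 z by simp
    ultimately show ?thesis by linarith
  qed
qed

section \<open>Missing triples that meet\<close>

lemma esym3_perm:
  assumes "bij_betw \<pi> A A" "finite A"
  shows "esym 3 A (y \<circ> \<pi>) = esym 3 A y"
proof -
  have "sum (\<lambda>i. f (y (\<pi> i))) A = sum (\<lambda>i. f (y i)) A" for f :: "real \<Rightarrow> real"
    using sum.reindex_bij_betw[OF assms(1), of "\<lambda>i. f (y i)"] .
  from this[of "\<lambda>r. r"] this[of "\<lambda>r. r\<^sup>2"] this[of "\<lambda>r. r ^ 3"]
  have "6 * esym 3 A (y \<circ> \<pi>) = 6 * esym 3 A y"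
    unfolding esym_3[OF assms(2)] by (simp add: o_def)
  then show ?thesis by simp
qed

lemma bij_of_two_sets:
  assumes A: "finite A" and g: "g1 \<subseteq> A" "g2 \<subseteq> A" "f1 \<subseteq> A" "f2 \<subseteq> A"
    and c: "card g1 = card f1" "card g2 = card f2" "card (g1 \<inter> g2) = card (f1 \<inter> f2)"
  shows "\<exists>\<pi>. bij_betw \<pi> A A \<and> \<pi> ` f1 = g1 \<and> \<pi> ` f2 = g2"
proof -
  have fin: "finite f1" "finite f2" "finite g1" "finite g2" using A g finite_subset by blast+
  have c1: "card (f1 - f2) = card (g1 - g2)" "card (f2 - f1) = card (g2 - g1)"
    using c fin card_Diff_subset_Int[of f1 f2] card_Diff_subset_Int[of f2 f1]
      card_Diff_subset_Int[of g1 g2] card_Diff_subset_Int[of g2 g1]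
    by (auto simp: Int_commute)
  have "card (f1 \<union> f2) = card (g1 \<union> g2)"
    using c fin card_Un_Int[of f1 f2] card_Un_Int[of g1 g2] by simp
  then have c2: "card (A - (f1 \<union> f2)) = card (A - (g1 \<union> g2))"
    using A g fin by (simp add: card_Diff_subset)
  obtain p where p: "bij_betw p (f1 \<inter> f2) (g1 \<inter> g2)"
    using finite_same_card_bij[of "f1 \<inter> f2" "g1 \<inter> g2"] fin c by auto
  obtain q where q: "bij_betw q (f1 - f2) (g1 - g2)"
    using finite_same_card_bij[of "f1 - f2" "g1 - g2"] fin c1 by auto
  obtain r where r: "bij_betw r (f2 - f1) (g2 - g1)"
    using finite_same_card_bij[of "f2 - f1" "g2 - g1"] fin c1 by auto
  obtain s where s: "bij_betw s (A - (f1 \<union> f2)) (A - (g1 \<union> g2))"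
    using finite_same_card_bij[of "A - (f1 \<union> f2)" "A - (g1 \<union> g2)"] A c2 by auto
  define \<pi> where "\<pi> x = (if x \<in> f1 then if x \<in> f2 then p x else q x else if x \<in> f2 then r x else s x)" for x
  have P: "bij_betw \<pi> (f1 \<inter> f2) (g1 \<inter> g2)" and Q: "bij_betw \<pi> (f1 - f2) (g1 - g2)"
    and R: "bij_betw \<pi> (f2 - f1) (g2 - g1)" and S: "bij_betw \<pi> (A - (f1 \<union> f2)) (A - (g1 \<union> g2))"
    by (rule bij_betw_cong[THEN iffD2, OF _ p], simp add: \<pi>_def)
      (rule bij_betw_cong[THEN iffD2, OF _ q], simp add: \<pi>_def,
       rule bij_betw_cong[THEN iffD2, OF _ r], simp add: \<pi>_def,
       rule bij_betw_cong[THEN iffD2, OF _ s], simp add: \<pi>_def)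
  have "bij_betw \<pi> ((f1 \<inter> f2) \<union> (f1 - f2)) ((g1 \<inter> g2) \<union> (g1 - g2))"
    by (rule bij_betw_combine[OF P Q]) auto
  then have 1: "bij_betw \<pi> f1 g1" by (simp add: Int_Diff_Un)
  have "bij_betw \<pi> ((f1 \<inter> f2) \<union> (f2 - f1)) ((g1 \<inter> g2) \<union> (g2 - g1))"
    by (rule bij_betw_combine[OF P R]) auto
  moreover have "(f1 \<inter> f2) \<union> (f2 - f1) = f2" "(g1 \<inter> g2) \<union> (g2 - g1) = g2" by auto
  ultimately have 2: "bij_betw \<pi> f2 g2" by simp
  have "bij_betw \<pi> (f1 \<union> (f2 - f1)) (g1 \<union> (g2 - g1))"
    by (rule bij_betw_combine[OF 1 R]) auto
  then have "bij_betw \<pi> (f1 \<union> (f2 - f1) \<union> (A - (f1 \<union> f2))) (g1 \<union> (g2 - g1) \<union> (A - (g1 \<union> g2)))"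
    by (rule bij_betw_combine[OF _ S]) auto
  moreover have "f1 \<union> (f2 - f1) \<union> (A - (f1 \<union> f2)) = A" "g1 \<union> (g2 - g1) \<union> (A - (g1 \<union> g2)) = A"
    using g by auto
  ultimately show ?thesis using 1 2 by (auto simp: bij_betw_def)
qed

text \<open>Two pairs of triples with intersections of equal size are exchanged by a permutation of \<open>A\<close>.\<close>

lemma same_type_le_lagrangian:
  assumes A: "finite A" and f: "f1 \<in> nsets A 3" "f2 \<in> nsets A 3" "f1 \<noteq> f2"
    and g: "g1 \<in> nsets A 3" "g2 \<in> nsets A 3" "g1 \<noteq> g2" and c: "card (g1 \<inter> g2) = card (f1 \<inter> f2)"
    and y: "y \<in> weightings A"
  shows "wsum (nsets A 3 - {g1, g2}) y \<le> lagrangian (Three_Graph A (nsets A 3 - {f1, f2}))"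
proof -
  obtain \<pi> where \<pi>: "bij_betw \<pi> A A" "\<pi> ` f1 = g1" "\<pi> ` f2 = g2"
    using bij_of_two_sets[OF A, of g1 g2 f1 f2] f g c by (auto simp: nsets_def)
  have fin: "finite (nsets A 3)" using A by (rule finite_imp_finite_nsets)
  have w: "y \<circ> \<pi> \<in> weightings A"
    using y \<pi>(1) sum.reindex_bij_betw[OF \<pi>(1), of y] by (auto simp: weightings_def bij_betw_def)
  have pr: "(\<Prod>i\<in>f. (y \<circ> \<pi>) i) = (\<Prod>i\<in>\<pi> ` f. y i)" if "f \<subseteq> A" for f
  proof -
    have "inj_on \<pi> f" using \<pi>(1) that by (meson bij_betw_def inj_on_subset)
    then show ?thesis by (simp add: prod.reindex)
  qed
  have "wsum (nsets A 3 - {f1, f2}) (y \<circ> \<pi>) = wsum (nsets A 3 - {g1, g2}) y"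
  proof -
    have "wsum {f1, f2} (y \<circ> \<pi>) = wsum {g1, g2} y"
      unfolding wsum_def using f g pr[of f1] pr[of f2] \<pi>(2,3) by (simp add: nsets_def)
    then show ?thesis
      using wsum_Diff[OF fin, of "{f1, f2}" "y \<circ> \<pi>"] wsum_Diff[OF fin, of "{g1, g2}" y] f g
        esym3_perm[OF \<pi>(1) A, of y] by (simp add: wsum_eq_esym)
  qed
  moreover have "is_three_graph (Three_Graph A (nsets A 3 - {f1, f2}))"
    using A by (auto simp: is_three_graph_def)
  ultimately show ?thesis
    using lagrange_poly_le_lagrangian[of "Three_Graph A (nsets A 3 - {f1, f2})" "y \<circ> \<pi>"] w
    by (simp add: lagrange_poly_wsum)
qed

lemma sum_ge_with_exceptions:
  fixes f :: "'b \<Rightarrow> real"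
  assumes "finite X" "finite E" "\<And>p. p \<in> X - E \<Longrightarrow> \<rho> \<le> f p"
    "\<And>p. p \<in> X \<inter> E \<Longrightarrow> c p \<le> f p" "\<And>p. p \<in> E \<Longrightarrow> c p \<le> \<rho>"
  shows "real (card X) * \<rho> - (\<Sum>p\<in>E. \<rho> - c p) \<le> sum f X"
proof -
  have "- (\<Sum>p\<in>E. \<rho> - c p) \<le> - (\<Sum>p\<in>X \<inter> E. \<rho> - c p)"
    using assms by (simp, intro sum_mono2) auto
  also have "\<dots> \<le> (\<Sum>p\<in>X \<inter> E. f p - \<rho>)"
    unfolding sum_negf[symmetric] using assms(4) by (intro sum_mono) force
  also have "\<dots> \<le> (\<Sum>p\<in>X \<inter> E. f p - \<rho>) + (\<Sum>p\<in>X - E. f p - \<rho>)"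
    using assms(3) by (simp, intro sum_nonneg) auto
  also have "\<dots> = (\<Sum>p\<in>X. f p - \<rho>)"
    using sum.Int_Diff[OF assms(1), of "\<lambda>p. f p - \<rho>" E] by simp
  finally show ?thesis by (simp add: sum_subtractf)
qed

lemma pairE:
  assumes "p \<in> nsets B 2" obtains a b where "p = {a, b}" "a \<in> B" "b \<in> B" "a \<noteq> b"
  using assms by (auto simp: nsets_def card_2_iff)

text \<open>The comparison needed when the missing triples share one vertex. The numbers \<open>u1, u2, u3, u4\<close> are the four
smallest weights after \<open>\<alpha>\<close>. Both sides are linear in \<open>d / n\<close> once \<open>d\<close> is bounded below by \<open>9 * (d / n)\<close> on the
right, so the two extreme values of this ratio decide.\<close>

lemma matching_slack_with_23:
  fixes u1 u2 u3 u4 \<alpha> d n :: real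
  assumes u: "0 < u1" "u1 \<le> u2" "u2 \<le> u3" "u3 \<le> u4" "u3 \<le> 3 * u1"
    and a: "0 \<le> \<alpha>" "\<alpha> \<le> u1" and d: "0 \<le> d" "d \<le> n" "9 \<le> n"
  shows "d * \<alpha>\<^sup>2 + d / n * (u1 * u4 + u2 * u3) \<le> u1 * u2 + u1 * u3 + d * (u1 * u4)"
proof -
  define \<theta> where "\<theta> = d / n"
  have \<theta>: "0 \<le> \<theta>" "\<theta> \<le> 1" "d = \<theta> * n" using d by (auto simp: \<theta>_def)
  have a2: "\<alpha>\<^sup>2 \<le> u1\<^sup>2" using a by (intro power_mono)
  define Y where "Y = 8 * u1 * u4 - 9 * u1\<^sup>2 - u2 * u3"
  have "u1\<^sup>2 \<le> u1 * u4" using u by (simp add: power2_eq_square)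
  then have "\<theta> * 9 * (u1 * u4 - u1\<^sup>2) \<le> \<theta> * n * (u1 * u4 - u1\<^sup>2)"
    using \<theta> d by (intro mult_right_mono mult_left_mono) auto
  moreover have "d * \<alpha>\<^sup>2 \<le> \<theta> * n * u1\<^sup>2" unfolding \<theta>(3) using \<theta> d a2 by (intro mult_left_mono) auto
  ultimately have 1: "u1 * u2 + u1 * u3 + \<theta> * Y \<le> u1 * u2 + u1 * u3 + d * (u1 * u4) - d * \<alpha>\<^sup>2 - \<theta> * (u1 * u4 + u2 * u3)"
    unfolding \<theta>(3) Y_def by (simp add: algebra_simps)
  have X: "0 \<le> u1 * u2 + u1 * u3" using u by simp
  have XY: "0 \<le> u1 * u2 + u1 * u3 + Y"
  proof -
    have "0 \<le> (u2 - u1) * (9 * u1 - u2)" using u by (intro mult_nonneg_nonneg) auto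
    moreover have "0 \<le> (u3 - u2) * (9 * u1 - u2)" using u by (intro mult_nonneg_nonneg) auto
    moreover have "0 \<le> u1 * (u4 - u3)" using u by (intro mult_nonneg_nonneg) auto
    ultimately show ?thesis unfolding Y_def by (simp add: algebra_simps power2_eq_square)
  qed
  have "0 \<le> (1 - \<theta>) * (u1 * u2 + u1 * u3) + \<theta> * (u1 * u2 + u1 * u3 + Y)"
    by (rule add_nonneg_nonneg[OF mult_nonneg_nonneg[OF _ X] mult_nonneg_nonneg[OF _ XY]]) (use \<theta> in simp_all)
  then have "0 \<le> u1 * u2 + u1 * u3 + \<theta> * Y" by (simp add: algebra_simps)
  then show ?thesis using 1 unfolding \<theta>_def by linarith
qed

text \<open>The same comparison when the pair of the second and third lightest vertex is present in the link of the
apex. Then the missing pairs may all contain the vertex of weight \<open>u1\<close>, and \<open>u3 < 3 * u1\<close> limits how light it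
can be.\<close>

lemma matching_slack_without_23:
  fixes u1 u2 u3 u4 \<alpha> d n :: real
  assumes u: "0 < u1" "u1 \<le> u2" "u2 \<le> u3" "u3 \<le> u4" "u3 < 3 * u1"
    and a: "0 \<le> \<alpha>" "\<alpha> \<le> u1" and d: "0 \<le> d" "d \<le> n" "9 \<le> n"
  shows "d * \<alpha>\<^sup>2 + (1 + d / n) * (u1 * u4 + u2 * u3) \<le> u1 * u2 + u1 * u3 + (2 + d) * (u1 * u4)"
    and "u1 * u4 + u2 * u3 < u1 * u2 + u1 * u3 + 2 * (u1 * u4)"
proof -
  have u34: "u1 * u3 \<le> u1 * u4" using u by simp
  have X: "0 < u1 * u2 + u1 * u3 + u1 * u4 - u2 * u3"
  proof (cases "u2 \<le> 2 * u1")
    case True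
    then have "0 \<le> u3 * (2 * u1 - u2)" "0 < u1 * u2" using u by auto
    then show ?thesis using u34 by (simp add: algebra_simps)
  next
    case False
    have "0 < (3 * u1 - u3) * (u2 - 2 * u1)" "0 \<le> 2 * u1 * (3 * u1 - u2)"
      using False u by (intro mult_pos_pos mult_nonneg_nonneg; simp)+
    then show ?thesis using u34 by (simp add: algebra_simps)
  qed
  then show "u1 * u4 + u2 * u3 < u1 * u2 + u1 * u3 + 2 * (u1 * u4)" by linarith
  define \<theta> where "\<theta> = d / n"
  have \<theta>: "0 \<le> \<theta>" "\<theta> \<le> 1" "d = \<theta> * n" using d by (auto simp: \<theta>_def)
  have a2: "\<alpha>\<^sup>2 \<le> u1\<^sup>2" using a by (intro power_mono)
  define Y where "Y = 8 * u1 * u4 - 9 * u1\<^sup>2 - u2 * u3"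
  have "u1\<^sup>2 \<le> u1 * u4" using u by (simp add: power2_eq_square)
  then have "\<theta> * 9 * (u1 * u4 - u1\<^sup>2) \<le> \<theta> * n * (u1 * u4 - u1\<^sup>2)"
    using \<theta> d by (intro mult_right_mono mult_left_mono) auto
  moreover have "d * \<alpha>\<^sup>2 \<le> \<theta> * n * u1\<^sup>2" unfolding \<theta>(3) using \<theta> d a2 by (intro mult_left_mono) auto
  ultimately have 1: "u1 * u2 + u1 * u3 + u1 * u4 - u2 * u3 + \<theta> * Y
      \<le> u1 * u2 + u1 * u3 + (2 + d) * (u1 * u4) - d * \<alpha>\<^sup>2 - (1 + \<theta>) * (u1 * u4 + u2 * u3)"
    unfolding \<theta>(3) Y_def by (simp add: algebra_simps)
  have XY: "0 \<le> u1 * u2 + u1 * u3 + u1 * u4 - u2 * u3 + Y"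
  proof -
    have "0 \<le> (u2 - u1) * (9 * u1 - 2 * u2)" using u by (intro mult_nonneg_nonneg) auto
    moreover have "0 \<le> (u3 - u2) * (10 * u1 - 2 * u2)" using u by (intro mult_nonneg_nonneg) auto
    ultimately show ?thesis using u34 unfolding Y_def by (simp add: algebra_simps power2_eq_square)
  qed
  have "0 \<le> (1 - \<theta>) * (u1 * u2 + u1 * u3 + u1 * u4 - u2 * u3) + \<theta> * (u1 * u2 + u1 * u3 + u1 * u4 - u2 * u3 + Y)"
    using X XY \<theta> by (intro add_nonneg_nonneg[OF mult_nonneg_nonneg mult_nonneg_nonneg]) simp_all
  then have "0 \<le> u1 * u2 + u1 * u3 + u1 * u4 - u2 * u3 + \<theta> * Y" by (simp add: algebra_simps)
  then show "d * \<alpha>\<^sup>2 + (1 + d / n) * (u1 * u4 + u2 * u3) \<le> u1 * u2 + u1 * u3 + (2 + d) * (u1 * u4)"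
    using 1 unfolding \<theta>_def by linarith
qed


text \<open>Rearrangement: the matching of four vertices that pairs the lightest with the heaviest is the lightest one,
and the \<open>k\<close>-th lightest of four distinct vertices weighs at least the \<open>k\<close>-th smallest weight.\<close>

lemma matching_sorted:
  fixes y :: "'a \<Rightarrow> real"
  assumes s: "\<And>a. a \<in> B \<Longrightarrow> u1 \<le> y a" "\<And>a b. a \<in> B \<Longrightarrow> b \<in> B \<Longrightarrow> a \<noteq> b \<Longrightarrow> u2 \<le> max (y a) (y b)"
    "\<And>a b c. a \<in> B \<Longrightarrow> b \<in> B \<Longrightarrow> c \<in> B \<Longrightarrow> distinct [a, b, c] \<Longrightarrow> u3 \<le> max (y a) (max (y b) (y c))"
    "\<And>a b c e. a \<in> B \<Longrightarrow> b \<in> B \<Longrightarrow> c \<in> B \<Longrightarrow> e \<in> B \<Longrightarrow> distinct [a, b, c, e]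
      \<Longrightarrow> u4 \<le> max (y a) (max (y b) (max (y c) (y e)))"
    and u: "0 \<le> u1" "u1 \<le> u2" "u2 \<le> u3" "u3 \<le> u4"
    and B: "a \<in> B" "b \<in> B" "c \<in> B" "e \<in> B" "distinct [a, b, c, e]"
  shows "u1 * u4 + u2 * u3 \<le> y a * y b + y c * y e"
proof -
  have main: "u1 * u4 + u2 * u3 \<le> y a * y b + y c * y e"
    if B: "a \<in> B" "b \<in> B" "c \<in> B" "e \<in> B" "distinct [a, b, c, e]"
      and o: "y a \<le> y b" "y c \<le> y e" "y b \<le> y e" for a b c e
  proof -
    have e: "u4 \<le> y e" using s(4)[of a b c e] B o by (auto simp: max_def split: if_splits)
    have nn: "0 \<le> y a" "0 \<le> y b" "0 \<le> y c" using s(1) B u by force+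
    consider "y c \<le> y b" "y a \<le> y c" | "y c \<le> y b" "y c \<le> y a" | "y b \<le> y c" by linarith
    then show ?thesis
    proof cases
      case 1
      have "u3 \<le> y b" using s(3)[of a b c] B o 1 by (auto simp: max_def split: if_splits)
      moreover have "u2 \<le> y c" using s(2)[of a c] B 1 by (auto simp: max_def split: if_splits)
      ultimately have "u1 * u3 + u2 * u4 \<le> y a * y b + y c * y e"
        using s(1)[of a] B u e nn by (intro add_mono mult_mono) auto
      moreover have "0 \<le> (u2 - u1) * (u4 - u3)" using u by (intro mult_nonneg_nonneg) auto
      ultimately show ?thesis by (simp add: algebra_simps)
    next
      case 2
      have "u3 \<le> y b" using s(3)[of a b c] B o 2 by (auto simp: max_def split: if_splits)
      moreover have "u2 \<le> y a" using s(2)[of a c] B 2 by (auto simp: max_def split: if_splits)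
      ultimately have "u2 * u3 + u1 * u4 \<le> y a * y b + y c * y e"
        using s(1)[of c] B u e nn by (intro add_mono mult_mono) auto
      then show ?thesis by simp
    next
      case 3
      have "u3 \<le> y c" using s(3)[of a b c] B o 3 by (auto simp: max_def split: if_splits)
      moreover have "u2 \<le> y b" using s(2)[of a b] B o by (auto simp: max_def split: if_splits)
      ultimately have "u1 * u2 + u3 * u4 \<le> y a * y b + y c * y e"
        using s(1)[of a] B u e nn by (intro add_mono mult_mono) auto
      moreover have "0 \<le> (u3 - u1) * (u4 - u2)" using u by (intro mult_nonneg_nonneg) auto
      ultimately show ?thesis by (simp add: algebra_simps)
    qed
  qed
  have half: "u1 * u4 + u2 * u3 \<le> y a * y b + y c * y e"
    if B: "a \<in> B" "b \<in> B" "c \<in> B" "e \<in> B" "distinct [a, b, c, e]" and o: "y a \<le> y b" "y c \<le> y e" for a b c e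
  proof (cases "y b \<le> y e")
    case True then show ?thesis using main[of a b c e] that by simp
  next
    case False then show ?thesis using main[of c e a b] that by auto
  qed
  consider "y a \<le> y b" "y c \<le> y e" | "y a \<le> y b" "y e \<le> y c" | "y b \<le> y a" "y c \<le> y e" | "y b \<le> y a" "y e \<le> y c"
    by linarith
  then show ?thesis
    using half[of a b c e] half[of a b e c] half[of b a c e] half[of b a e c] B
    by cases (auto simp: mult.commute)
qed

text \<open>At most \<open>card A - 1\<close> pairs contain \<open>i\<close>, and each of them that is not missing leaves one more missing
pair elsewhere.\<close>

lemma card_avoiding:
  assumes "finite A" "M \<subseteq> nsets A 2" "i \<in> A" "card A + 3 \<le> card M"
  shows "4 + card {j \<in> A - {i}. {i, j} \<notin> M} \<le> card {p\<in>M. i \<notin> p}"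
  using pairs_at_complement(2,3)[OF assms(1-3)] assms(4) by linarith

lemma avoiding_pair_in:
  assumes "M \<subseteq> nsets A 2" "p \<in> {p\<in>M. i \<notin> p}"
  shows "p \<in> nsets (A - {i}) 2"
  using assms by (auto simp: nsets_def)

lemma pivot_config:
  assumes A: "finite A" "3 \<le> card A" "t \<notin> A" "T \<subseteq> nsets A 3" "M \<subseteq> nsets A 2"
    and x: "x \<in> weightings (insert t A)" "lagrange_poly (config t A T M) x = lagrangian (config t A T M)"
    and t: "0 < x t" and i: "i \<in> A" and min: "\<And>j. j \<in> A \<Longrightarrow> x i \<le> x j"
    and d: "d = card {j \<in> A - {i}. {i, j} \<notin> M}" and P: "P = wdeg T x i"
  shows "wsum {p\<in>M. i \<notin> p} x \<le> P
    \<or> wsum {p\<in>M. i \<notin> p} x < real d * (x i)\<^sup>2 + P * (1 + real d / (real (card A) - 2))"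
proof (rule pivot[where y = x and z = "x t" and i = i and N = "card A", OF A(1) refl A(2) i A(5) _ t _ min _ _ _ d])
  have nn: "0 \<le> x j" if "j \<in> A" for j using x that by (auto simp: weightings_def)
  note kkt = config_kkt[OF A(1,3,4,5) x]
  show "0 \<le> x i" using nn i .
  show "sum x A = 1 - x t" using x A(1,3) by (simp add: weightings_def)
  show "0 \<le> P" unfolding P using A(4) nn by (rule wdeg_nonneg')
  show "x t * (1 - x t) + wsum M x \<le> x i * (1 - x i) + x t * wdeg M x i + P"
    unfolding P by (rule kkt(1)[OF i t])
  show "x j * (1 - x j) + x t * wdeg M x j \<le> x i * (1 - x i) + x t * wdeg M x i + P" if "j \<in> A" "0 < x j" for j
  proof -
    have "0 \<le> wdeg T x j" using A(4) nn by (rule wdeg_nonneg')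
    then show ?thesis using kkt(3)[OF that(1) i that(2)] unfolding P by linarith
  qed
qed

text \<open>Here \<open>P\<close> is the sum of the weights of the two lightest pairs \<open>{v1, v2}\<close> and \<open>{v1, v3}\<close>. Two of the
\<open>4 + d\<close> missing pairs pay for \<open>P\<close>, two more for \<open>P * (d / (N - 2))\<close>, where the pair \<open>p0\<close> guarantees
\<open>d \<le> N - 2\<close>, and the others for \<open>d\<close> times the square of the weight of \<open>i\<close>.\<close>

lemma no_optimum_if_missing_share_pair:
  assumes A: "finite A" "11 \<le> card A" "t \<notin> A" and M: "M \<subseteq> nsets A 2" "card A + 3 \<le> card M"
    and T: "T = {{i, v1, v2}, {i, v1, v3}}"
    and x: "x \<in> weightings (insert t A)" "lagrange_poly (config t A T M) x = lagrangian (config t A T M)"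
    and t: "0 < x t" and v: "i \<in> A" "v1 \<in> A" "v2 \<in> A" "v3 \<in> A" "distinct [i, v1, v2, v3]"
    and min: "\<And>j. j \<in> A \<Longrightarrow> x i \<le> x j" "\<And>j. j \<in> A - {i} \<Longrightarrow> x v1 \<le> x j"
      "\<And>j. j \<in> A - {i, v1} \<Longrightarrow> x v2 \<le> x j" "\<And>j. j \<in> A - {i, v1, v2} \<Longrightarrow> x v3 \<le> x j"
    and pos: "0 < x v1" and j: "p0 \<in> M" "i \<in> p0"
  shows False
proof -
  define d where "d = card {j \<in> A - {i}. {i, j} \<notin> M}"
  define L where "L = {p\<in>M. i \<notin> p}"
  have fM: "finite M" using A(1) M(1) finite_subset finite_imp_finite_nsets by blast
  have u: "x v1 \<le> x v2" "x v2 \<le> x v3" "0 \<le> x i" "x i \<le> x v1"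
    using min v x by (auto simp: weightings_def)
  have TA: "T \<subseteq> nsets A 3" using v unfolding T by (auto simp: nsets_def)
  have P: "wdeg T x i = x v1 * x v2 + x v1 * x v3"
  proof -
    have ne: "{i, v1, v2} \<noteq> {i, v1, v3}" using v by auto
    have "{e\<in>T. i \<in> e} = {{i, v1, v2}, {i, v1, v3}}" unfolding T by auto
    moreover have "{i, v1, v2} - {i} = {v1, v2}" "{i, v1, v3} - {i} = {v1, v3}" using v by auto
    ultimately show ?thesis using ne v by (simp add: wdeg_def)
  qed
  have card: "4 + d \<le> card L" unfolding d_def L_def by (rule card_avoiding[OF A(1) M(1) v(1) M(2)])
  have "card {p\<in>M. i \<in> p} \<noteq> 0" using j fM by auto
  then have dN: "d \<le> card A - 2"
    using pairs_at_complement(2)[OF A(1) M(1) v(1)] unfolding d_def by linarith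
  define \<rho> where "\<rho> = x v1 * x v3"
  have \<rho>: "0 < \<rho>" using pos u by (simp add: \<rho>_def)
  have pair: "\<rho> \<le> (\<Prod>k\<in>p. x k)" if p: "p \<in> L" "p \<noteq> {v1, v2}" for p
  proof -
    obtain a b where ab: "p = {a, b}" "a \<in> A - {i}" "b \<in> A - {i}" "a \<noteq> b"
      using pairE[OF avoiding_pair_in[OF M(1)]] p(1) unfolding L_def by metis
    have l: "x v1 * x v3 \<le> x a * x b" if "a \<in> A - {i}" "b \<in> A - {i, v1, v2}" for a b
      using that min(2)[of a] min(4)[of b] u pos by (intro mult_mono) auto
    consider "b \<notin> {v1, v2}" | "a \<notin> {v1, v2}" using ab p by auto
    then have "x v1 * x v3 \<le> x a * x b"
    proof cases
      case 1 then show ?thesis using l[of a b] ab by auto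
    next
      case 2 then show ?thesis using l[of b a] ab by (auto simp: mult.commute)
    qed
    then show ?thesis using ab by (simp add: \<rho>_def)
  qed
  have "real (card L) * \<rho> - (\<Sum>p\<in>{{v1, v2}}. \<rho> - x v1 * x v2) \<le> (\<Sum>p\<in>L. \<Prod>k\<in>p. x k)"
  proof (rule sum_ge_with_exceptions)
    show "finite L" using fM by (simp add: L_def)
    show "x v1 * x v2 \<le> prod x p" if "p \<in> L \<inter> {{v1, v2}}" for p
      using that v by auto
    show "x v1 * x v2 \<le> \<rho>" unfolding \<rho>_def using u pos by simp
  qed (use pair in auto)
  moreover have "(4 + real d) * \<rho> \<le> real (card L) * \<rho>"
    using card \<rho> by (intro mult_right_mono) auto
  ultimately have low: "x v1 * x v2 + (3 + real d) * \<rho> \<le> wsum L x"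
    by (simp add: wsum_def algebra_simps)
  have a2: "(x i)\<^sup>2 \<le> \<rho>" unfolding \<rho>_def power2_eq_square using u by (intro mult_mono) auto
  have P2: "wdeg T x i \<le> 2 * \<rho>" unfolding P \<rho>_def using u pos by simp
  have q: "0 \<le> real d / (real (card A) - 2)" "real d / (real (card A) - 2) \<le> 1"
    using dN A(2) by (auto simp: divide_simps)
  have "wdeg T x i * (real d / (real (card A) - 2)) \<le> 2 * \<rho> * 1"
    using P2 q \<rho> by (intro mult_mono) auto
  moreover have "real d * (x i)\<^sup>2 \<le> real d * \<rho>" using a2 by (intro mult_left_mono) auto
  moreover have P': "wdeg T x i = x v1 * x v2 + \<rho>" unfolding P \<rho>_def ..
  moreover have "wdeg T x i < wsum L x"
  proof -
    have "0 \<le> real d * \<rho>" using \<rho> by simp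
    moreover have "(3 + real d) * \<rho> = 3 * \<rho> + real d * \<rho>" by (simp add: algebra_simps)
    ultimately show ?thesis using low \<rho> unfolding P' by linarith
  qed
  moreover have "wsum L x \<le> wdeg T x i
      \<or> wsum L x < real d * (x i)\<^sup>2 + wdeg T x i * (1 + real d / (real (card A) - 2))"
    unfolding L_def using A(2)
    by (intro pivot_config[OF A(1) _ A(3) TA M(1) x t v(1) min(1) d_def refl]) auto
  moreover have "wdeg T x i * (1 + real d / (real (card A) - 2))
      = wdeg T x i + wdeg T x i * (real d / (real (card A) - 2))"
    "(3 + real d) * \<rho> = 3 * \<rho> + real d * \<rho>"
    by (simp_all only: distrib_left distrib_right mult_1_right)
  ultimately show False using low by linarith
qed

text \<open>The vertex \<open>v1\<close> lies in only one missing triple, together with \<open>i\<close>, so it misses very little weight there.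
Comparing it with the apex shows that the apex is at most as heavy as \<open>v1\<close>, since at least one of the four
pairs of \<open>M\<close> that avoid \<open>v1\<close> is as heavy as \<open>{i, v4}\<close>. Hence \<open>v1\<close> cannot lose much by its missing pairs
either, and it is not much lighter than \<open>v3\<close>.\<close>

lemma third_lightest_less_three_times:
  assumes A: "finite A" "11 \<le> card A" "t \<notin> A" and M: "M \<subseteq> nsets A 2" "card A + 3 \<le> card M"
    and T: "T = {{i, v1, v4}, {i, v2, v3}}"
    and x: "x \<in> weightings (insert t A)" "lagrange_poly (config t A T M) x = lagrangian (config t A T M)"
    and t: "0 < x t" and v: "i \<in> A" "v1 \<in> A" "v2 \<in> A" "v3 \<in> A" "v4 \<in> A" "distinct [i, v1, v2, v3, v4]"
    and min: "\<And>j. j \<in> A \<Longrightarrow> x i \<le> x j" "\<And>j. j \<in> A - {i} \<Longrightarrow> x v1 \<le> x j"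
      "\<And>j. j \<in> A - {i, v1} \<Longrightarrow> x v2 \<le> x j" "\<And>j. j \<in> A - {i, v1, v2} \<Longrightarrow> x v3 \<le> x j"
      "\<And>j. j \<in> A - {i, v1, v2, v3} \<Longrightarrow> x v4 \<le> x j"
    and pos: "0 < x v1" and cov: "wdeg M x v1 < 1 - x t - x v1"
  shows "x v3 < 3 * x v1"
proof -
  have nn: "0 \<le> x j" if "j \<in> A" for j using x that by (auto simp: weightings_def)
  have sA: "sum x A = 1 - x t" using x A(1,3) by (simp add: weightings_def)
  have TA: "T \<subseteq> nsets A 3" using v unfolding T by (auto simp: nsets_def)
  note kkt = config_kkt[OF A(1,3) TA M(1) x]
  have u: "x v1 \<le> x v2" "x v2 \<le> x v3" "x v3 \<le> x v4" "0 \<le> x i" "x i \<le> x v1"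
    using min v nn by auto
  have P: "wdeg T x v1 = x i * x v4"
  proof -
    have "{e\<in>T. v1 \<in> e} = {{i, v1, v4}}" unfolding T using v by auto
    moreover have "{i, v1, v4} - {v1} = {i, v4}" using v by auto
    ultimately show ?thesis using v by (simp add: wdeg_def)
  qed
  define L where "L = {p\<in>M. v1 \<notin> p}"
  have fL: "finite L" using A(1) M(1) finite_subset finite_imp_finite_nsets unfolding L_def by fastforce
  have "x i * x v4 \<le> wsum L x"
  proof -
    have "4 \<le> card L" using card_avoiding[OF A(1) M(1) v(2) M(2)] by (simp add: L_def)
    moreover have "card {{i, v2}, {i, v3}, {v2, v3}} \<le> 3"
      using card_length[of "[{i, v2}, {i, v3}, {v2, v3}]"] by simp
    ultimately have "\<not> L \<subseteq> {{i, v2}, {i, v3}, {v2, v3}}"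
      using card_mono[of "{{i, v2}, {i, v3}, {v2, v3}}" L] by fastforce
    then obtain p where p: "p \<in> L" "p \<notin> {{i, v2}, {i, v3}, {v2, v3}}" by blast
    obtain a b where ab: "p = {a, b}" "a \<in> A - {v1}" "b \<in> A - {v1}" "a \<noteq> b"
      using pairE[OF avoiding_pair_in[OF M(1)]] p(1) unfolding L_def by metis
    have l: "x i * x v4 \<le> x a * x b" if "a \<in> A" "b \<in> A - {i, v1, v2, v3}" for a b
      using that min(1)[of a] min(5)[of b] nn v by (intro mult_mono) auto
    consider "b \<notin> {i, v2, v3}" | "a \<notin> {i, v2, v3}" using ab p by auto
    then have "x i * x v4 \<le> x a * x b"
    proof cases
      case 1 then show ?thesis using l[of a b] ab by auto
    next
      case 2 then show ?thesis using l[of b a] ab by (auto simp: mult.commute)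
    qed
    also have "\<dots> = (\<Prod>k\<in>p. x k)" using ab by simp
    also have "\<dots> \<le> wsum L x"
      unfolding wsum_def
    proof (rule member_le_sum[OF p(1) _ fL])
      fix q assume "q \<in> L - {p}"
      then have "q \<subseteq> A" using M(1) by (auto simp: L_def nsets_def)
      then show "0 \<le> prod x q" using nn by (intro prod_nonneg) blast
    qed
    finally show ?thesis .
  qed
  moreover have "wsum L x \<le> (x v1 - x t) * sum x {j \<in> A - {v1}. {v1, j} \<notin> M} + x i * x v4"
    unfolding L_def using kkt(1)[OF v(2) t] unfolding P by (intro pivot_sum A v M sA) auto
  moreover have "0 < sum x {j \<in> A - {v1}. {v1, j} \<notin> M}"
    using pairs_at_complement(1)[OF A(1) M(1) v(2), of x] sA cov by simp
  moreover from calculation have "0 \<le> (x v1 - x t) * sum x {j \<in> A - {v1}. {v1, j} \<notin> M}" by linarith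
  ultimately have zu: "x t \<le> x v1" by (simp only: zero_le_mult_iff) linarith
  show ?thesis
  proof (rule ccontr)
    assume c: "\<not> ?thesis"
    have "real (card (A - {i, v1, v2})) * x v3 \<le> sum x (A - {i, v1, v2})"
      using min by (intro sum_bounded_below) auto
    also have "\<dots> \<le> sum x A" using A nn by (intro sum_mono2) auto
    also have "\<dots> \<le> 1" using sA t by simp
    finally have "real (card (A - {i, v1, v2})) * x v3 \<le> 1" .
    moreover have "card (A - {i, v1, v2}) = card A - 3" using A v by (simp add: card_Diff_subset)
    then have "8 * x v3 \<le> real (card (A - {i, v1, v2})) * x v3"
      using A(2) nn v by (intro mult_right_mono) auto
    ultimately have u3: "x v3 \<le> 1/8" by simp
    have "real (card (A - {i, v1, v2, v3})) * x v4 \<le> sum x (A - {i, v1, v2, v3})"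
      using min by (intro sum_bounded_below) auto
    also have "\<dots> \<le> sum x A" using A nn by (intro sum_mono2) auto
    also have "\<dots> \<le> 1" using sA t by simp
    finally have "real (card (A - {i, v1, v2, v3})) * x v4 \<le> 1" .
    moreover have "card (A - {i, v1, v2, v3}) = card A - 4" using A v by (simp add: card_Diff_subset)
    then have "7 * x v4 \<le> real (card (A - {i, v1, v2, v3})) * x v4"
      using A(2) nn v by (intro mult_right_mono) auto
    ultimately have u4: "x v4 \<le> 1/7" by simp
    have "x t * wdeg M x v1 \<le> x v1 * 1" using zu cov t pos wdeg_nonneg'[OF M(1) nn] by (intro mult_mono) auto
    moreover have "x i * x v4 \<le> x v1 * (1/7)" using u u4 nn v by (intro mult_mono) auto
    moreover have "0 \<le> x t * wdeg M x v3" "0 \<le> wdeg T x v3"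
      using t wdeg_nonneg'[OF M(1) nn] wdeg_nonneg'[OF TA nn] by auto
    moreover have "0 < x v3" using pos u by simp
    ultimately have "x v3 * (1 - x v3) - x v1 * (1 - x v1) \<le> x v1 * (8/7)"
      using kkt(3)[OF v(4) v(2)] unfolding P by linarith
    moreover have "2 * x v1 * (5/6) \<le> (x v3 - x v1) * (1 - x v3 - x v1)"
      using c u3 pos by (intro mult_mono) auto
    then have "2 * x v1 * (5/6) \<le> x v3 * (1 - x v3) - x v1 * (1 - x v1)" by (simp add: algebra_simps)
    ultimately show False using pos by simp
  qed
qed

text \<open>Now \<open>P\<close> is the sum of the weights of \<open>{v1, v4}\<close> and \<open>{v2, v3}\<close>. Except for \<open>{v1, v2}\<close>, \<open>{v1, v3}\<close> and
\<open>{v2, v3}\<close>, every pair weighs at least as much as \<open>{v1, v4}\<close>, which bounds the weight of the missing pairs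
from below. Only when \<open>{v2, v3}\<close> is not missing is it necessary that \<open>v1\<close> is not too light.\<close>

lemma no_optimum_if_missing_share_vertex:
  assumes A: "finite A" "11 \<le> card A" "t \<notin> A" and M: "M \<subseteq> nsets A 2" "card A + 3 \<le> card M"
    and T: "T = {{i, v1, v4}, {i, v2, v3}}"
    and x: "x \<in> weightings (insert t A)" "lagrange_poly (config t A T M) x = lagrangian (config t A T M)"
    and t: "0 < x t" and v: "i \<in> A" "v1 \<in> A" "v2 \<in> A" "v3 \<in> A" "v4 \<in> A" "distinct [i, v1, v2, v3, v4]"
    and min: "\<And>j. j \<in> A \<Longrightarrow> x i \<le> x j" "\<And>j. j \<in> A - {i} \<Longrightarrow> x v1 \<le> x j"
      "\<And>j. j \<in> A - {i, v1} \<Longrightarrow> x v2 \<le> x j" "\<And>j. j \<in> A - {i, v1, v2} \<Longrightarrow> x v3 \<le> x j"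
      "\<And>j. j \<in> A - {i, v1, v2, v3} \<Longrightarrow> x v4 \<le> x j"
    and pos: "0 < x v1" and cov: "wdeg M x v1 < 1 - x t - x v1" and j: "p0 \<in> M" "i \<in> p0"
  shows False
proof -
  define d where "d = card {j \<in> A - {i}. {i, j} \<notin> M}"
  define L where "L = {p\<in>M. i \<notin> p}"
  have fM: "finite M" using A(1) M(1) finite_subset finite_imp_finite_nsets by blast
  have fL: "finite L" using fM by (simp add: L_def)
  have u: "x v1 \<le> x v2" "x v2 \<le> x v3" "x v3 \<le> x v4" "0 \<le> x i" "x i \<le> x v1"
    using min v x by (auto simp: weightings_def)
  have TA: "T \<subseteq> nsets A 3" using v unfolding T by (auto simp: nsets_def)
  have P: "wdeg T x i = x v1 * x v4 + x v2 * x v3"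
  proof -
    have ne: "{i, v1, v4} \<noteq> {i, v2, v3}" using v by auto
    have "{e\<in>T. i \<in> e} = {{i, v1, v4}, {i, v2, v3}}" unfolding T by auto
    moreover have "{i, v1, v4} - {i} = {v1, v4}" "{i, v2, v3} - {i} = {v2, v3}" using v by auto
    ultimately show ?thesis using ne v by (simp add: wdeg_def)
  qed
  have card: "4 + d \<le> card L" unfolding d_def L_def by (rule card_avoiding[OF A(1) M(1) v(1) M(2)])
  have "card {p\<in>M. i \<in> p} \<noteq> 0" using j fM by auto
  then have dN: "d \<le> card A - 2"
    using pairs_at_complement(2)[OF A(1) M(1) v(1)] unfolding d_def by linarith
  have d: "0 \<le> real d" "real d \<le> real (card A) - 2" "9 \<le> real (card A) - 2" using dN A(2) by auto
  have spread: "x v3 < 3 * x v1"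
    by (rule third_lightest_less_three_times[OF A M T x t v min pos cov])
  define \<rho> where "\<rho> = x v1 * x v4"
  define E where "E = {{v1, v2}, {v1, v3}}"
  define c where "c p = (if p = {v1, v2} then x v1 * x v2 else x v1 * x v3)" for p
  have \<rho>: "0 < \<rho>" using pos u by (simp add: \<rho>_def)
  have ne: "{v1, v2} \<noteq> {v1, v3}" using v by (auto simp: doubleton_eq_iff)
  have pair: "\<rho> \<le> (\<Prod>k\<in>p. x k)" if p: "p \<in> L" "p \<notin> E" "p \<noteq> {v2, v3}" for p
  proof -
    obtain a b where ab: "p = {a, b}" "a \<in> A - {i}" "b \<in> A - {i}" "a \<noteq> b"
      using pairE[OF avoiding_pair_in[OF M(1)]] p(1) unfolding L_def by metis
    have l: "x v1 * x v4 \<le> x a * x b" if "a \<in> A - {i}" "b \<in> A - {i, v1, v2, v3}" for a b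
      using that min(2)[of a] min(5)[of b] u pos by (intro mult_mono) auto
    consider "b \<notin> {v1, v2, v3}" | "a \<notin> {v1, v2, v3}" using ab p by (auto simp: E_def)
    then have "x v1 * x v4 \<le> x a * x b"
    proof cases
      case 1 then show ?thesis using l[of a b] ab by auto
    next
      case 2 then show ?thesis using l[of b a] ab by (auto simp: mult.commute)
    qed
    then show ?thesis using ab by (simp add: \<rho>_def)
  qed
  have low: "x v1 * x v2 + x v1 * x v3 + (real k - 2) * \<rho> \<le> wsum X x"
    if X: "X \<subseteq> L" "{v2, v3} \<notin> X" "k \<le> card X" for X k
  proof -
    have fX: "finite X" using X fL finite_subset by blast
    have "real (card X) * \<rho> - (\<Sum>p\<in>E. \<rho> - c p) \<le> (\<Sum>p\<in>X. \<Prod>k\<in>p. x k)"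
    proof (rule sum_ge_with_exceptions[OF fX])
      show "finite E" by (simp add: E_def)
      show "\<rho> \<le> prod x p" if "p \<in> X - E" for p using pair[of p] that X by auto
      show "c p \<le> prod x p" if "p \<in> X \<inter> E" for p
        using that v ne by (auto simp: E_def c_def)
      show "c p \<le> \<rho>" for p unfolding c_def \<rho>_def using u pos by (auto intro!: mult_left_mono)
    qed
    moreover have "(\<Sum>p\<in>E. \<rho> - c p) = 2 * \<rho> - x v1 * x v2 - x v1 * x v3"
      using ne unfolding E_def c_def by simp
    moreover have "real k * \<rho> \<le> real (card X) * \<rho>" using X(3) \<rho> by (intro mult_right_mono) auto
    ultimately show ?thesis by (simp add: wsum_def algebra_simps)
  qed
  have piv: "wsum L x \<le> wdeg T x i
      \<or> wsum L x < real d * (x i)\<^sup>2 + wdeg T x i * (1 + real d / (real (card A) - 2))"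
    unfolding L_def using A(2)
    by (intro pivot_config[OF A(1) _ A(3) TA M(1) x t v(1) min(1) d_def refl]) auto
  have d\<rho>: "0 \<le> real d * \<rho>" using \<rho> by simp
  show False
  proof (cases "{v2, v3} \<in> L")
    case True
    have "wsum L x = x v2 * x v3 + wsum (L - {{v2, v3}}) x"
      using sum.remove[OF fL True, of "prod x"] v by (simp add: wsum_def)
    moreover have "x v1 * x v2 + x v1 * x v3 + (real (3 + d) - 2) * \<rho> \<le> wsum (L - {{v2, v3}}) x"
      using card True fL by (intro low) auto
    ultimately have "x v2 * x v3 + x v1 * x v2 + x v1 * x v3 + (1 + real d) * \<rho> \<le> wsum L x" by simp
    moreover have "real d * (x i)\<^sup>2 + real d / (real (card A) - 2) * (x v1 * x v4 + x v2 * x v3)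
        \<le> x v1 * x v2 + x v1 * x v3 + real d * (x v1 * x v4)"
      using u pos spread d by (intro matching_slack_with_23) auto
    moreover have "0 < x v1 * x v2" "0 < x v1 * x v3" using pos u by auto
    ultimately show False using piv d\<rho> unfolding P \<rho>_def by (simp add: algebra_simps)
  next
    case False
    have "x v1 * x v2 + x v1 * x v3 + (real (4 + d) - 2) * \<rho> \<le> wsum L x"
      using card False by (intro low) auto
    moreover have "real d * (x i)\<^sup>2 + (1 + real d / (real (card A) - 2)) * (x v1 * x v4 + x v2 * x v3)
        \<le> x v1 * x v2 + x v1 * x v3 + (2 + real d) * (x v1 * x v4)"
      "x v1 * x v4 + x v2 * x v3 < x v1 * x v2 + x v1 * x v3 + 2 * (x v1 * x v4)"
      using u pos spread d matching_slack_without_23[of "x v1" "x v2" "x v3" "x v4" "x i" "real d" "real (card A) - 2"]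
      by auto
    ultimately show False using piv d\<rho> unfolding P \<rho>_def by (simp add: algebra_simps)
  qed
qed


lemma obtain_min:
  fixes y :: "'a \<Rightarrow> real"
  assumes "finite B" "0 < card B"
  obtains v where "v \<in> B" "\<And>w. w \<in> B \<Longrightarrow> y v \<le> y w"
  using assms ex_is_arg_min_if_finite[of B y] by (auto simp: is_arg_min_linorder card_gt_0_iff)

text \<open>A graph of maximal Lagrangian is chosen among all graphs with a pair of missing triples of the given
type and at least \<open>card A + 3\<close> missing pairs. If its Lagrangian exceeded that of the clique, then for an
optimal weighting the apex would have positive weight, and the missing triples and pairs could be
replaced by lighter ones of the same type, the weighting remaining optimal for the new graph.
So the missing triples may be placed on the lightest vertices, where the preceding lemmas apply. Their
two remaining hypotheses hold because otherwise the weight of the apex could be given to the second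
lightest vertex without loss, leaving a weighting of the clique.\<close>

lemma lagrangian_le_clique_if_missing_meet:
  assumes A: "finite A" "11 \<le> card A" "t \<notin> A"
    and f: "f1 \<in> nsets A 3" "f2 \<in> nsets A 3" "f1 \<noteq> f2" "f1 \<inter> f2 \<noteq> {}"
    and M: "M \<subseteq> nsets A 2" "card A + 3 \<le> card M"
  shows "lagrangian (config t A {f1, f2} M) \<le> lagrangian (Three_Graph A (nsets A 3 - {f1, f2}))"
proof (rule ccontr)
  define \<mu> where "\<mu> = lagrangian (Three_Graph A (nsets A 3 - {f1, f2}))"
  \<comment> \<open>the type of the pair of missing triples determines the Lagrangian of the clique\<close>
  define Fam where "Fam = {(T, M). \<exists>g1 g2. T = {g1, g2} \<and> g1 \<in> nsets A 3 \<and> g2 \<in> nsets A 3 \<and> g1 \<noteq> g2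
    \<and> card (g1 \<inter> g2) = card (f1 \<inter> f2) \<and> M \<subseteq> nsets A 2 \<and> card A + 3 \<le> card M}"
  define val where "val c = lagrangian (config t A (fst c) (snd c))" for c
  assume "\<not> lagrangian (config t A {f1, f2} M) \<le> lagrangian (Three_Graph A (nsets A 3 - {f1, f2}))"
  then have gt: "\<mu> < val ({f1, f2}, M)" by (simp add: \<mu>_def val_def)
  have in_Fam: "({f1, f2}, M) \<in> Fam" using f M unfolding Fam_def by blast
  have "Fam \<subseteq> Pow (nsets A 3) \<times> Pow (nsets A 2)" by (auto simp: Fam_def)
  then have "finite Fam" using A(1) by (meson finite_Pow_iff finite_SigmaI finite_imp_finite_nsets finite_subset)
  then have "\<exists>c\<in>Fam. \<forall>c'\<in>Fam. val c' \<le> val c"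
    using in_Fam Max_in[of "val ` Fam"] Max_ge[of "val ` Fam"]
    by (metis (no_types, lifting) empty_iff finite_imageI image_iff imageI)
  then obtain T0 M0 where TM: "(T0, M0) \<in> Fam" and max: "\<And>c. c \<in> Fam \<Longrightarrow> val c \<le> val (T0, M0)"
    by (metis surj_pair)
  have top: "\<mu> < val (T0, M0)" using gt max[OF in_Fam] by linarith
  obtain g1 g2 where g: "T0 = {g1, g2}" "g1 \<in> nsets A 3" "g2 \<in> nsets A 3" "g1 \<noteq> g2"
    "card (g1 \<inter> g2) = card (f1 \<inter> f2)" and M0: "M0 \<subseteq> nsets A 2" "card A + 3 \<le> card M0"
    using TM unfolding Fam_def by blast
  obtain x where x: "x \<in> weightings (insert t A)" "lagrange_poly (config t A T0 M0) x = val (T0, M0)"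
    using lagrangian_attained[OF config_graph[OF A(1)], of t T0 M0] by (auto simp: val_def)
  have nn: "0 \<le> x j" if "j \<in> insert t A" for j using x that by (auto simp: weightings_def)
  have sA: "sum x A = 1 - x t" using x A(1,3) by (simp add: weightings_def)
  have T0A: "T0 \<subseteq> nsets A 3" using g by auto
  have fin: "finite (nsets A 3)" using A(1) by (rule finite_imp_finite_nsets)
  have le_mu: "wsum (nsets A 3 - {h1, h2}) y \<le> \<mu>"
    if "h1 \<in> nsets A 3" "h2 \<in> nsets A 3" "h1 \<noteq> h2" "card (h1 \<inter> h2) = card (f1 \<inter> f2)" "y \<in> weightings A" for h1 h2 y
    unfolding \<mu>_def by (rule same_type_le_lagrangian[OF A(1) f(1-3) that])
  have t: "0 < x t"
  proof (rule ccontr)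
    assume "\<not> 0 < x t"
    then have t0: "x t = 0" using nn[of t] by simp
    then have "x \<in> weightings A" using nn sA by (simp add: weightings_def)
    then have "wsum (nsets A 3 - T0) x \<le> \<mu>" unfolding g(1) by (intro le_mu g) auto
    then show False
      using x(2) top t0 wsum_config[OF A(1,3) T0A M0(1), of x] wsum_Diff[OF fin T0A, of x]
      by (simp add: lagrange_poly_wsum wsum_eq_esym)
  qed
  have mins: "\<exists>v\<in>A - set us. \<forall>w\<in>A - set us. x v \<le> x w" if "length us < 11" for us
  proof -
    have "card (set us) < card A" using card_length[of us] that A(2) by linarith
    then have "0 < card (A - set us)" using diff_card_le_card_Diff[of "set us" A] by simp
    then show ?thesis using obtain_min[of "A - set us" x] A(1) by (metis finite_Diff)
  qed
  obtain i where i: "i \<in> A" "\<And>j. j \<in> A \<Longrightarrow> x i \<le> x j" using mins[of "[]"] by auto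
  obtain v1 where v1: "v1 \<in> A - {i}" "\<And>j. j \<in> A - {i} \<Longrightarrow> x v1 \<le> x j"
    using mins[of "[i]"] by auto
  obtain v2 where v2: "v2 \<in> A - {i, v1}" "\<And>j. j \<in> A - {i, v1} \<Longrightarrow> x v2 \<le> x j"
    using mins[of "[i, v1]"] by auto
  obtain v3 where v3: "v3 \<in> A - {i, v1, v2}" "\<And>j. j \<in> A - {i, v1, v2} \<Longrightarrow> x v3 \<le> x j"
    using mins[of "[i, v1, v2]"] by auto
  obtain v4 where v4: "v4 \<in> A - {i, v1, v2, v3}" "\<And>j. j \<in> A - {i, v1, v2, v3} \<Longrightarrow> x v4 \<le> x j"
    using mins[of "[i, v1, v2, v3]"] by auto
  have v: "v1 \<in> A" "v2 \<in> A" "v3 \<in> A" "v4 \<in> A" "distinct [i, v1, v2, v3, v4]"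
    using v1 v2 v3 v4 by auto
  have u: "0 \<le> x i" "x i \<le> x v1" "0 \<le> x v1" "x v1 \<le> x v2" "x v2 \<le> x v3" "x v3 \<le> x v4"
    using i v1 v2 v3 v4 nn by auto
  (* a missing pair through i leaves i at most card A - 2 neighbours; if there is none, some missing pair
     is exchanged for {i, v1}, the lightest of all pairs *)
  have "\<exists>M'. M' \<subseteq> nsets A 2 \<and> card A + 3 \<le> card M' \<and> wsum M' x \<le> wsum M0 x \<and> (\<exists>p\<in>M'. i \<in> p)"
  proof (cases "\<exists>p\<in>M0. i \<in> p")
    case True then show ?thesis using M0 by blast
  next
    case False
    have fM: "finite M0" using A(1) M0(1) finite_subset finite_imp_finite_nsets by blast
    obtain q where q: "q \<in> M0" using M0(2) by fastforce
    obtain a b where ab: "q = {a, b}" "a \<in> A" "b \<in> A" "a \<noteq> b"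
      using pairE M0(1) q by blast
    have bi: "b \<noteq> i" using False q ab by auto
    define M' where "M' = insert {i, v1} (M0 - {q})"
    have new: "{i, v1} \<notin> M0 - {q}" using False by auto
    have "M' \<subseteq> nsets A 2" using M0(1) i v by (auto simp: M'_def nsets_def)
    moreover have "card M' = card M0"
      using new fM q card_Suc_Diff1[OF fM q] by (simp add: M'_def)
    moreover have "wsum M' x \<le> wsum M0 x"
    proof -
      have "x i * x v1 \<le> x a * x b" using i v1 ab bi u nn by (intro mult_mono) auto
      moreover have "wsum M' x = x i * x v1 + wsum (M0 - {q}) x"
        using new fM v by (simp add: M'_def wsum_def)
      moreover have "wsum M0 x = x a * x b + wsum (M0 - {q}) x"
        using sum.remove[OF fM q, of "prod x"] ab by (simp add: wsum_def)
      ultimately show ?thesis by linarith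
    qed
    ultimately show ?thesis using M0(2) by (intro exI[of _ M']) (auto simp: M'_def)
  qed
  then obtain M' p0 where M': "M' \<subseteq> nsets A 2" "card A + 3 \<le> card M'" "wsum M' x \<le> wsum M0 x"
    and p0: "p0 \<in> M'" "i \<in> p0" by blast
  \<comment> \<open>replacing the missing triples by lighter ones of the same type keeps \<open>x\<close> optimal\<close>
  have final: False
    if T: "T = {h1, h2}" and h: "h1 \<in> nsets A 3" "h2 \<in> nsets A 3" "h1 \<noteq> h2" "card (h1 \<inter> h2) = card (f1 \<inter> f2)"
      and le: "wsum T x \<le> wsum T0 x" and degv: "x v1 = 0 \<Longrightarrow> wdeg T x v1 = 0"
      and core: "\<lbrakk>x \<in> weightings (insert t A); lagrange_poly (config t A T M') x = lagrangian (config t A T M');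
        0 < x v1; wdeg M' x v1 < 1 - x t - x v1\<rbrakk> \<Longrightarrow> False"
    for T h1 h2
  proof -
    have TA: "T \<subseteq> nsets A 3" using T h by auto
    have "(T, M') \<in> Fam" using T h M' unfolding Fam_def by blast
    then have up: "val (T, M') \<le> val (T0, M0)" by (rule max)
    have "x t * wsum M' x \<le> x t * wsum M0 x" using M'(3) t by simp
    then have "val (T0, M0) \<le> lagrange_poly (config t A T M') x"
      using x(2) le wsum_config[OF A(1,3) T0A M0(1), of x] wsum_config[OF A(1,3) TA M'(1), of x]
      by (simp add: lagrange_poly_wsum)
    moreover have "lagrange_poly (config t A T M') x \<le> val (T, M')"
      using lagrange_poly_le_lagrangian[OF config_graph[OF A(1)], of x t T M'] x(1) by (simp add: val_def)
    ultimately have opt: "lagrange_poly (config t A T M') x = lagrangian (config t A T M')"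
      and big: "\<mu> < wsum (edges (config t A T M')) x"
      using up top by (auto simp: val_def lagrange_poly_wsum)
    note ab = absorb_apex[OF A(1,3) TA M'(1) x(1) v(1)]
    have "wsum (nsets A 3 - T) (x(v1 := x v1 + x t)) \<le> \<mu>"
      unfolding T by (intro le_mu h) (rule ab(1))
    then have neg: "x t * (wsum M' x - wdeg T x v1 - x v1 * (1 - x t - x v1)) < 0"
      using ab(2) big by linarith
    then have neg': "wsum M' x - wdeg T x v1 - x v1 * (1 - x t - x v1) < 0"
      using t by (simp add: mult_less_0_iff)
    have pos: "0 < x v1"
    proof (rule ccontr)
      assume "\<not> 0 < x v1"
      then have "x v1 = 0" using u by simp
      moreover have "0 \<le> wsum M' x" using M'(1) nn by (intro wsum_nonneg[of _ A 2]) auto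
      ultimately show False using neg' degv by simp
    qed
    have "wdeg M' x v1 < 1 - x t - x v1"
    proof (rule ccontr)
      assume "\<not> ?thesis"
      then have "x t * (1 - x t - x v1) \<le> x t * wdeg M' x v1" using t by simp
      moreover have "x v1 * (1 - x v1) + x t * wdeg M' x v1 + wdeg T x v1 \<le> x t * (1 - x t) + wsum M' x"
        by (rule config_kkt(2)[OF A(1,3) TA M'(1) x(1) opt v(1) pos])
      ultimately have "0 \<le> wsum M' x - wdeg T x v1 - x v1 * (1 - x t - x v1)"
        by (simp add: algebra_simps)
      then show False using neg' by linarith
    qed
    then show False using core[OF x(1) opt pos] by blast
  qed
  have c3: "card f1 = 3" "card f2 = 3" "finite f1" "finite f2" using f by (auto simp: nsets_def)
  have "card (f1 \<inter> f2) \<noteq> 0" using f c3 by simp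
  moreover have "card (f1 \<inter> f2) < 3"
  proof (rule ccontr)
    assume "\<not> ?thesis"
    then have "f1 \<inter> f2 = f1" "f1 \<inter> f2 = f2"
      using c3 card_subset_eq[of f1 "f1 \<inter> f2"] card_subset_eq[of f2 "f1 \<inter> f2"]
        card_mono[of f1 "f1 \<inter> f2"] card_mono[of f2 "f1 \<inter> f2"] by auto
    then show False using f(3) by simp
  qed
  ultimately consider "card (f1 \<inter> f2) = 2" | "card (f1 \<inter> f2) = 1" by linarith
  then show False
  proof cases
    case 1
    define T where "T = {{i, v1, v2}, {i, v1, v3}}"
    have ne: "{i, v1, v2} \<noteq> {i, v1, v3}" using v by auto
    have pair: "x v1 * x v3 \<le> x a * x b" if "a \<in> A - {i}" "b \<in> A - {i, v1, v2}" for a b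
      using that v1(2)[of a] v3(2)[of b] u by (intro mult_mono) auto
    have pair': "x v1 * x v2 \<le> x a * x b" if "a \<in> A - {i}" "b \<in> A - {i, v1}" for a b
      using that v1(2)[of a] v2(2)[of b] u by (intro mult_mono) auto
    have triple: "x i * (x v1 * x v2) \<le> prod x g \<and> (g \<noteq> {i, v1, v2} \<longrightarrow> x i * (x v1 * x v3) \<le> prod x g)"
      if gA: "g \<in> nsets A 3" for g
    proof -
      (* the vertex c is chosen so that the other two avoid i and are v1, v2 only if g = {i, v1, v2} *)
      define c where "c = (if i \<in> g then i else if v1 \<in> g then v1 else (SOME c. c \<in> g))"
      have "g \<noteq> {}" using gA by (auto simp: nsets_def)
      then have cg: "c \<in> g" by (auto simp: c_def some_in_eq)
      have g': "finite g" "g \<subseteq> A" "card (g - {c}) = 2" using gA cg by (auto simp: nsets_def)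
      then obtain a b where ab: "g - {c} = {a, b}" "a \<noteq> b" by (auto simp: card_2_iff)
      have ic: "a \<in> A - {i}" "b \<in> A - {i}" "c \<in> A"
        using ab g' cg by (auto simp: c_def split: if_splits)
      have g3: "g = {c, a, b}" "c \<noteq> a" "c \<noteq> b" using ab cg by auto
      then have pg: "prod x g = x c * (x a * x b)" using ab(2) by simp
      have "x v1 * x v2 \<le> x a * x b"
      proof (cases "b = v1")
        case True
        then have "a \<in> A - {i, v1}" using ic(1) ab(2) by simp
        then show ?thesis using pair'[OF ic(2)] by (simp only: mult.commute)
      next
        case False
        then have "b \<in> A - {i, v1}" using ic(2) by simp
        then show ?thesis by (rule pair'[OF ic(1)])
      qed
      moreover have "x v1 * x v3 \<le> x a * x b" if "g \<noteq> {i, v1, v2}"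
      proof -
        have "{a, b} \<noteq> {v1, v2}"
        proof
          assume e: "{a, b} = {v1, v2}"
          then have "v1 \<in> g" "c \<noteq> v1" using g3 by blast+
          then have "c = i" unfolding c_def by metis
          then show False using that g3(1) e by simp
        qed
        then consider "b \<notin> {v1, v2}" | "a \<notin> {v1, v2}" using ab(2) by blast
        then show ?thesis
        proof cases
          case 1
          then have "b \<in> A - {i, v1, v2}" using ic(2) by simp
          then show ?thesis by (rule pair[OF ic(1)])
        next
          case 2
          then have "a \<in> A - {i, v1, v2}" using ic(1) by simp
          then show ?thesis using pair[OF ic(2)] by (simp only: mult.commute)
        qed
      qed
      moreover have "x i * q \<le> x c * r" if "0 \<le> q" "q \<le> r" for q r :: real
        using i(2)[OF ic(3)] that u by (intro mult_mono) auto
      moreover have "0 \<le> x v1 * x v2" "0 \<le> x v1 * x v3" using u by simp_all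
      ultimately show ?thesis unfolding pg by blast
    qed
    show False
    proof (rule final[OF T_def _ _ ne])
      show "{i, v1, v2} \<in> nsets A 3" "{i, v1, v3} \<in> nsets A 3" using i v by (auto simp: nsets_def)
      have int: "{i, v1, v2} \<inter> {i, v1, v3} = {i, v1}" using v by auto
      show "card ({i, v1, v2} \<inter> {i, v1, v3}) = card (f1 \<inter> f2)" unfolding int 1 using v by simp
      have "wsum T x = x i * (x v1 * x v2) + x i * (x v1 * x v3)"
        unfolding T_def wsum_def using ne v by simp
      also have "\<dots> \<le> prod x g1 + prod x g2"
        using triple[OF g(2)] triple[OF g(3)] g(4) by (cases "g1 = {i, v1, v2}") auto
      also have "\<dots> = wsum T0 x" unfolding g(1) wsum_def using g(4) by simp
      finally show "wsum T x \<le> wsum T0 x" .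
      have "x i = 0" if "x v1 = 0" using that u by simp
      moreover have "{e\<in>T. v1 \<in> e} = {{i, v1, v2}, {i, v1, v3}}" unfolding T_def by auto
      moreover have "{i, v1, v2} - {v1} = {i, v2}" "{i, v1, v3} - {v1} = {i, v3}" using v by auto
      ultimately show "wdeg T x v1 = 0" if "x v1 = 0" using that ne v by (simp add: wdeg_def)
    next
      assume a: "x \<in> weightings (insert t A)" "lagrange_poly (config t A T M') x = lagrangian (config t A T M')"
        "0 < x v1"
      show False
        by (rule no_optimum_if_missing_share_pair[OF A M'(1,2) T_def a(1,2) t i(1) v(1-3) _ i(2) v1(2) v2(2) v3(2) a(3) p0])
          (use v in auto)
    qed
  next
    case 2
    define T where "T = {{i, v1, v4}, {i, v2, v3}}"
    have ne: "{i, v1, v4} \<noteq> {i, v2, v3}" using v by auto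
    define P where "P = x v1 * x v4 + x v2 * x v3"
    have m: "P \<le> x a * x b + x c * x e"
      if "a \<in> A - {i}" "b \<in> A - {i}" "c \<in> A - {i}" "e \<in> A - {i}" "distinct [a, b, c, e]" for a b c e
      unfolding P_def
    proof (rule matching_sorted[of "A - {i}" "x v1" x "x v2" "x v3" "x v4"])
      show "x v1 \<le> x a" if "a \<in> A - {i}" for a using v1(2) that .
      show "x v2 \<le> max (x a) (x b)" if "a \<in> A - {i}" "b \<in> A - {i}" "a \<noteq> b" for a b
        using v2(2)[of a] v2(2)[of b] that by (cases "a = v1") auto
      show "x v3 \<le> max (x a) (max (x b) (x c))"
        if "a \<in> A - {i}" "b \<in> A - {i}" "c \<in> A - {i}" "distinct [a, b, c]" for a b c
      proof -
        have "\<exists>w\<in>{a, b, c}. w \<notin> {v1, v2}" using that by auto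
        then show ?thesis using v3(2)[of a] v3(2)[of b] v3(2)[of c] that by (auto simp: le_max_iff_disj)
      qed
      show "x v4 \<le> max (x a) (max (x b) (max (x c) (x e)))"
        if "a \<in> A - {i}" "b \<in> A - {i}" "c \<in> A - {i}" "e \<in> A - {i}" "distinct [a, b, c, e]" for a b c e
      proof -
        have "\<exists>w\<in>{a, b, c, e}. w \<notin> {v1, v2, v3}" using that by auto
        then show ?thesis using v4(2)[of a] v4(2)[of b] v4(2)[of c] v4(2)[of e] that
          by (auto simp: le_max_iff_disj)
      qed
    qed (use u that in auto)
    \<comment> \<open>a common vertex of the triples can be exchanged for the lightest vertex \<open>i\<close>\<close>
    have star: "x i * P \<le> x c * (x a * x b) + x c * (x e * x w)"
      if d: "distinct [c, a, b, e, w]" and s: "{c, a, b, e, w} \<subseteq> A" for c a b e w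
    proof -
      have c0: "x i \<le> x k" "0 \<le> x k" if "k \<in> A" for k using i that nn by auto
      have P0: "0 \<le> x i" using u by simp
      have swap: "x i * P \<le> x c * (x i * x b) + x c * (x e * x w)"
        if d: "distinct [c, i, b, e, w]" and s: "{c, b, e, w} \<subseteq> A" for c b e w
      proof -
        have "x i * P \<le> x i * (x c * x b + x e * x w)"
          using d s P0 by (intro mult_left_mono m) auto
        also have "\<dots> = x c * (x i * x b) + x i * (x e * x w)" by (simp add: algebra_simps)
        also have "\<dots> \<le> x c * (x i * x b) + x c * (x e * x w)"
          using s c0 by (intro add_left_mono mult_right_mono mult_nonneg_nonneg) auto
        finally show ?thesis .
      qed
      consider "a = i" | "b = i" | "e = i" | "w = i" | "i \<notin> {a, b, e, w}" by auto
      then show ?thesis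
      proof cases
        case 1 then show ?thesis using swap[of c b e w] d s by simp
      next
        case 2 then show ?thesis using swap[of c a e w] d s by (auto simp: mult.commute)
      next
        case 3 then show ?thesis using swap[of c w a b] d s by (auto simp: add.commute)
      next
        case 4 then show ?thesis using swap[of c e a b] d s by (auto simp: mult.commute add.commute)
      next
        case 5
        have "x i * P \<le> x c * (x a * x b + x e * x w)"
        proof (rule mult_mono)
          show "P \<le> x a * x b + x e * x w" using 5 d s by (intro m) auto
          show "0 \<le> P" unfolding P_def using u by (intro add_nonneg_nonneg mult_nonneg_nonneg) auto
        qed (use s c0 in auto)
        then show ?thesis by (simp add: algebra_simps)
      qed
    qed
    obtain c where c: "g1 \<inter> g2 = {c}" using g(5) 2 by (auto simp: card_1_singleton_iff)
    have cg: "c \<in> g1" "c \<in> g2" using c by auto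
    have gf: "finite g1" "finite g2" "g1 \<subseteq> A" "g2 \<subseteq> A" "card (g1 - {c}) = 2" "card (g2 - {c}) = 2"
      using g(2,3) cg by (auto simp: nsets_def)
    obtain a b where ab: "g1 - {c} = {a, b}" "a \<noteq> b" using gf by (auto simp: card_2_iff)
    obtain e w where ew: "g2 - {c} = {e, w}" "e \<noteq> w" using gf by (auto simp: card_2_iff)
    have dist: "distinct [c, a, b, e, w]" "{c, a, b, e, w} \<subseteq> A" using c ab ew gf by auto
    have "g1 = {c, a, b}" "g2 = {c, e, w}" using ab ew cg by auto
    then have pg: "prod x g1 = x c * (x a * x b)" "prod x g2 = x c * (x e * x w)" using dist by auto
    show False
    proof (rule final[OF T_def _ _ ne])
      show "{i, v1, v4} \<in> nsets A 3" "{i, v2, v3} \<in> nsets A 3" using i v by (auto simp: nsets_def)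
      have int: "{i, v1, v4} \<inter> {i, v2, v3} = {i}" using v by auto
      show "card ({i, v1, v4} \<inter> {i, v2, v3}) = card (f1 \<inter> f2)" unfolding int 2 by simp
      have "wsum T x = x i * P"
        unfolding T_def wsum_def P_def using ne v by (simp add: algebra_simps)
      also have "\<dots> \<le> prod x g1 + prod x g2" unfolding pg by (rule star[OF dist])
      also have "\<dots> = wsum T0 x" unfolding g(1) wsum_def using g(4) by simp
      finally show "wsum T x \<le> wsum T0 x" .
      have "x i = 0" if "x v1 = 0" using that u by simp
      moreover have "{e\<in>T. v1 \<in> e} = {{i, v1, v4}}" unfolding T_def using v by auto
      moreover have "{i, v1, v4} - {v1} = {i, v4}" using v by auto
      ultimately show "wdeg T x v1 = 0" if "x v1 = 0" using that v by (simp add: wdeg_def)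
    next
      assume a: "x \<in> weightings (insert t A)" "lagrange_poly (config t A T M') x = lagrangian (config t A T M')"
        "0 < x v1" "wdeg M' x v1 < 1 - x t - x v1"
      show False
        by (rule no_optimum_if_missing_share_vertex[OF A M'(1,2) T_def a(1,2) t i(1) v(1-4) v(5) i(2) v1(2) v2(2) v3(2) v4(2) a(3,4) p0])
    qed
  qed
qed

section \<open>Missing triples that are disjoint\<close>

text \<open>The numbers are the weights \<open>\<alpha>\<close> and \<open>u\<close> of the lightest and second lightest vertex of the clique, the
weight \<open>z\<close> of the apex, the weight \<open>w\<close> of the missing neighbours of the second lightest vertex, and the
largest weight \<open>Y\<close>. If \<open>u \<le> Y / 2\<close>, then \<open>z * w\<close> must be large by \<open>c1\<close>; but missing pairs at a light vertex
are limited by \<open>c2\<close>, and the apex is limited by \<open>c3\<close>.\<close>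

lemma second_lightest_real:
  fixes u \<alpha> z w Y :: real
  assumes Y: "0 < Y" "Y \<le> 51/500" and a: "0 \<le> \<alpha>" "\<alpha> \<le> u" and z: "0 \<le> z" "z \<le> 51/500"
    and u: "17/100 * Y \<le> u" and w: "0 \<le> w" "w \<le> 1 - z - u"
    and c1: "(Y - u) * (1 - Y - u) \<le> z * w + Y\<^sup>2"
    and c2: "z < \<alpha> \<Longrightarrow> u * (w - \<alpha>) \<le> \<alpha> - z + Y\<^sup>2" "\<alpha> \<le> z \<Longrightarrow> u * (w - \<alpha>) \<le> Y\<^sup>2"
    and c3: "(z - u) * (1 - z - u - w) \<le> Y\<^sup>2"
  shows "Y / 2 < u"
proof (rule ccontr)
  assume "\<not> ?thesis"
  then have uY: "u \<le> Y / 2" by simp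
  have Y2: "Y\<^sup>2 \<le> 51/500 * Y" unfolding power2_eq_square using Y by (intro mult_right_mono) auto
  have "(Y - u) * (847/1000) \<le> (Y - u) * (1 - Y - u)" using Y uY by (intro mult_left_mono) auto
  moreover have "(Y - u) * (847/1000) = 847/1000 * Y - 847/1000 * u" by (simp add: field_simps)
  ultimately have zw: "745/1000 * Y - 847/1000 * u \<le> z * w" using c1 Y2 by linarith
  have upos: "0 < u" using u Y by simp
  show False
  proof (cases "z < \<alpha>")
    case True
    have "z * w \<le> u * 1" using True a z w upos by (intro mult_mono) auto
    then have u4: "403/1000 * Y \<le> u" using zw Y by simp
    have zw': "3215/10000 * Y \<le> z * w" using zw uY by linarith
    have "u * \<alpha> \<le> u * (51/1000)" using a uY Y upos by (intro mult_left_mono) auto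
    then have "u * w \<le> 1051/1000 * u + 102/1000 * Y - z"
      using c2(1)[OF True] a Y2 by (simp add: field_simps)
    then have "z * (u * w) \<le> z * (1051/1000 * u + 102/1000 * Y - z)" using z by (intro mult_left_mono) auto
    also have "\<dots> \<le> (1051/1000 * u + 102/1000 * Y)\<^sup>2 / 4"
      using zero_le_power2[of "z - (1051/1000 * u + 102/1000 * Y) / 2"]
      by (simp add: field_simps power2_eq_square)
    also have "\<dots> \<le> (6275/10000 * Y)\<^sup>2 / 4"
      using uY upos Y by (intro divide_right_mono power_mono) auto
    also have "\<dots> = 63001/640000 * Y\<^sup>2" by (simp add: field_simps power2_eq_square)
    also have "\<dots> \<le> 99/1000 * Y\<^sup>2" by (intro mult_right_mono) auto
    finally have "z * (u * w) \<le> 99/1000 * Y\<^sup>2" .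
    moreover have "403/1000 * Y * (3215/10000 * Y) \<le> u * (z * w)"
      by (rule mult_mono[OF u4 zw']) (use Y upos in auto)
    moreover have "403/1000 * Y * (3215/10000 * Y) = 259129/2000000 * Y\<^sup>2" "u * (z * w) = z * (u * w)"
      by (simp_all add: field_simps power2_eq_square)
    moreover have "0 < Y\<^sup>2" using Y by simp
    ultimately show False by linarith
  next
    case False
    then have az: "\<alpha> \<le> z" by simp
    have ub: "u * (w - \<alpha>) \<le> 51/500 * Y" using c2(2)[OF az] Y2 by simp
    (* u lies between r * Y and q * Y; then w is at most W and z at most (q + p) * Y *)
    have bound: "z * w \<le> W * (q + p) * Y"
      if r: "r * Y \<le> u" "u \<le> q * Y" and k: "51/500 \<le> r * k" "k + q * (51/500) = W" "0 < r" "0 \<le> q" "0 \<le> k"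
        and p: "51/500 \<le> p * (1 - 51/500 - q * (51/500) - W)" "0 \<le> p" "W < 1 - 51/500 - q * (51/500)" for r q k p W
    proof -
      have "q * Y \<le> q * (51/500)" using Y k by (intro mult_left_mono) auto
      then have uq: "u \<le> q * (51/500)" using r by simp
      have "w - \<alpha> \<le> k"
      proof (rule ccontr)
        assume "\<not> w - \<alpha> \<le> k"
        then have "u * k < u * (w - \<alpha>)" using upos by simp
        moreover have "r * Y * k \<le> u * k" using r k by (intro mult_right_mono) auto
        moreover have "51/500 * Y \<le> r * k * Y" using k Y by (intro mult_right_mono) auto
        ultimately show False using ub by (simp add: field_simps)
      qed
      then have wW: "w \<le> W" using a uq k by simp
      define D0 where "D0 = 1 - 51/500 - q * (51/500) - W"
      have D0: "0 < D0" "D0 \<le> 1 - z - u - w" using p wW z uq by (auto simp: D0_def)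
      have "z - u \<le> p * Y"
      proof (rule ccontr)
        assume c: "\<not> z - u \<le> p * Y"
        have "51/500 * Y \<le> p * D0 * Y" using p Y unfolding D0_def by (intro mult_right_mono) auto
        also have "\<dots> = p * Y * D0" by simp
        also have "\<dots> < (z - u) * D0" using c D0 by simp
        also have "\<dots> \<le> (z - u) * (1 - z - u - w)"
        proof (rule mult_left_mono[OF D0(2)])
          have "0 \<le> p * Y" using p Y by simp
          then show "0 \<le> z - u" using c by linarith
        qed
        finally show False using c3 Y2 by linarith
      qed
      then have zq: "z \<le> (q + p) * Y" using r by (simp add: field_simps)
      have "z * w \<le> (q + p) * Y * W" using zq wW z w by (intro mult_mono) auto
      then show ?thesis by (simp add: field_simps)
    qed
    show False
    proof (cases "u \<le> 3/10 * Y")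
      case True
      have "z * w \<le> (3153/5000) * (3/10 + 108/250) * Y"
        using u True by (intro bound[of "17/100" "3/10" "3/5"]) auto
      then show False using zw True Y by simp
    next
      case False
      have "z * w \<le> (391/1000) * (1/2 + 1/4) * Y"
        using False uY by (intro bound[of "3/10" "1/2" "17/50"]) auto
      then show False using zw uY Y by simp
    qed
  qed
qed

text \<open>The final comparison for disjoint missing triples: \<open>L\<close> is the weight of the missing pairs that avoid the
lightest vertex, and \<open>D\<close> the weight of its neighbours in the link of the apex.\<close>

lemma disjoint_inequalities_inconsistent:
  fixes u \<alpha> z Y d D L :: real
  assumes Y: "0 < Y" "Y \<le> 51/500" and a: "0 \<le> \<alpha>" "\<alpha> \<le> u" and u: "Y / 2 < u" and z: "0 \<le> z"
    and d: "0 \<le> d" "d * Y \<le> 28/25" and D: "0 \<le> D" "D \<le> d * Y"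
    and L: "L \<le> (\<alpha> - z) * D + Y\<^sup>2" "(4 + d) * u\<^sup>2 \<le> L"
    and gap: "(Y - \<alpha> - z) * (347/500) \<le> Y\<^sup>2"
  shows False
proof -
  have u2: "Y\<^sup>2 < 4 * u\<^sup>2"
  proof -
    have "(Y / 2)\<^sup>2 < u\<^sup>2" using u Y by (intro power_strict_mono) auto
    then show ?thesis by (simp add: power_divide)
  qed
  have du: "0 \<le> d * u\<^sup>2" using d by simp
  show False
  proof (cases "\<alpha> \<le> z \<or> d = 0")
    case True
    then have "(\<alpha> - z) * D \<le> 0" using D by (auto intro: mult_nonpos_nonneg)
    then show False using L u2 du by (simp add: field_simps)
  next
    case False
    then have za: "z < \<alpha>" and d0: "0 < d" using d by auto
    have "(\<alpha> - z) * D \<le> (\<alpha> - z) * (d * Y)" using za D by (intro mult_left_mono) auto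
    also have "\<dots> \<le> (2 * \<alpha> - Y + 1441/1000 * Y\<^sup>2) * (d * Y)"
    proof (intro mult_right_mono)
      have "0 \<le> Y\<^sup>2" by simp
      moreover have "Y - \<alpha> - z \<le> 500/347 * Y\<^sup>2" using gap by (simp add: field_simps)
      ultimately show "\<alpha> - z \<le> 2 * \<alpha> - Y + 1441/1000 * Y\<^sup>2" by linarith
    qed (use d Y in auto)
    finally have *: "(4 + d) * u\<^sup>2 \<le> d * Y * (2 * \<alpha> - Y) + 1441/1000 * (d * Y) * Y\<^sup>2 + Y\<^sup>2"
      using L by (simp add: field_simps)
    have YY: "0 < Y\<^sup>2" using Y by simp
    have dY1: "1441/1000 * (d * Y) \<le> 147/1000 * d"
    proof -
      have "d * Y \<le> d * (51/500)" using d Y by (intro mult_left_mono) auto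
      then show ?thesis using d(1) by linarith
    qed
    show False
    proof (cases "\<alpha> \<le> Y / 2")
      case True
      have "d * Y * (2 * \<alpha> - Y) \<le> 0" using True d Y by (intro mult_nonneg_nonpos) auto
      moreover have "1441/1000 * (d * Y) * Y\<^sup>2 \<le> 147/1000 * d * Y\<^sup>2" using dY1 YY by (intro mult_right_mono) auto
      moreover have "d * (Y\<^sup>2 / 4) \<le> d * u\<^sup>2" using u2 d by (intro mult_left_mono) auto
      moreover have "0 < d * Y\<^sup>2" using d0 YY by simp
      ultimately show False using * u2 by (simp add: field_simps)
    next
      case False
      define K where "K = 1441/1000 * (d * Y)"
      have "\<alpha>\<^sup>2 \<le> u\<^sup>2" using a by (intro power_mono)
      then have "(4 + d) * \<alpha>\<^sup>2 \<le> (4 + d) * u\<^sup>2" using d by (intro mult_left_mono) auto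
      then have **: "d * (Y - \<alpha>)\<^sup>2 + 4 * \<alpha>\<^sup>2 - Y\<^sup>2 - K * Y\<^sup>2 \<le> 0"
        using * unfolding K_def by (simp add: field_simps power2_eq_square)
      have a4: "Y\<^sup>2 \<le> 4 * \<alpha>\<^sup>2"
      proof -
        have "(Y / 2)\<^sup>2 \<le> \<alpha>\<^sup>2" using False Y by (intro power_mono) auto
        then show ?thesis by (simp add: power_divide)
      qed
      have key: "0 < 15 * \<alpha>\<^sup>2 - 22 * Y * \<alpha> + 838/100 * Y\<^sup>2"
      proof -
        have "15 * \<alpha>\<^sup>2 - 22 * Y * \<alpha> + 838/100 * Y\<^sup>2 = 15 * (\<alpha> - 11/15 * Y)\<^sup>2 + (838/100 - 121/15) * Y\<^sup>2"
          by (simp add: field_simps power2_eq_square)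
        moreover have "0 \<le> 15 * (\<alpha> - 11/15 * Y)\<^sup>2" "0 < (838/100 - 121/15) * Y\<^sup>2"
          using YY by simp_all
        ultimately show ?thesis by linarith
      qed
      (* if alpha is close to Y, the square of Y - alpha does not pay for K, but four pairs weigh nearly
         4 * Y^2; as K is bounded both by a multiple of d and by a constant, d = 11 is the worst case *)
      show False
      proof (cases "d \<le> 11")
        case True
        have "K * Y\<^sup>2 \<le> 147/1000 * d * Y\<^sup>2" unfolding K_def using dY1 YY by (intro mult_right_mono) auto
        moreover have "0 \<le> (1 - d / 11) * (4 * \<alpha>\<^sup>2 - Y\<^sup>2)" using True a4 by (intro mult_nonneg_nonneg) auto
        moreover have "0 < d / 11 * (15 * \<alpha>\<^sup>2 - 22 * Y * \<alpha> + 838/100 * Y\<^sup>2)" using d0 key by simp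
        moreover have "0 \<le> d * Y\<^sup>2" using d0 by simp
        ultimately show False using ** by (simp add: field_simps power2_eq_square)
      next
        case False
        have "K \<le> 1614/1000" unfolding K_def using d(2) by linarith
        then have "K * Y\<^sup>2 \<le> 1614/1000 * Y\<^sup>2" using YY by (intro mult_right_mono) auto
        moreover have "11 * (Y - \<alpha>)\<^sup>2 \<le> d * (Y - \<alpha>)\<^sup>2" using False by (intro mult_right_mono) auto
        ultimately show False using ** key YY by (simp add: field_simps power2_eq_square)
      qed
    qed
  qed
qed

text \<open>If two vertices had total weight at most \<open>381/1000 * h\<close>, the other \<open>n - 1\<close> vertices would share almost all the
weight. The heaviest of them, of weight at least \<open>q\<close>, would then have too small a degree.\<close>

lemma two_light_vertices_inconsistent:
  fixes h q n l p :: real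
  assumes h: "0 < h" "h \<le> 1/11" and n: "n * h = 1" and p: "p \<le> 381/1000 * h"
    and l: "1 - 3 * h + 2 * h\<^sup>2 - 12 * h ^ 3 \<le> l"
    and q: "(n - 1) * q = 1 - p" and main: "2 * q * (1 - q) + (n - 1) * q\<^sup>2 \<le> 1 - l"
  shows False
proof -
  define k where "k = h * (1 + 619/1000 * h)"
  have n11: "11 \<le> n"
  proof (rule ccontr)
    assume "\<not> 11 \<le> n"
    then have "n * h < 11 * h" using h by (intro mult_strict_right_mono) auto
    then show False using n h by simp
  qed
  have k: "k \<le> q"
  proof -
    have "(n - 1) * k = (n * h) * (1 + 619/1000 * h) - h * (1 + 619/1000 * h)"
      by (simp add: k_def field_simps)
    also have "\<dots> = 1 - 381/1000 * h - 619/1000 * h\<^sup>2"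
      unfolding n by (simp add: field_simps power2_eq_square)
    also have "\<dots> \<le> 1 - p" using p zero_le_power2[of h] by linarith
    finally have "(n - 1) * k \<le> (n - 1) * q" using q by simp
    then show ?thesis using n11 by simp
  qed
  have k0: "0 \<le> k" using h by (simp add: k_def)
  have "(n - 3) * k\<^sup>2 \<le> (n - 3) * q\<^sup>2" using k k0 n11 by (intro mult_left_mono power_mono) auto
  then have "2 * k + (n - 3) * k\<^sup>2 \<le> 1 - l"
    using k main by (simp add: field_simps power2_eq_square)
  moreover have "(n - 3) * k\<^sup>2 = (n * h) * (h * (1 + 619/1000 * h)\<^sup>2) - 3 * (h * (1 + 619/1000 * h))\<^sup>2"
    by (simp add: k_def field_simps power2_eq_square)
  ultimately have "2 * (h * (1 + 619/1000 * h)) + h * (1 + 619/1000 * h)\<^sup>2 - 3 * (h * (1 + 619/1000 * h))\<^sup>2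
      \<le> 3 * h - 2 * h\<^sup>2 + 12 * h ^ 3"
    using l unfolding n by (simp add: k_def)
  moreover have "2 * (h * (1 + 619/1000 * h)) + h * (1 + 619/1000 * h)\<^sup>2 - 3 * (h * (1 + 619/1000 * h))\<^sup>2
      - (3 * h - 2 * h\<^sup>2 + 12 * h ^ 3) = h\<^sup>2 * (1476/1000 - 15331/1000 * h - 115/100 * h\<^sup>2)
      + h ^ 3 * (161/1000000) + h\<^sup>2 * h\<^sup>2 * (517/1000000)"
    by (simp add: field_simps power2_eq_square power3_eq_cube)
  moreover have "0 \<le> h ^ 3 * (161/1000000)" "0 \<le> h\<^sup>2 * h\<^sup>2 * (517/1000000)" using h by simp_all
  ultimately have "h\<^sup>2 * (1476/1000 - 15331/1000 * h - 115/100 * h\<^sup>2) \<le> 0" by linarith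
  moreover have "0 < h\<^sup>2 * (1476/1000 - 15331/1000 * h - 115/100 * h\<^sup>2)"
  proof (rule mult_pos_pos)
    have "h\<^sup>2 \<le> (1/11)\<^sup>2" using h by (intro power_mono) auto
    then show "0 < 1476/1000 - 15331/1000 * h - 115/100 * h\<^sup>2" using h by (simp add: power2_eq_square)
  qed (use h in simp)
  ultimately show False by simp
qed


lemma pair_prod_ge:
  assumes "p \<in> nsets B 2" "\<And>j. j \<in> B \<Longrightarrow> c \<le> x j" "0 \<le> (c::real)"
  shows "c\<^sup>2 \<le> prod x p"
proof -
  obtain a b where ab: "p = {a, b}" "a \<in> B" "b \<in> B" "a \<noteq> b" using pairE[OF assms(1)] by metis
  have "c * c \<le> x a * x b" using assms(2)[OF ab(2)] assms(2)[OF ab(3)] assms(3) by (intro mult_mono) auto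
  then show ?thesis using ab by (simp add: power2_eq_square)
qed

text \<open>The degree \<open>l / 2\<close> is so close to its maximum for \<open>Suc N\<close> vertices that no vertex can be much heavier
than \<open>1 / N\<close>; the factor \<open>28/25\<close> suffices from \<open>N = 11\<close> on.\<close>

lemma vertex_weight_le:
  fixes h :: real
  assumes V: "finite V" "card V = Suc N" "11 \<le> N" and F: "F \<subseteq> nsets V 3" and x: "x \<in> weightings V" and v: "v \<in> V"
    and deg: "2 * wdeg F x v = l" and h: "h = 1 / real N" and l: "1 - 3 * h + 2 * h\<^sup>2 - 12 * h ^ 3 \<le> l"
  shows "x v \<le> 28/25 * h"
proof (rule ccontr)
  assume c: "\<not> ?thesis"
  have hh: "0 < h" "h \<le> 1/11" "real N * h = 1" using V(3) by (auto simp: h divide_simps)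
  have nn: "0 \<le> x i" if "i \<in> V" for i using x that by (auto simp: weightings_def)
  have sV: "sum x V = 1" using x by (auto simp: weightings_def)
  have x1: "x v \<le> 1" using member_le_sum[of v V x] V v nn sV by auto
  define S where "S = (\<Sum>i\<in>V - {v}. (x i)\<^sup>2)"
  have sv: "sum x (V - {v}) = 1 - x v" using V v sV by (simp add: sum_diff1)
  have "card (V - {v}) = N" using V v by simp
  then have "(1 - x v)\<^sup>2 \<le> S * real N"
    using sum_squared_le_sum_of_squares[of x "V - {v}"] unfolding sv S_def by simp
  then have "h * (1 - x v)\<^sup>2 \<le> h * (S * real N)" using hh by (intro mult_left_mono) auto
  also have "\<dots> = S * (real N * h)" by simp
  also have "\<dots> = S" unfolding hh(3) by simp
  finally have "l \<le> (1 - h) * (1 - x v)\<^sup>2"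
    using vertex_bound[OF V(1) F x v] deg unfolding S_def by (simp add: algebra_simps)
  also have "\<dots> \<le> (1 - h) * (1 - 28/25 * h)\<^sup>2"
    using c x1 hh by (intro mult_left_mono power_mono) auto
  finally have "h * (24/100 - 14944/10000 * h - (107456/10000) * h\<^sup>2) \<le> 0"
    using l by (simp add: field_simps power2_eq_square power3_eq_cube)
  moreover have "h\<^sup>2 \<le> (1/11)\<^sup>2" using hh by (intro power_mono) auto
  then have "0 < h * (24/100 - 14944/10000 * h - (107456/10000) * h\<^sup>2)"
    using hh by (intro mult_pos_pos) (auto simp: power2_eq_square)
  ultimately show False by simp
qed

text \<open>Each vertex lies in at most one missing triple, which takes at most \<open>Y\<^sup>2\<close> from its degree, where \<open>Y\<close> is the
largest weight in \<open>A\<close>. Since the second lightest vertex weighs more than \<open>Y / 2\<close>, any four pairs that avoid the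
lightest vertex outweigh \<open>Y\<^sup>2\<close>.\<close>

lemma no_optimum_if_missing_disjoint:
  assumes A: "finite A" "11 \<le> card A" "t \<notin> A"
    and f: "f1 \<in> nsets A 3" "f2 \<in> nsets A 3" "f1 \<inter> f2 = {}"
    and M: "M \<subseteq> nsets A 2" "card A + 3 \<le> card M"
    and x: "x \<in> weightings (insert t A)"
      "lagrange_poly (config t A {f1, f2} M) x = lagrangian (config t A {f1, f2} M)"
    and pos: "\<And>v. v \<in> insert t A \<Longrightarrow> 0 < x v"
    and deg: "\<And>v. v \<in> insert t A \<Longrightarrow> 2 * wdeg (edges (config t A {f1, f2} M)) x v = l"
    and h: "h = 1 / real (card A)" and l: "1 - 3 * h + 2 * h\<^sup>2 - 12 * h ^ 3 \<le> l"
  shows False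
proof -
  define T where "T = {f1, f2}"
  define F where "F = edges (config t A T M)"
  define V where "V = insert t A"
  define z where "z = x t"
  define w where "w j = wdeg M x j" for j
  define m where "m j = wdeg T x j" for j
  note xT = x[folded T_def]
  have hh: "0 < h" "h \<le> 1/11" "real (card A) * h = 1" using A(2) by (auto simp: h divide_simps)
  have TA: "T \<subseteq> nsets A 3" using f by (auto simp: T_def)
  have FV: "F \<subseteq> nsets V 3" using config_graph[OF A(1)] by (simp add: F_def V_def is_three_graph_def)
  have V: "finite V" "card V = Suc (card A)" using A by (auto simp: V_def)
  have xV: "x \<in> weightings V" using x by (simp add: V_def)
  have posA: "0 < x j" if "j \<in> A" for j using pos that by simp
  have nn: "0 \<le> x j" if "j \<in> A" for j using posA[OF that] by simp
  have z: "0 < z" using pos[of t] by (simp add: z_def)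
  have sA: "sum x A = 1 - z" using x A(1,3) by (simp add: weightings_def z_def)
  have degV: "2 * wdeg F x v = l" if "v \<in> V" for v using deg that by (simp add: F_def T_def V_def)
  have up: "x v \<le> 28/25 * h" if "v \<in> V" for v
    by (rule vertex_weight_le[OF V A(2) FV xV that degV[OF that] h l])
  have up': "x v \<le> 51/500" if "v \<in> V" for v using up[OF that] hh by simp
  have E: "x j * (1 - x j) + z * w j + m j = z * (1 - z) + wsum M x" if j: "j \<in> A" for j
    using config_kkt(1)[OF A(1,3) TA M(1) xT j] config_kkt(2)[OF A(1,3) TA M(1) xT j] z posA[OF j]
    by (simp add: z_def w_def m_def)
  have w0: "0 \<le> w j" for j unfolding w_def using M(1) nn by (rule wdeg_nonneg')
  have m0: "0 \<le> m j" for j unfolding m_def using TA nn by (rule wdeg_nonneg')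
  have ne: "A \<noteq> {}" using A(2) by auto
  obtain jm where jm: "jm \<in> A" "\<And>j. j \<in> A \<Longrightarrow> x j \<le> x jm"
    using obtain_min[of A "\<lambda>j. - x j"] A by auto
  define Y where "Y = x jm"
  have Y: "0 < Y" "Y \<le> 51/500" using posA[OF jm(1)] up'[of jm] jm by (auto simp: Y_def V_def)
  obtain i where i: "i \<in> A" "\<And>j. j \<in> A \<Longrightarrow> x i \<le> x j" using obtain_min[of A x] A by auto
  obtain v1 where v1: "v1 \<in> A - {i}" "\<And>j. j \<in> A - {i} \<Longrightarrow> x v1 \<le> x j"
    using obtain_min[of "A - {i}" x] A i by auto
  have v1A: "v1 \<in> A" "v1 \<noteq> i" using v1 by auto
  have mY: "m j \<le> Y\<^sup>2" for j
  proof -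
    have one: "prod x (f - {j}) \<le> Y\<^sup>2" if "f \<in> nsets A 3" "j \<in> f" for f
    proof -
      have "card (f - {j}) = 2" "f \<subseteq> A" using that by (auto simp: nsets_def)
      then obtain a b where ab: "f - {j} = {a, b}" "a \<noteq> b" "a \<in> A" "b \<in> A" by (auto simp: card_2_iff)
      have "x a * x b \<le> Y * Y" using jm ab nn Y by (intro mult_mono) (auto simp: Y_def)
      then show ?thesis using ab by (simp add: power2_eq_square)
    qed
    consider "j \<in> f1" "{e\<in>T. j \<in> e} = {f1}" | "j \<in> f2" "{e\<in>T. j \<in> e} = {f2}" | "{e\<in>T. j \<in> e} = {}"
      using f(3) unfolding T_def by blast
    then show ?thesis
    proof cases
      case 1 then show ?thesis unfolding m_def wdeg_def using one[OF f(1)] by simp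
    next
      case 2 then show ?thesis unfolding m_def wdeg_def using one[OF f(2)] by simp
    next
      case 3 then show ?thesis unfolding m_def wdeg_def 3 by simp
    qed
  qed
  define J where "J = {j \<in> A - {i}. {i, j} \<notin> M}"
  define L where "L = {p\<in>M. i \<notin> p}"
  define d where "d = card J"
  have cL: "4 + d \<le> card L" unfolding d_def J_def L_def by (rule card_avoiding[OF A(1) M(1) i(1) M(2)])
  have fM: "finite M" using A(1) M(1) finite_subset finite_imp_finite_nsets by blast
  have LB: "p \<in> nsets (A - {i}) 2" if "p \<in> L" for p
    using avoiding_pair_in[OF M(1)] that unfolding L_def .
  have low: "(4 + real d) * (x v1)\<^sup>2 \<le> wsum L x"
  proof -
    have "(4 + real d) * (x v1)\<^sup>2 \<le> real (card L) * (x v1)\<^sup>2" using cL by (intro mult_right_mono) auto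
    also have "\<dots> \<le> wsum L x"
      unfolding wsum_def using pair_prod_ge[OF LB, of _ "x v1" x] v1 nn[OF v1A(1)]
      by (intro sum_bounded_below) auto
    finally show ?thesis .
  qed
  have piv: "wsum L x \<le> (x i - z) * sum x J + m i"
    unfolding L_def J_def using E[OF i(1)]
    by (intro pivot_sum[OF A(1) i(1) M(1) sA]) (simp add: w_def)
  have Jdef: "sum x J = 1 - z - x i - w i"
    using pairs_at_complement(1)[OF A(1) M(1) i(1), of x] sA by (simp add: J_def w_def)
  have J0: "0 \<le> sum x J" unfolding J_def using nn by (intro sum_nonneg) auto
  have au: "x i \<le> x v1" using i v1A by simp
  have half: "Y / 2 < x v1"
  proof (rule second_lightest_real[OF Y nn[OF i(1)] au])
    show "0 \<le> z" "z \<le> 51/500" using z up'[of t] by (auto simp: z_def V_def)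
    show "0 \<le> w v1" by (rule w0)
    have Da: "sum x {j \<in> A - {v1}. {v1, j} \<notin> M} = 1 - z - x v1 - w v1"
      using pairs_at_complement(1)[OF A(1) M(1) v1A(1), of x] sA by (simp add: w_def)
    moreover have "0 \<le> sum x {j \<in> A - {v1}. {v1, j} \<notin> M}" using nn by (intro sum_nonneg) auto
    ultimately show "w v1 \<le> 1 - z - x v1" by simp
    have "0 \<le> z * w jm" using z w0 by simp
    then show "(Y - x v1) * (1 - Y - x v1) \<le> z * w v1 + Y\<^sup>2"
      using E[OF jm(1)] E[OF v1A(1)] m0[of jm] mY[of v1] by (simp add: Y_def algebra_simps)
    have "wsum {p\<in>M. v1 \<notin> p} x \<le> (x v1 - z) * (1 - z - x v1 - w v1) + m v1"
      unfolding Da[symmetric] using E[OF v1A(1)]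
      by (intro pivot_sum[OF A(1) v1A(1) M(1) sA]) (simp add: w_def)
    moreover have "0 \<le> wsum {p\<in>M. v1 \<notin> p} x"
      using M(1) nn by (intro wsum_nonneg[of _ A 2]) auto
    ultimately show "(z - x v1) * (1 - z - x v1 - w v1) \<le> Y\<^sup>2"
      using mY[of v1] by (simp add: algebra_simps)
    have uw: "x v1 * (w v1 - x i) \<le> wsum L x"
    proof -
      have LA: "L \<subseteq> nsets A 2" using M(1) by (auto simp: L_def)
      have "w v1 \<le> x i + wdeg L x v1"
        unfolding w_def pairs_at(1)[OF A(1) M(1) v1A(1)] pairs_at(1)[OF A(1) LA v1A(1)]
      proof -
        let ?K = "{j \<in> A - {v1}. {v1, j} \<in> L}"
        have "sum x {j \<in> A - {v1}. {v1, j} \<in> M} \<le> sum x (insert i ?K)"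
          using A(1) i(1) nn v1A by (intro sum_mono2) (auto simp: L_def)
        also have "\<dots> = x i + sum x ?K"
          using A(1) by (subst sum.insert) (auto simp: L_def)
        finally show "sum x {j \<in> A - {v1}. {v1, j} \<in> M} \<le> x i + sum x ?K" .
      qed
      then have "x v1 * (w v1 - x i) \<le> x v1 * wdeg L x v1" using nn[OF v1A(1)] by (intro mult_left_mono) auto
      also have "\<dots> \<le> wsum {p\<in>L. v1 \<notin> p} x + x v1 * wdeg L x v1"
        using LA nn wsum_nonneg[of "{p\<in>L. v1 \<notin> p}" A 2 x] by auto
      also have "\<dots> = wsum L x"
      proof (rule wsum_split[symmetric])
        show "finite L" using fM by (simp add: L_def)
        show "finite e" if "e \<in> L" for e using that LA by (auto simp: nsets_def)
      qed
      finally show ?thesis .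
    qed
    show "x v1 * (w v1 - x i) \<le> x i - z + Y\<^sup>2" if "z < x i"
    proof -
      have "sum x J \<le> 1" using Jdef z nn[OF i(1)] w0[of i] by simp
      then have "(x i - z) * sum x J \<le> (x i - z) * 1" using that by (intro mult_left_mono) auto
      then have "(x i - z) * sum x J \<le> x i - z" by (simp only: mult_1_right)
      then show ?thesis using uw piv mY[of i] by linarith
    qed
    show "x v1 * (w v1 - x i) \<le> Y\<^sup>2" if "x i \<le> z"
    proof -
      have "(x i - z) * sum x J \<le> 0" using that J0 by (intro mult_nonpos_nonneg) auto
      then show ?thesis using uw piv mY[of i] by linarith
    qed
    show "17/100 * Y \<le> x v1"
    proof (rule ccontr)
      assume c: "\<not> ?thesis"
      define p where "p = x i + x v1"
      have "Y \<le> 28/25 * h" using up[of jm] jm by (simp add: Y_def V_def)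
      then have p: "p \<le> 381/1000 * h" using c au hh by (simp add: p_def)
      define B where "B = V - {i, v1}"
      define q where "q = (1 - p) / (real (card A) - 1)"
      have "{i, v1} \<subseteq> V" using i v1A by (auto simp: V_def)
      then have cB: "card B = card A - 1" using V v1A(2) by (simp add: B_def card_Diff_subset)
      then have rB: "real (card B) = real (card A) - 1" using A(2) by (simp add: of_nat_diff)
      have sV: "sum x V = 1" using xV by (simp add: weightings_def)
      have sB: "sum x B = 1 - p"
        using V(1) \<open>{i, v1} \<subseteq> V\<close> v1A(2) sV by (simp add: B_def sum_diff p_def)
      have qe: "(real (card A) - 1) * q = 1 - p" using A(2) by (simp add: q_def)
      have "\<exists>v\<in>B. q \<le> x v"
      proof (rule ccontr)
        assume "\<not> ?thesis"
        then have "sum x B < real (card B) * q"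
          using A(2) cB V(1) by (intro sum_bounded_above_strict) auto
        then show False using sB qe rB by simp
      qed
      then obtain v where v: "v \<in> B" "q \<le> x v" by blast
      have vV: "v \<in> V" using v by (simp add: B_def)
      have "(sum x B)\<^sup>2 \<le> (\<Sum>j\<in>B. (x j)\<^sup>2) * real (card B)" by (rule sum_squared_le_sum_of_squares)
      then have "((real (card A) - 1) * q)\<^sup>2 \<le> (\<Sum>j\<in>B. (x j)\<^sup>2) * (real (card A) - 1)"
        unfolding sB rB qe .
      then have "(real (card A) - 1) * ((real (card A) - 1) * q\<^sup>2) \<le> (real (card A) - 1) * (\<Sum>j\<in>B. (x j)\<^sup>2)"
        by (simp add: power2_eq_square algebra_simps)
      then have "(real (card A) - 1) * q\<^sup>2 \<le> (\<Sum>j\<in>B. (x j)\<^sup>2)" using A(2) by simp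
      also have "\<dots> \<le> (\<Sum>j\<in>V. (x j)\<^sup>2)" using V(1) by (intro sum_mono2) (auto simp: B_def)
      also have "\<dots> = (\<Sum>j\<in>V - {v}. (x j)\<^sup>2) + (x v)\<^sup>2" using V(1) vV by (simp add: sum_diff1)
      finally have "(real (card A) - 1) * q\<^sup>2 + l \<le> (1 - x v)\<^sup>2 + (x v)\<^sup>2"
        using vertex_bound[OF V(1) FV xV vV] degV[OF vV] by linarith
      moreover have "0 \<le> (x v - q) * (1 - x v - q)" using v(2) up'[OF vV] by (intro mult_nonneg_nonneg) auto
      ultimately have "2 * q * (1 - q) + (real (card A) - 1) * q\<^sup>2 \<le> 1 - l"
        by (simp add: algebra_simps power2_eq_square)
      then show False by (rule two_light_vertices_inconsistent[OF hh(1,2,3) p l qe])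
    qed
  qed
  show False
  proof (cases "i \<in> f1 \<union> f2")
    case False
    then have "{e\<in>T. i \<in> e} = {}" by (auto simp: T_def)
    then have mi: "wdeg T x i = 0" unfolding wdeg_def by (simp only: sum.empty)
    have "wsum L x \<le> 0 \<or> wsum L x < real d * (x i)\<^sup>2 + 0 * (1 + real d / (real (card A) - 2))"
      unfolding L_def using A(2) z
      by (intro pivot_config[OF A(1) _ A(3) TA M(1) xT _ i d_def[unfolded J_def] mi[symmetric]]) (auto simp: z_def)
    moreover have "(x i)\<^sup>2 \<le> (x v1)\<^sup>2" using au nn[OF i(1)] by (intro power_mono)
    then have "real d * (x i)\<^sup>2 \<le> real d * (x v1)\<^sup>2" by (intro mult_left_mono) auto
    moreover have "0 < (x v1)\<^sup>2" using posA[OF v1A(1)] by simp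
    moreover have "0 \<le> real d * (x v1)\<^sup>2" by simp
    moreover have "(4 + real d) * (x v1)\<^sup>2 = 4 * (x v1)\<^sup>2 + real d * (x v1)\<^sup>2" by (rule distrib_right)
    ultimately show False using low by linarith
  next
    case True
    have fJ: "finite J" using A(1) by (simp add: J_def)
    have "sum x J \<le> real (card J) * Y" using jm by (intro sum_bounded_above) (auto simp: Y_def J_def)
    then have D: "sum x J \<le> real d * Y" by (simp add: d_def)
    have "d \<le> card A" unfolding d_def J_def using A(1) by (intro card_mono) auto
    moreover have "Y \<le> 28/25 * h" using up[of jm] jm by (simp add: Y_def V_def)
    ultimately have "real d * Y \<le> real (card A) * (28/25 * h)" using Y by (intro mult_mono) auto
    also have "\<dots> = 28/25 * (real (card A) * h)" by simp
    finally have dY: "real d * Y \<le> 28/25" unfolding hh(3) by simp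
    have L1: "wsum L x \<le> (x i - z) * sum x J + Y\<^sup>2" using piv mY[of i] by linarith
    have "w i - w jm \<le> 1 - z - 2 * x i"
    proof (cases "jm = i \<or> {i, jm} \<notin> M")
      case True
      then have "x i \<le> sum x J \<or> jm = i"
      proof (cases "jm = i")
        case False
        then have "jm \<in> J" using True jm by (simp add: J_def)
        then have "x jm \<le> sum x J" using fJ nn by (intro member_le_sum) (auto simp: J_def)
        then show ?thesis using i(2)[OF jm(1)] by linarith
      qed simp
      then show ?thesis
      proof
        assume "x i \<le> sum x J"
        then show ?thesis using Jdef w0[of jm] by linarith
      next
        assume "jm = i"
        have "2 * x i \<le> 51/250" "z \<le> 51/500" using up'[of i] up'[of t] i by (auto simp: z_def V_def)
        then show ?thesis using \<open>jm = i\<close> by simp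
      qed
    next
      case False
      have "x i \<le> w jm"
        unfolding w_def pairs_at(1)[OF A(1) M(1) jm(1)]
        using False A(1) i nn by (intro member_le_sum) (auto simp: insert_commute)
      then show ?thesis using Jdef J0 by linarith
    qed
    then have "z * (w i - w jm) \<le> z * (1 - z - 2 * x i)" using z by (intro mult_left_mono) auto
    then have "(Y - x i) * (1 - Y - x i) \<le> z * (1 - z - 2 * x i) + Y\<^sup>2"
      using E[OF jm(1)] E[OF i(1)] m0[of jm] mY[of i] by (simp add: Y_def algebra_simps)
    then have g: "(Y - x i - z) * (1 - z - x i - Y) \<le> Y\<^sup>2" by (simp add: algebra_simps power2_eq_square)
    have gap: "(Y - x i - z) * (347/500) \<le> Y\<^sup>2"
    proof (cases "Y - x i - z \<le> 0")
      case True
      then have "(Y - x i - z) * (347/500) \<le> 0" by (intro mult_nonpos_nonneg) auto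
      then show ?thesis using zero_le_power2[of Y] by linarith
    next
      case False
      have "x i \<le> 51/500" "z \<le> 51/500" using up'[of i] up'[of t] i by (auto simp: z_def V_def)
      then have "(Y - x i - z) * (347/500) \<le> (Y - x i - z) * (1 - z - x i - Y)"
        using False Y by (intro mult_left_mono) auto
      then show ?thesis using g by linarith
    qed
    show False
      by (rule disjoint_inequalities_inconsistent[OF Y nn[OF i(1)] au half less_imp_le[OF z] _ dY J0 D L1 low gap]) simp
  qed
qed

section \<open>The theorem\<close>

lemma choose_2_real: "real (k choose 2) = real k * (real k - 1) / 2"
proof (cases k)
  case (Suc j)
  have "even (k * (k - 1))" using Suc by simp
  then have "2 * (k choose 2) = k * (k - 1)" by (simp add: choose_two)
  then have "2 * real (k choose 2) = real (k * (k - 1))" by (metis of_nat_mult of_nat_numeral)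
  then show ?thesis using Suc by (simp add: algebra_simps)
qed simp

lemma choose_3_real: "real (k choose 3) = real k * (real k - 1) * (real k - 2) / 6"
proof (induction k)
  case (Suc k)
  have "Suc k choose 3 = (k choose 2) + (k choose 3)" by (simp add: eval_nat_numeral)
  then show ?case using Suc choose_2_real[of k] by (simp add: field_simps)
qed (simp add: eval_nat_numeral)

lemma card_nsets_real:
  assumes "finite A"
  shows "real (card (nsets A 3)) = real (card A) * (real (card A) - 1) * (real (card A) - 2) / 6"
    and "real (card (nsets A 2)) = real (card A) * (real (card A) - 1) / 2"
  using choose_3_real[of "card A"] choose_2_real[of "card A"] assms by simp_all

lemma config_eq:
  assumes "finite A" "t \<notin> A" "F \<subseteq> nsets (insert t A) 3"
  shows "F = edges (config t A (nsets A 3 - F) {p \<in> nsets A 2. insert t p \<notin> F})"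
proof -
  have "nsets (insert t A) 3 = nsets A 3 \<union> insert t ` nsets A 2"
    using nsets_insert_Suc[OF assms(1,2), of 2] by (simp add: eval_nat_numeral)
  moreover have "t \<in> insert t p" "e \<in> nsets A 3 \<Longrightarrow> t \<notin> e" for p e
    using assms(2) by (auto simp: nsets_def)
  ultimately show ?thesis using assms(3) unfolding config_def by auto
qed

theorem theorem5p1:
  fixes m t n :: nat and H :: "nat three_graph"
  assumes "m > 0" and "t \<ge> 12"
    and "(t - 1) choose 3 \<le> m"
    and "m \<le> ((t - 1) choose 3) + ((t - 2) choose 2) - 6"
    and "is_three_graph H" and "verts H = {1..n}"
    and "card (edges H) = m"
    and "card (nsets {1..t - 1} 3 - edges H) = 2"
  shows "\<not> dense H"
proof
  assume dense: "dense H"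
  define A where "A = {1..t - 1}"
  define N where "N = card A"
  define h where "h = 1 / real N"
  define F where "F = edges H"
  have A: "finite A" "card A = t - 1" "N = t - 1" "11 \<le> N" "t \<notin> A" "insert t A = {1..t}"
    using assms(2) by (auto simp: A_def N_def)
  have F: "F \<subseteq> nsets {1..n} 3" "finite F" using assms(5,6) edges_finite(1)[OF assms(5)] by (auto simp: is_three_graph_def F_def)
  have hh: "0 < h" "real N * h = 1" using A by (auto simp: h_def)
  obtain f1 f2 where f: "nsets A 3 - F = {f1, f2}" "f1 \<noteq> f2"
    using assms(8) by (auto simp: card_2_iff A_def F_def)
  have fA: "f1 \<in> nsets A 3" "f2 \<in> nsets A 3" using f(1) by auto
  have finA: "finite (nsets A 3)" using A(1) by (rule finite_imp_finite_nsets)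
  have inside: "real (card (nsets A 3 \<inter> F)) = real (card (nsets A 3)) - 2"
  proof -
    have "card (nsets A 3) = card (nsets A 3 \<inter> F) + card (nsets A 3 - F)"
      using card_Int_Diff[OF finA] by blast
    then show ?thesis using assms(8) by (simp add: A_def F_def)
  qed
  have split: "real m = real (card (nsets A 3 \<inter> F)) + real (card (F - nsets A 3))"
  proof -
    have "card F = card (F \<inter> nsets A 3) + card (F - nsets A 3)" using card_Int_Diff[OF F(2)] by blast
    then show ?thesis using assms(7) by (simp add: F_def Int_commute)
  qed
  have N3: "real (card (nsets A 3)) = real ((t - 1) choose 3)" using A by simp
  have outside: "2 * real (card (F - nsets A 3)) \<le> real N ^ 2 - 3 * real N - 6"
  proof -
    have "real (t - 2) = real N - 1" using A by (simp add: of_nat_diff)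
    then have c2: "real ((t - 2) choose 2) = (real N - 1) * (real N - 2) / 2"
      using choose_2_real[of "t - 2"] by simp
    moreover have "10 * 9 \<le> (real N - 1) * (real N - 2)" using A(4) by (intro mult_mono) auto
    ultimately have "6 \<le> (t - 2) choose 2" by linarith
    then have "m + 6 \<le> ((t - 1) choose 3) + ((t - 2) choose 2)" using assms(4) by linarith
    then have "real m + 6 \<le> real ((t - 1) choose 3) + real ((t - 2) choose 2)"
      by (metis of_nat_add of_nat_le_iff of_nat_numeral)
    moreover note c2
    ultimately have "real (card (F - nsets A 3)) \<le> (real N - 1) * (real N - 2) / 2 - 4"
      using split inside N3 by linarith
    then show ?thesis by (simp add: field_simps power2_eq_square)
  qed
  have "F - nsets A 3 \<noteq> {}"
  proof
    assume "F - nsets A 3 = {}"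
    then have "card (F - nsets A 3) = 0" by (simp only: card.empty)
    then have "real m = real ((t - 1) choose 3) - 2" using split inside N3 by linarith
    then show False using assms(3) by linarith
  qed
  then obtain e where e: "e \<in> F" "e \<notin> nsets A 3" by blast
  then have "\<not> e \<subseteq> A" "e \<subseteq> {1..n}" using F(1) by (auto simp: nsets_def)
  moreover have "{1..n} \<subseteq> A" if "\<not> t \<le> n" using that by (auto simp: A_def)
  ultimately have tn: "t \<le> n" by blast
  have ne: "verts H \<noteq> {}" using tn assms(2,6) by simp
  obtain x where x: "x \<in> weightings (verts H)" "lagrange_poly H x = lagrangian H"
    "\<And>v. v \<in> verts H \<Longrightarrow> 0 < x v" "\<And>v. v \<in> verts H \<Longrightarrow> wdeg (edges H) x v = 3 * lagrangian H"
    using dense_optimum[OF dense assms(5) ne] by blast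
  define l where "l = 6 * lagrangian H"
  have deg: "2 * wdeg F x v = l" if "v \<in> verts H" for v using x(4)[OF that] by (simp add: F_def l_def)
  have AV: "A \<subseteq> verts H" "A \<noteq> verts H" "A \<noteq> {}"
    using tn assms(2,6) A(5) by (auto simp: A_def)
  have mu: "lagrangian (Three_Graph A (nsets A 3 \<inter> F)) < lagrangian H"
    by (rule subgraph_lagrangian_less[OF dense assms(5) AV(1) _ _ AV(3,2)]) (auto simp: F_def)
  have l: "1 - 3 * h + 2 * h\<^sup>2 - 12 * h ^ 3 \<le> l"
  proof -
    have "is_three_graph (Three_Graph A (nsets A 3 \<inter> F))" using A(1) by (simp add: is_three_graph_def)
    then have "real (card (nsets A 3 \<inter> F)) / real N ^ 3 \<le> lagrangian (Three_Graph A (nsets A 3 \<inter> F))"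
      using lagrangian_ge_uniform[of "Three_Graph A (nsets A 3 \<inter> F)"] AV(3) by (simp add: N_def)
    then have "6 * (real (card (nsets A 3 \<inter> F)) / real N ^ 3) \<le> l" using mu by (simp add: l_def)
    moreover have "6 * (real (card (nsets A 3 \<inter> F)) / real N ^ 3) = 1 - 3 * h + 2 * h\<^sup>2 - 12 * h ^ 3"
      using A(4) unfolding inside card_nsets_real(1)[OF A(1)] N_def[symmetric] h_def
      by (simp add: field_simps power2_eq_square power3_eq_cube)
    ultimately show ?thesis by simp
  qed
  show False
  proof (cases "n = t")
    case False
    then have w: "t \<in> verts H" "t + 1 \<in> verts H" "t \<noteq> t + 1" using tn assms(2,6) by auto
    have "{e \<in> F. t \<in> e \<or> t + 1 \<in> e} \<subseteq> F - nsets A 3"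
    proof -
      have "t + 1 \<notin> A" by (simp add: A_def)
      then show ?thesis using A(5) by (auto simp: nsets_def)
    qed
    then have "card {e \<in> F. t \<in> e \<or> t + 1 \<in> e} \<le> card (F - nsets A 3)" using F(2) by (intro card_mono) auto
    then have E: "2 * real (card {e \<in> F. t \<in> e \<or> t + 1 \<in> e}) \<le> real N ^ 2 - 3 * real N - 6"
      using outside by linarith
    have lw: "l = 6 * wsum F x" using x(2) by (simp add: l_def F_def lagrange_poly_wsum)
    show False
      by (rule no_two_outer_vertices[OF _ _ x(1) deg lw w A(4) h_def E l]) (use F assms(6) in auto)
  next
    case True
    then have V: "verts H = insert t A" using assms(6) A(6) by simp
    define M where "M = {p \<in> nsets A 2. insert t p \<notin> F}"
    have FV: "F \<subseteq> nsets (insert t A) 3" using F(1) True A(6) by simp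
    have Fc: "F = edges (config t A {f1, f2} M)"
      using config_eq[OF A(1,5) FV] unfolding f(1) M_def .
    have Hc: "H = config t A {f1, f2} M"
      using Fc V by (cases H) (simp add: F_def config_def)
    have M: "M \<subseteq> nsets A 2" by (auto simp: M_def)
    have cM: "card A + 3 \<le> card M"
    proof -
      have fin2: "finite (nsets A 2)" using A(1) by (rule finite_imp_finite_nsets)
      have inj: "inj_on (insert t) (nsets A 2 - M)"
      proof (rule inj_onI)
        fix p q assume "p \<in> nsets A 2 - M" "q \<in> nsets A 2 - M" and eq: "insert t p = insert t q"
        then have "t \<notin> p" "t \<notin> q" using A(5) by (auto simp: nsets_def)
        then show "p = q" using eq insert_ident by metis
      qed
      have "insert t ` (nsets A 2 - M) \<subseteq> F - nsets A 3" using A(5) by (auto simp: M_def nsets_def)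
      then have "card (nsets A 2 - M) \<le> card (F - nsets A 3)"
        using card_mono[of "F - nsets A 3"] F(2) unfolding card_image[OF inj, symmetric] by blast
      moreover have "card (nsets A 2 - M) = card (nsets A 2) - card M"
        using M fin2 finite_subset by (intro card_Diff_subset) auto
      moreover have "card M \<le> card (nsets A 2)" using M fin2 by (intro card_mono)
      ultimately have "real (card (nsets A 2)) - real (card M) \<le> real (card (F - nsets A 3))" by linarith
      then have "2 * (real (card (nsets A 2)) - real (card M)) \<le> 2 * real (card (F - nsets A 3))" by simp
      also note outside
      finally have "real N + 3 \<le> real (card M)"
        unfolding card_nsets_real(2)[OF A(1)] N_def[symmetric] by (simp add: field_simps power2_eq_square)
      then show ?thesis unfolding N_def by linarith
    qed
    have clique: "nsets A 3 - {f1, f2} = nsets A 3 \<inter> F" using f(1) by auto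
    show False
    proof (cases "f1 \<inter> f2 = {}")
      case False
      have "lagrangian H \<le> lagrangian (Three_Graph A (nsets A 3 - {f1, f2}))"
        unfolding Hc using A N_def by (intro lagrangian_le_clique_if_missing_meet fA f False M cM) auto
      then show False using mu clique by simp
    next
      case True
      show False
      proof (rule no_optimum_if_missing_disjoint[OF A(1) _ A(5) fA True M cM _ _ _ _ _ l])
        show "11 \<le> card A" using A(4) unfolding N_def .
        show "x \<in> weightings (insert t A)" using x(1) unfolding V .
        show "lagrange_poly (config t A {f1, f2} M) x = lagrangian (config t A {f1, f2} M)"
          using x(2) unfolding Hc[symmetric] .
        show "0 < x v" if "v \<in> insert t A" for v using x(3) that unfolding V .
        show "2 * wdeg (edges (config t A {f1, f2} M)) x v = l" if "v \<in> insert t A" for v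
          using deg that unfolding V Fc[symmetric] .
        show "h = 1 / real (card A)" unfolding h_def N_def ..
      qed
    qed
  qed
qed

end
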